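(* In the $d$-dimensional Black–Scholes market of the context, let $l$ be a loss function and $H$ a contingent claim as described there. Assume in addition that $l''$ is increasing and that $\mathbf E[l'(H)H]<+\infty$ and $\mathbf E[l''(H)H^2]<+\infty$. For $v\in[0,\mathbf E[l(H)])$ let $c=c(v)\ge0$ be a solution of the equation $\Psi^l_1(c)=v$. Then $$\Phi^l_2(v)=\begin{cases}e^{-rT}\Psi^l_2(c(v)) & \text{for } v\in[0,\mathbf E[l(H)]),\\ 0 & \text{for } v\ge\mathbf E[l(H)].\end{cases}$$
   Context: Market. $(\Omega,\mathcal F,(\mathcal F_t)_{t\in[0,T]},P)$ is a filtered probability space with a $d$-dimensional Wiener process $W=(W^1,\dots,W^d)$ whose components are correlated with positive definite correlation matrix $Q=(\rho_{i,j})$, $\rho_{i,i}=1$, $\rho_{i,j}=\mathrm{cor}(W^i_1,W^j_1)$. Stocks: $dS^i_t=S^i_t(\alpha_i\,dt+\sigma_i\,dW^i_t)$, $\alpha_i\in\mathbb R$, $\sigma_i>0$; money market account $dB_t=rB_t\,dt$, $r$ constant. Let $\theta=\left(\frac{\alpha_1-r}{\sigma_1},\dots,\frac{\alpha_d-r}{\sigma_d}\right)^T$. The unique martingale measure $\tilde P$ has density $\frac{d\tilde P}{dP}=\tilde Z_T:=\exp\left(-(Q^{-1}\theta,W_T)-\tfrac12|Q^{-1/2}\theta|^2T\right)$. $\mathbf E,\tilde{\mathbf E}$ denote expectations under $P,\tilde P$. The market is complete (e.g. the filtration is the augmented filtration generated by $W$): every nonnegative $\mathcal F_T$-measurable payoff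 $G$ with $\tilde{\mathbf E}[e^{-rT}G]<\infty$ is replicated by an admissible self-financing strategy with initial capital $\tilde{\mathbf E}[e^{-rT}G]$. Strategies. Wealth process: $X^{x,\pi}_t=\pi^0_tB_t+\sum_{i=1}^d\pi^i_tS^i_t$, $X_0^{x,\pi}=x$; strategies are self-financing, $dX^{x,\pi}_t=\pi^0_t\,dB_t+\sum_i\pi^i_t\,dS^i_t$, and admissible, $X^{x,\pi}_t\ge0$ for all $t\in[0,T]$ a.s. Loss function. $l:[0,\infty)\to[0,\infty)$ is increasing, strictly convex, $l(0)=0$, $l\in C^2(0,\infty)$, $l'$ strictly increasing with $l'(0+)=0$, $l'(+\infty)=+\infty$; $I:=(l')^{-1}$ (with $I(0)=0$). Expressions $l'(H)H$ and $l''(H)H^2$ are read as $0$ on $\{H=0\}$. Claim. $H\ge0$ is $\mathcal F_T$-measurable with $\mathbf E[e^{-rT}\tilde Z_TH]<\infty$ and $\mathbf E[l(H)]<\infty$. Cost reduction function: $\Phi^l_2(v):=\min\{x:\exists\pi\ \text{s.t.}\ \mathbf E[l((H-X^{x,\pi}_T)^+)]\le v\}$, $v\ge0$. Auxiliary functions. For $c\ge0$: $\varphi_c:=\left\{1-\left(\frac{I(c\tilde Z_T)}{H}\wedge1\right)\right\}\mathbf 1_{\{H>0\}}$, $\Psi^l_1(c):=\mathbf E[l((1-\varphi_c)H)]$, $\Psi^l_2(c):=\tilde{\mathbf E}[H\varphi_c]$. *)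

theory Defs
  imports "HOL-Probability.Probability"
begin

section \<open>The Ito integral\<close>

definition progressive ::
  "(real \<Rightarrow> 'w measure) \<Rightarrow> real \<Rightarrow> (real \<Rightarrow> 'w \<Rightarrow> real) \<Rightarrow> bool" where
  "progressive F T K \<longleftrightarrow>
     (\<forall>t\<in>{0..T}. (\<lambda>(s, \<omega>). K s \<omega>) \<in> borel_measurable (restrict_space borel {0..t} \<Otimes>\<^sub>M F t))"

text \<open>A list of triples \<open>(s, t, \<xi>)\<close> encodes the simple process
  \<open>\<Sum> \<xi> 1\<^bsub>(s,t]\<^esub>\<close>, where \<open>\<xi>\<close> is bounded and \<open>F s\<close>-measurable; the intervals may overlap.\<close>

type_synonym 'w simple = "(real \<times> real \<times> ('w \<Rightarrow> real)) list"

definition simple_process :: "(real \<Rightarrow> 'w measure) \<Rightarrow> real \<Rightarrow> 'w simple \<Rightarrow> bool" where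
  "simple_process F T hs \<longleftrightarrow>
     (\<forall>(s, t, \<xi>)\<in>set hs. 0 \<le> s \<and> s \<le> t \<and> t \<le> T \<and>
        \<xi> \<in> borel_measurable (F s) \<and> bounded (\<xi> ` space (F s)))"

definition simple_value :: "'w simple \<Rightarrow> real \<Rightarrow> 'w \<Rightarrow> real" where
  "simple_value hs u \<omega> = (\<Sum>(s, t, \<xi>)\<leftarrow>hs. \<xi> \<omega> * indicator {s<..t} u)"

definition simple_integral :: "(real \<Rightarrow> 'w \<Rightarrow> real) \<Rightarrow> 'w simple \<Rightarrow> real \<Rightarrow> 'w \<Rightarrow> real" where
  "simple_integral V hs u \<omega> = (\<Sum>(s, t, \<xi>)\<leftarrow>hs. \<xi> \<omega> * (V (min t u) \<omega> - V (min s u) \<omega>))"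

text \<open>\<open>Y\<close> is (a version of) the Ito integral process \<open>\<integral> K dV\<close> on \<open>[0,T]\<close>, for a Brownian motion
  \<open>V\<close> and a progressively measurable \<open>K\<close> with \<open>\<integral>\<^sub>0\<^sup>T K\<^sup>2 dt < \<infinity>\<close> almost surely: simple processes
  converge to \<open>K\<close> in \<open>L\<^sup>2[0,T]\<close> and their integrals converge to \<open>Y\<close> uniformly on \<open>[0,T]\<close>. The usual
  definition asks for both convergences in probability. Since the approximating sequence is
  existentially quantified, almost sure convergence gives the same notion (pass to a
  subsequence), and it needs no measurability of suprema.\<close>

definition ito_integral :: "'w measure \<Rightarrow> (real \<Rightarrow> 'w measure) \<Rightarrow> real \<Rightarrow> (real \<Rightarrow> 'w \<Rightarrow> real) \<Rightarrow>
    (real \<Rightarrow> 'w \<Rightarrow> real) \<Rightarrow> (real \<Rightarrow> 'w \<Rightarrow> real) \<Rightarrow> bool" where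
  "ito_integral M F T V K Y \<longleftrightarrow>
     progressive F T K \<and>
     (AE \<omega> in M. set_integrable lborel {0..T} (\<lambda>s. (K s \<omega>)\<^sup>2)) \<and>
     (\<exists>hs. (\<forall>n. simple_process F T (hs n)) \<and>
        (AE \<omega> in M.
           (\<lambda>n. LINT s:{0..T}|lborel. (simple_value (hs n) s \<omega> - K s \<omega>)\<^sup>2) \<longlonglongrightarrow> 0 \<and>
           uniform_limit {0..T} (\<lambda>n u. simple_integral V (hs n) u \<omega>) (\<lambda>u. Y u \<omega>) sequentially))"


section \<open>The Black--Scholes market\<close>

record ('w, 'n::finite) market =
  prob :: "'w measure"
  filt :: "real \<Rightarrow> 'w measure"
  horizon :: real
  corr :: "real^'n^'n"
  wiener :: "real \<Rightarrow> 'w \<Rightarrow> real^'n"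
  drift :: "real^'n"
  vol :: "real^'n"
  rate :: real
  bond :: "real \<Rightarrow> real"
  stock :: "real \<Rightarrow> 'w \<Rightarrow> real^'n"

definition filtered_prob_space ::
  "'w measure \<Rightarrow> (real \<Rightarrow> 'w measure) \<Rightarrow> real \<Rightarrow> bool" where
  "filtered_prob_space M F T \<longleftrightarrow> prob_space M \<and>
     (\<forall>t\<in>{0..T}. subalgebra M (F t)) \<and>
     (\<forall>s t. 0 \<le> s \<and> s \<le> t \<and> t \<le> T \<longrightarrow> subalgebra (F t) (F s))"

definition correlation_matrix :: "real^'n^'n \<Rightarrow> bool" where
  "correlation_matrix Q \<longleftrightarrow>
     transpose Q = Q \<and> (\<forall>x. x \<noteq> 0 \<longrightarrow> 0 < x \<bullet> (Q *v x)) \<and> (\<forall>i. Q $ i $ i = 1)"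

text \<open>Increments over \<open>[s,t]\<close> are independent of \<open>F s\<close> and jointly Gaussian with mean 0 and
  covariance \<open>(t - s) Q\<close>; the latter is expressed through the one-dimensional projections.\<close>

definition correlated_wiener :: "'w measure \<Rightarrow> (real \<Rightarrow> 'w measure) \<Rightarrow> real \<Rightarrow> real^'n^'n \<Rightarrow>
    (real \<Rightarrow> 'w \<Rightarrow> real^'n) \<Rightarrow> bool" where
  "correlated_wiener M F T Q W \<longleftrightarrow>
     (\<forall>t\<in>{0..T}. W t \<in> borel_measurable (F t)) \<and>
     (AE \<omega> in M. W 0 \<omega> = 0 \<and> continuous_on {0..T} (\<lambda>t. W t \<omega>)) \<and>
     (\<forall>s t. 0 \<le> s \<and> s < t \<and> t \<le> T \<longrightarrow>
        prob_space.indep_set M (sets (F s))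
          (sets (vimage_algebra (space M) (\<lambda>\<omega>. W t \<omega> - W s \<omega>) borel)) \<and>
        (\<forall>a. a \<noteq> 0 \<longrightarrow> distributed M lborel (\<lambda>\<omega>. a \<bullet> (W t \<omega> - W s \<omega>))
           (\<lambda>x. ennreal (normal_density 0 (sqrt ((t - s) * (a \<bullet> (Q *v a)))) x))))"

text \<open>\<open>G = \<integral> p dS\<^sup>i\<close> where \<open>dS\<^sup>i = S\<^sup>i (\<alpha>\<^sub>i dt + \<sigma>\<^sub>i dW\<^sup>i)\<close>.\<close>

definition stock_integral :: "('w, 'n::finite) market \<Rightarrow> 'n \<Rightarrow>
    (real \<Rightarrow> 'w \<Rightarrow> real) \<Rightarrow> (real \<Rightarrow> 'w \<Rightarrow> real) \<Rightarrow> bool" where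
  "stock_integral m i p G \<longleftrightarrow>
     (\<exists>J. ito_integral (prob m) (filt m) (horizon m) (\<lambda>t \<omega>. wiener m t \<omega> $ i)
            (\<lambda>t \<omega>. p t \<omega> * (stock m t \<omega> $ i * vol m $ i)) J \<and>
          (AE \<omega> in prob m. \<forall>t\<in>{0..horizon m}.
             G t \<omega> = (LINT s:{0..t}|lborel. p s \<omega> * (stock m s \<omega> $ i * drift m $ i)) + J t \<omega>))"

definition black_scholes_market :: "('w, 'n::finite) market \<Rightarrow> bool" where
  "black_scholes_market m \<longleftrightarrow>
     0 < horizon m \<and>
     filtered_prob_space (prob m) (filt m) (horizon m) \<and>
     correlation_matrix (corr m) \<and>
     correlated_wiener (prob m) (filt m) (horizon m) (corr m) (wiener m) \<and>
     (\<forall>i. 0 < vol m $ i) \<and>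
     0 < bond m 0 \<and>
     (\<forall>t\<in>{0..horizon m}.
        (bond m has_real_derivative rate m * bond m t) (at t within {0..horizon m})) \<and>
     (\<forall>t\<in>{0..horizon m}. stock m t \<in> borel_measurable (filt m t)) \<and>
     (AE \<omega> in prob m. continuous_on {0..horizon m} (\<lambda>t. stock m t \<omega>)) \<and>
     (\<exists>s0. (\<forall>i. 0 < s0 $ i) \<and> (AE \<omega> in prob m. stock m 0 \<omega> = s0)) \<and>
     (\<forall>i. stock_integral m i (\<lambda>_ _. 1) (\<lambda>t \<omega>. stock m t \<omega> $ i - stock m 0 \<omega> $ i))"


subsection \<open>The martingale measure\<close>

definition risk_premium :: "('w, 'n::finite) market \<Rightarrow> real^'n" where
  "risk_premium m = (\<chi> i. (drift m $ i - rate m) / vol m $ i)"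

text \<open>For positive definite \<open>Q\<close> exactly one \<open>R\<close> has this property.\<close>

definition inv_sqrt_matrix :: "real^'n^'n \<Rightarrow> real^'n^'n" where
  "inv_sqrt_matrix Q = (SOME R. transpose R = R \<and> (\<forall>x. x \<noteq> 0 \<longrightarrow> 0 < x \<bullet> (R *v x)) \<and>
     R ** R = matrix_inv Q)"

definition mart_density :: "('w, 'n::finite) market \<Rightarrow> 'w \<Rightarrow> real" where
  "mart_density m \<omega> =
     exp (- ((matrix_inv (corr m) *v risk_premium m) \<bullet> wiener m (horizon m) \<omega>)
          - 1/2 * (norm (inv_sqrt_matrix (corr m) *v risk_premium m))\<^sup>2 * horizon m)"

definition mart_measure :: "('w, 'n::finite) market \<Rightarrow> 'w measure" where
  "mart_measure m = density (prob m) (\<lambda>\<omega>. ennreal (mart_density m \<omega>))"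


subsection \<open>Strategies\<close>

text \<open>A strategy is a pair \<open>(\<pi>\<^sup>0, (\<pi>\<^sup>1, \<dots>, \<pi>\<^sup>d))\<close>.\<close>

type_synonym ('w, 'n) strategy = "(real \<Rightarrow> 'w \<Rightarrow> real) \<times> (real \<Rightarrow> 'w \<Rightarrow> real^'n)"

definition wealth ::
  "('w, 'n::finite) market \<Rightarrow> ('w, 'n) strategy \<Rightarrow> real \<Rightarrow> 'w \<Rightarrow> real" where
  "wealth m \<pi> t \<omega> =
     fst \<pi> t \<omega> * bond m t + (\<Sum>i\<in>UNIV. snd \<pi> t \<omega> $ i * stock m t \<omega> $ i)"

definition self_financing ::
  "('w, 'n::finite) market \<Rightarrow> real \<Rightarrow> ('w, 'n) strategy \<Rightarrow> bool" where
  "self_financing m x \<pi> \<longleftrightarrow>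
     progressive (filt m) (horizon m) (fst \<pi>) \<and>
     (\<forall>i. progressive (filt m) (horizon m) (\<lambda>t \<omega>. snd \<pi> t \<omega> $ i)) \<and>
     (AE \<omega> in prob m. wealth m \<pi> 0 \<omega> = x) \<and>
     (AE \<omega> in prob m. set_integrable lborel {0..horizon m} (\<lambda>s. fst \<pi> s \<omega>)) \<and>
     (\<exists>G. (\<forall>i. stock_integral m i (\<lambda>t \<omega>. snd \<pi> t \<omega> $ i) (G i)) \<and>
          (AE \<omega> in prob m. \<forall>t\<in>{0..horizon m}.
             wealth m \<pi> t \<omega> = x + (LINT s:{0..t}|lborel. fst \<pi> s \<omega> * (rate m * bond m s))
                                + (\<Sum>i\<in>UNIV. G i t \<omega>)))"

definition admissible ::
  "('w, 'n::finite) market \<Rightarrow> real \<Rightarrow> ('w, 'n) strategy \<Rightarrow> bool" where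
  "admissible m x \<pi> \<longleftrightarrow> self_financing m x \<pi> \<and>
     (AE \<omega> in prob m. \<forall>t\<in>{0..horizon m}. 0 \<le> wealth m \<pi> t \<omega>)"

definition complete_market :: "('w, 'n::finite) market \<Rightarrow> bool" where
  "complete_market m \<longleftrightarrow>
     (\<forall>G. G \<in> borel_measurable (filt m (horizon m)) \<longrightarrow> (\<forall>\<omega>\<in>space (prob m). 0 \<le> G \<omega>) \<longrightarrow>
        integrable (mart_measure m) (\<lambda>\<omega>. exp (- rate m * horizon m) * G \<omega>) \<longrightarrow>
        (\<exists>\<pi>. admissible m (LINT \<omega>|mart_measure m. exp (- rate m * horizon m) * G \<omega>) \<pi> \<and>
             (AE \<omega> in prob m. wealth m \<pi> (horizon m) \<omega> = G \<omega>)))"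


section \<open>Loss functions and the cost reduction function\<close>

text \<open>Only the values of \<open>l\<close> on \<open>[0,\<infinity>)\<close> matter; \<open>l'\<close> and \<open>l''\<close> are \<open>deriv l\<close> and
  \<open>deriv (deriv l)\<close> on the open half line \<open>(0,\<infinity>)\<close>.\<close>

definition loss_function :: "(real \<Rightarrow> real) \<Rightarrow> bool" where
  "loss_function l \<longleftrightarrow>
     (\<forall>x\<ge>0. 0 \<le> l x) \<and> l 0 = 0 \<and> mono_on {0..} l \<and>
     (\<forall>x\<ge>0. \<forall>y\<ge>0. \<forall>u. x \<noteq> y \<and> 0 < u \<and> u < 1 \<longrightarrow>
        l ((1 - u) * x + u * y) < (1 - u) * l x + u * l y) \<and>
     (\<forall>x>0. l differentiable (at x) \<and> deriv l differentiable (at x)) \<and>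
     continuous_on {0<..} (deriv (deriv l)) \<and>
     strict_mono_on {0<..} (deriv l) \<and>
     (deriv l \<longlongrightarrow> 0) (at_right 0) \<and>
     filterlim (deriv l) at_top at_top"

definition inv_deriv :: "(real \<Rightarrow> real) \<Rightarrow> real \<Rightarrow> real" where
  "inv_deriv l y = (if y = 0 then 0 else the_inv_into {0<..} (deriv l) y)"

definition contingent_claim ::
  "('w, 'n::finite) market \<Rightarrow> (real \<Rightarrow> real) \<Rightarrow> ('w \<Rightarrow> real) \<Rightarrow> bool" where
  "contingent_claim m l H \<longleftrightarrow>
     H \<in> borel_measurable (filt m (horizon m)) \<and> (\<forall>\<omega>\<in>space (prob m). 0 \<le> H \<omega>) \<and>
     integrable (prob m) (\<lambda>\<omega>. exp (- rate m * horizon m) * mart_density m \<omega> * H \<omega>) \<and>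
     integrable (prob m) (\<lambda>\<omega>. l (H \<omega>))"

text \<open>The set over which the minimum defining the cost reduction function is taken.\<close>

definition feasible_costs ::
  "('w, 'n::finite) market \<Rightarrow> (real \<Rightarrow> real) \<Rightarrow> ('w \<Rightarrow> real) \<Rightarrow> real \<Rightarrow> real set" where
  "feasible_costs m l H v = {x. \<exists>\<pi>. admissible m x \<pi> \<and>
     (\<integral>\<^sup>+\<omega>. ennreal (l (max (H \<omega> - wealth m \<pi> (horizon m) \<omega>) 0)) \<partial>prob m) \<le> ennreal v}"

definition cost_reduction ::
  "('w, 'n::finite) market \<Rightarrow> (real \<Rightarrow> real) \<Rightarrow> ('w \<Rightarrow> real) \<Rightarrow> real \<Rightarrow> real" where
  "cost_reduction m l H v = (LEAST x. x \<in> feasible_costs m l H v)"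

definition test_fun ::
  "('w, 'n::finite) market \<Rightarrow> (real \<Rightarrow> real) \<Rightarrow> ('w \<Rightarrow> real) \<Rightarrow> real \<Rightarrow> 'w \<Rightarrow> real" where
  "test_fun m l H c \<omega> =
     (if 0 < H \<omega> then 1 - min (inv_deriv l (c * mart_density m \<omega>) / H \<omega>) 1 else 0)"

definition Psi1 ::
  "('w, 'n::finite) market \<Rightarrow> (real \<Rightarrow> real) \<Rightarrow> ('w \<Rightarrow> real) \<Rightarrow> real \<Rightarrow> real" where
  "Psi1 m l H c = (LINT \<omega>|prob m. l ((1 - test_fun m l H c \<omega>) * H \<omega>))"

definition Psi2 ::
  "('w, 'n::finite) market \<Rightarrow> (real \<Rightarrow> real) \<Rightarrow> ('w \<Rightarrow> real) \<Rightarrow> real \<Rightarrow> real" where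
  "Psi2 m l H c = (LINT \<omega>|mart_measure m. H \<omega> * test_fun m l H c \<omega>)"

end

theory Submission
  imports Defs
begin

text \<open>Under the martingale measure the discounted wealth of an admissible strategy is a
  supermartingale, so the initial capital \<open>x\<close> of a strategy with terminal wealth \<open>X\<close> is at least the
  price of \<open>X\<close>, hence at least that of \<open>H - R\<close> with the shortfall \<open>R = (H - X)\<^sup>+\<close>. For every
  \<open>c > 0\<close> the payoff \<open>min (I (c Z)) H\<close> minimizes \<open>l r - c Z r\<close> pointwise over \<open>0 \<le> r \<le> H\<close>. Hence
  no shortfall whose expected loss is at most that of \<open>min (I (c Z)) H\<close> has a higher price, and by
  completeness the capital that leaves exactly this shortfall suffices.

  For the supermartingale property, the stochastic integrals in the wealth equation are approximated
  by simple integrals, pathwise uniformly. Each simple integrand is switched off before its energy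
  exceeds a level \<open>k\<close>. The truncated integrals are martingales that are bounded in \<open>L\<^sup>2\<close> by a constant
  depending only on \<open>k\<close>, and they agree with the discounted wealth at some time up to a vanishing error;
  nonnegativity of the wealth therefore makes their negative parts vanish in the limit, and Fatou's
  lemma, first in the approximation and then in \<open>k\<close>, gives the inequality.\<close>

section \<open>Square roots of positive definite matrices\<close>

text \<open>\<open>ito_integral\<close> supplies only an almost sure uniform limit of simple
  integrals, and the integrand is square integrable merely path by path. So there is no isometry and
  no integrability of the limit to start from, and the approximating integrals need not be bounded
  in L^2 either. The truncation works on a deterministic grid because a simple integrand is known at
  the left end of each grid interval; no stopping times or local martingales are involved, and the
  cutoff index enters only path by path. The price is that the comparison with the wealth must be
  uniform over all grid points, for which uniform convergence in time is essential.

  Girsanov's theorem appears only through Laplace transforms of increments, tested against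
  nonnegative weights known at the left end. First and second moments follow by elementary
  inequalities, without identifying the law of the drifted process. Matrix square roots enter
  because the density is written with the norm of Q^(-1/2) \<theta>, and a root chosen by
  \<open>SOME\<close> has its defining properties only if one exists.\<close>

lemma blinfun_half_square_fixpoint:
  fixes A :: "'a::{banach,real_inner} \<Rightarrow>\<^sub>L 'a"
  assumes norm_A: "norm A < 1" and sym_A: "\<And>x y. x \<bullet> A y = A x \<bullet> y"
  obtains Y where "norm Y \<le> norm A" "\<And>x y. x \<bullet> blinfun_apply Y y = blinfun_apply Y x \<bullet> y"
    "Y = (A + (Y o\<^sub>L Y)) /\<^sub>R 2"
proof -
  \<comment> \<open>Self-adjointness is a closed condition preserved by \<open>f\<close>; built into
    the complete set, it passes to the fixed point.\<close>
  define S where "S = cball 0 (norm A) \<inter> (\<Inter>x. \<Inter>y. {Y::'a \<Rightarrow>\<^sub>L 'a. x \<bullet> Y y = Y x \<bullet> y})"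
  \<comment> \<open>A fixed point satisfies 2 Y = A + Y Y, that is (1 - Y)^2 = 1 - A. On the ball of
    radius \<open>norm A\<close> the map is a contraction with factor \<open>norm A\<close>, since Y
    Y - Z Z = (Y - Z) Y + Z (Y - Z).\<close>
  define f where "f Y = (A + (Y o\<^sub>L Y)) /\<^sub>R 2" for Y :: "'a \<Rightarrow>\<^sub>L 'a"
  have "closed {Y::'a \<Rightarrow>\<^sub>L 'a. x \<bullet> Y y = Y x \<bullet> y}" for x y
    by (intro closed_Collect_eq continuous_intros)
  then have "closed S"
    unfolding S_def by (intro closed_Int closed_INT closed_cball) auto
  moreover have "0 \<in> S" by (simp add: S_def)
  moreover have "f Y \<in> S" if "Y \<in> S" for Y
  proof -
    have Y: "norm Y \<le> norm A" "\<And>x y. x \<bullet> Y y = Y x \<bullet> y" using that by (auto simp: S_def)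
    have "norm (Y o\<^sub>L Y) \<le> norm A * norm A"
      using norm_blinfun_compose[of Y Y] mult_mono[OF Y(1) Y(1)] by (auto intro: order_trans)
    also have "\<dots> \<le> norm A" using norm_A by (simp add: mult_left_le)
    finally have "norm (f Y) \<le> norm A"
      unfolding f_def using norm_triangle_ineq[of A "Y o\<^sub>L Y"] by simp
    then show ?thesis
      using sym_A Y(2) by (simp add: S_def f_def blinfun.add_left blinfun.scaleR_left
          inner_add_left inner_add_right)
  qed
  moreover have "dist (f Y) (f Z) \<le> norm A * dist Y Z" if "Y \<in> S" "Z \<in> S" for Y Z
  proof -
    have YZ: "norm Y \<le> norm A" "norm Z \<le> norm A" using that by (auto simp: S_def)
    have "f Y - f Z = ((Y o\<^sub>L Y) - (Z o\<^sub>L Z)) /\<^sub>R 2"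
      by (simp add: f_def scaleR_diff_right[symmetric])
    also have "\<dots> = (((Y - Z) o\<^sub>L Y) + (Z o\<^sub>L (Y - Z))) /\<^sub>R 2"
      by (rule blinfun_eqI) (simp add: f_def blinfun.bilinear_simps)
    finally have "norm (f Y - f Z) \<le> (norm ((Y - Z) o\<^sub>L Y) + norm (Z o\<^sub>L (Y - Z))) / 2"
      using norm_triangle_ineq[of "(Y - Z) o\<^sub>L Y" "Z o\<^sub>L (Y - Z)"]
      by simp
    also have "\<dots> \<le> (norm (Y - Z) * norm Y + norm Z * norm (Y - Z)) / 2"
      by (intro divide_right_mono add_mono norm_blinfun_compose) auto
    also have "\<dots> \<le> (norm (Y - Z) * norm A + norm A * norm (Y - Z)) / 2"
      using YZ by (intro divide_right_mono add_mono mult_left_mono mult_right_mono) auto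
    finally show ?thesis by (simp add: dist_norm mult.commute)
  qed
  ultimately have "\<exists>!Y. Y \<in> S \<and> f Y = Y"
    using norm_A by (intro Banach_fix[of S "norm A"]) (auto simp: complete_eq_closed)
  then obtain Y where Y: "Y \<in> S" "f Y = Y" by auto
  show ?thesis
  proof
    show "norm Y \<le> norm A" "x \<bullet> Y y = Y x \<bullet> y" for x y using Y(1) by (auto simp: S_def)
    show "Y = (A + (Y o\<^sub>L Y)) /\<^sub>R 2" by (rule Y(2)[symmetric, unfolded f_def])
  qed
qed

text \<open>The quadratic form attains its minimum on the compact unit sphere; homogeneity extends
  the bound to all vectors.\<close>

lemma posdef_matrix_lower_bound:
  fixes B :: "real^'n^'n"
  assumes "\<And>x. x \<noteq> 0 \<Longrightarrow> 0 < x \<bullet> (B *v x)"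
  obtains \<mu> where "0 < \<mu>" "\<And>x. \<mu> * (norm x)\<^sup>2 \<le> x \<bullet> (B *v x)"
proof -
  have "continuous_on (sphere 0 1) (\<lambda>x. x \<bullet> (B *v x))"
    by (intro continuous_intros linear_continuous_on matrix_vector_mul_bounded_linear)
  moreover have "sphere (0::real^'n) 1 \<noteq> {}" by simp
  ultimately obtain x0 where x0: "norm x0 = 1" "\<And>x. norm x = 1 \<Longrightarrow> x0 \<bullet> (B *v x0) \<le> x \<bullet> (B *v x)"
    using continuous_attains_inf[of "sphere (0::real^'n) 1" "\<lambda>x. x \<bullet> (B *v x)"] compact_sphere
    by (metis mem_sphere_0)
  show ?thesis
  proof
    show "0 < x0 \<bullet> (B *v x0)" using assms[of x0] x0(1) by fastforce
    show "x0 \<bullet> (B *v x0) * (norm x)\<^sup>2 \<le> x \<bullet> (B *v x)" for x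
    proof (cases "x = 0")
      case False
      have "x0 \<bullet> (B *v x0) \<le> (x /\<^sub>R norm x) \<bullet> (B *v (x /\<^sub>R norm x))"
        using False by (intro x0) simp
      also have "\<dots> = (x \<bullet> (B *v x)) / (norm x)\<^sup>2"
        by (simp add: matrix_vector_mult_scaleR power2_eq_square divide_inverse)
      finally show ?thesis using False by (simp add: field_simps)
    qed simp
  qed
qed

lemma inner_matrix_vector_transpose:
  fixes B :: "real^'n^'m"
  shows "x \<bullet> (B *v y) = (transpose B *v x) \<bullet> y"
  unfolding transpose_matrix_vector by (rule dot_lmul_matrix[symmetric])

text \<open>The root is a multiple of 1 - Y, where Y is the fixed point for A = 1 - e B. This avoids
  diagonalization; it only takes a multiple of B that makes A a strict contraction.\<close>

lemma posdef_matrix_sqrt: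
  fixes B :: "real^'n^'n"
  assumes sym: "transpose B = B" and pos: "\<And>x. x \<noteq> 0 \<Longrightarrow> 0 < x \<bullet> (B *v x)"
  shows "\<exists>R. transpose R = R \<and> (\<forall>x. x \<noteq> 0 \<longrightarrow> 0 < x \<bullet> (R *v x)) \<and> R ** R = B"
proof -
  have symB: "x \<bullet> (B *v y) = (B *v x) \<bullet> y" for x y
    by (subst inner_matrix_vector_transpose) (simp add: sym)
  obtain \<mu> where \<mu>: "0 < \<mu>" "\<And>x. \<mu> * (norm x)\<^sup>2 \<le> x \<bullet> (B *v x)"
    using posdef_matrix_lower_bound[OF pos] by blast
  obtain K where K: "0 < K" "\<And>x. norm (B *v x) \<le> K * norm x"
    using bounded_linear.pos_bounded[OF matrix_vector_mul_bounded_linear[of B]]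
    by (auto simp: mult.commute)
  \<comment> \<open>This e minimizes the bound 1 - 2 e \<mu> + e^2 K^2 for the squared norm of A and
    turns it into 1 - e \<mu>.\<close>
  define e where "e = \<mu> / K\<^sup>2"
  have e: "0 < e" using \<mu> K by (simp add: e_def)
  define A where "A = Blinfun (\<lambda>x. x - e *\<^sub>R (B *v x))"
  have A: "blinfun_apply A x = x - e *\<^sub>R (B *v x)" for x
    unfolding A_def
    by (subst bounded_linear_Blinfun_apply)
      (auto intro!: bounded_linear_intros matrix_vector_mul_bounded_linear)
  \<comment> \<open>The maximum with 0 spares a proof that 1 - e \<mu> is nonnegative before the
    square root is taken.\<close>
  define q where "q = max 0 (1 - e * \<mu>)"
  have q: "0 \<le> q" "q < 1" using \<mu> e by (auto simp: q_def)
  have "norm (A x) \<le> sqrt q * norm x" for x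
  proof -
    have "(norm (A x))\<^sup>2 = (norm x)\<^sup>2 - 2 * e * (x \<bullet> (B *v x)) + e\<^sup>2 * (norm (B *v x))\<^sup>2"
      unfolding A power2_norm_eq_inner
      by (simp add: inner_diff_left inner_diff_right inner_commute power2_eq_square algebra_simps)
    also have "\<dots> \<le> (norm x)\<^sup>2 - 2 * e * (\<mu> * (norm x)\<^sup>2) + e\<^sup>2 * (K * norm x)\<^sup>2"
      using e \<mu>(2)[of x] K(2)[of x] by (intro add_mono diff_mono mult_left_mono power_mono) auto
    also have "e\<^sup>2 * (K * norm x)\<^sup>2 = e * (e * K\<^sup>2) * (norm x)\<^sup>2"
      by (simp only: power2_eq_square mult_ac)
    also have "e * K\<^sup>2 = \<mu>" using K(1) by (simp add: e_def)
    also have "(norm x)\<^sup>2 - 2 * e * (\<mu> * (norm x)\<^sup>2) + e * \<mu> * (norm x)\<^sup>2 = (1 - e * \<mu>) * (norm x)\<^sup>2"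
      by (simp add: algebra_simps)
    also have "\<dots> \<le> q * (norm x)\<^sup>2" by (intro mult_right_mono) (auto simp: q_def)
    also have "q * (norm x)\<^sup>2 = (sqrt q * norm x)\<^sup>2"
      using q(1) by (simp add: power_mult_distrib)
    finally show ?thesis
      by (rule power2_le_imp_le) (simp add: q(1))
  qed
  then have "norm A \<le> sqrt q"
    by (rule norm_blinfun_bound[rotated]) (simp add: q(1))
  also have "sqrt q < 1" using q by simp
  finally have nA: "norm A < 1" .
  have symA: "x \<bullet> A y = A x \<bullet> y" for x y
    by (simp add: A inner_diff_left inner_diff_right symB)
  obtain Y where Y: "norm Y \<le> norm A"
      "\<And>x y. x \<bullet> blinfun_apply Y y = blinfun_apply Y x \<bullet> y"
      "Y = (A + (Y o\<^sub>L Y)) /\<^sub>R 2"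
    by (rule blinfun_half_square_fixpoint[OF nA symA]) (rule that)
  \<comment> \<open>(1 - Y)^2 = 1 - A = e B, so the factor 1 / sqrt e yields a square root of B; it
    is positive because \<open>norm Y\<close> < 1.\<close>
  define f where "f x = (1 / sqrt e) *\<^sub>R (x - Y x)" for x
  have lin: "linear f"
    unfolding f_def by (intro bounded_linear.linear bounded_linear_intros)
  have f: "matrix f *v x = f x" for x by (simp add: lin matrix_works)
  have "f (f x) = B *v x" for x
  proof -
    have "2 *\<^sub>R Y x = A x + Y (Y x)"
      by (subst Y(3)) (simp add: blinfun.bilinear_simps)
    then have "f (f x) = (1 / e) *\<^sub>R (x - A x)"
      using e by (simp add: f_def blinfun.bilinear_simps algebra_simps scaleR_2)
    then show ?thesis using e by (simp add: A)
  qed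
  then have "matrix f ** matrix f = B"
    by (intro matrix_eq[THEN iffD2]) (simp add: f matrix_vector_mul_assoc[symmetric])
  moreover have "transpose (matrix f) = matrix f"
  proof -
    have "(transpose (matrix f) *v x) \<bullet> y = (matrix f *v x) \<bullet> y" for x y
      by (subst inner_matrix_vector_transpose[symmetric])
         (simp add: f f_def inner_diff_left inner_diff_right Y(2))
    then have "transpose (matrix f) *v x = matrix f *v x" for x
      using vector_eq_rdot by blast
    then show ?thesis by (rule matrix_eq[THEN iffD2, OF allI])
  qed
  moreover have "0 < x \<bullet> (matrix f *v x)" if "x \<noteq> 0" for x
  proof -
    have "x \<bullet> Y x \<le> norm x * norm (Y x)" by (rule norm_cauchy_schwarz)
    also have "\<dots> \<le> norm x * (norm A * norm x)"
      using norm_blinfun[of Y x] Y(1) by (intro mult_left_mono order_trans[OF norm_blinfun] mult_right_mono) auto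
    also have "\<dots> < x \<bullet> x" using nA that by (simp add: dot_square_norm power2_eq_square)
    finally show ?thesis using e by (simp add: f f_def inner_diff_right)
  qed
  ultimately show ?thesis by blast
qed

text \<open>\<open>matrix_inv\<close> is a choice operator; positive definiteness makes Q injective,
  hence invertible in finite dimension.\<close>

lemma correlation_matrix_matrix_inv:
  assumes "correlation_matrix Q"
  shows "Q ** matrix_inv Q = mat 1" "matrix_inv Q ** Q = mat 1"
proof -
  have "inj ((*v) Q)"
  proof (rule linear_injective_0[THEN iffD2])
    show "linear ((*v) Q)" by simp
    show "\<forall>x. Q *v x = 0 \<longrightarrow> x = 0"
      using assms unfolding correlation_matrix_def by (metis inner_zero_right less_irrefl)
  qed
  then have "invertible Q"
    by (metis invertible_left_inverse matrix_left_invertible_injective)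
  then have "\<exists>B. Q ** B = mat 1 \<and> B ** Q = mat 1" by (simp add: invertible_def)
  from someI_ex[OF this] show "Q ** matrix_inv Q = mat 1" "matrix_inv Q ** Q = mat 1"
    by (auto simp: matrix_inv_def)
qed

lemma correlation_matrix_inner_sym:
  assumes "correlation_matrix Q"
  shows "x \<bullet> (Q *v y) = (Q *v x) \<bullet> y"
  using assms by (subst inner_matrix_vector_transpose) (simp add: correlation_matrix_def)

text \<open>The root is a \<open>SOME\<close> choice, so its existence has to be known first.
  Afterwards only symmetry and R R = Q^(-1) matter, and the exponent of the density becomes free of
  roots.\<close>

lemma norm_inv_sqrt_matrix:
  fixes Q :: "real^'n^'n"
  assumes Q: "correlation_matrix Q"
  shows "(norm (inv_sqrt_matrix Q *v \<theta>))\<^sup>2 = (matrix_inv Q *v \<theta>) \<bullet> \<theta>"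
proof -
  let ?B = "matrix_inv Q"
  note inv = correlation_matrix_matrix_inv[OF Q]
  have QB: "Q *v (?B *v x) = x" for x by (simp add: matrix_vector_mul_assoc inv)
  have "transpose ?B = transpose ?B ** (transpose Q ** ?B)"
    using Q by (simp add: inv correlation_matrix_def)
  also have "\<dots> = ?B"
    by (simp add: matrix_mul_assoc matrix_transpose_mul[symmetric] inv)
  finally have "transpose ?B = ?B" .
  moreover have "0 < x \<bullet> (?B *v x)" if "x \<noteq> 0" for x
  proof -
    have "?B *v x \<noteq> 0" using QB[of x] that by auto
    then have "0 < (?B *v x) \<bullet> (Q *v (?B *v x))" using Q by (simp add: correlation_matrix_def)
    then show ?thesis by (simp add: QB inner_commute)
  qed
  ultimately have "\<exists>R. transpose R = R \<and> (\<forall>x. x \<noteq> 0 \<longrightarrow> 0 < x \<bullet> (R *v x)) \<and> R ** R = ?B"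
    by (rule posdef_matrix_sqrt)
  from someI_ex[OF this] have R: "transpose (inv_sqrt_matrix Q) = inv_sqrt_matrix Q"
    "inv_sqrt_matrix Q ** inv_sqrt_matrix Q = ?B"
    unfolding inv_sqrt_matrix_def by blast+
  have "(norm (inv_sqrt_matrix Q *v \<theta>))\<^sup>2 = (inv_sqrt_matrix Q *v (inv_sqrt_matrix Q *v \<theta>)) \<bullet> \<theta>"
    unfolding power2_norm_eq_inner inner_matrix_vector_transpose[of "inv_sqrt_matrix Q *v \<theta>"] R(1) ..
  then show ?thesis by (simp add: matrix_vector_mul_assoc R(2))
qed

section \<open>Loss functions\<close>

lemma loss_function_deriv_continuous:
  assumes "loss_function l"
  shows "continuous_on {0<..} (deriv l)"
  using assms unfolding loss_function_def
  by (intro continuous_at_imp_continuous_on ballI differentiable_imp_continuous_within) auto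

text \<open>Monotonicity and the limit 0 at 0+ give l' >= 0 everywhere; comparison with x / 2 makes
  the inequality strict.\<close>

lemma loss_function_deriv_pos:
  assumes l: "loss_function l" and "0 < x"
  shows "0 < deriv l x"
proof -
  have sm: "strict_mono_on {0<..} (deriv l)" and lim: "(deriv l \<longlongrightarrow> 0) (at_right 0)"
    using l by (auto simp: loss_function_def)
  have "0 \<le> deriv l y" if "0 < y" for y
  proof (rule tendsto_upperbound[OF lim])
    show "\<forall>\<^sub>F z in at_right 0. deriv l z \<le> deriv l y"
      using that eventually_at_right_less[of 0] eventually_at_right[of 0 y]
      by (auto simp: eventually_at_right intro!: exI[of _ y] less_imp_le strict_mono_onD[OF sm])
  qed simp
  from this[of "x/2"] have "0 \<le> deriv l (x/2)" using assms by simp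
  also have "\<dots> < deriv l x" using assms by (intro strict_mono_onD[OF sm]) auto
  finally show ?thesis .
qed

lemma loss_function_deriv_bij:
  assumes l: "loss_function l"
  shows "bij_betw (deriv l) {0<..} {0<..}"
proof (unfold bij_betw_def, intro conjI set_eqI iffI)
  have sm: "strict_mono_on {0<..} (deriv l)" and lim: "(deriv l \<longlongrightarrow> 0) (at_right 0)"
    and top: "filterlim (deriv l) at_top at_top"
    using l by (auto simp: loss_function_def)
  show "inj_on (deriv l) {0<..}" using sm by (rule strict_mono_on_imp_inj_on)
  show "y \<in> {0<..}" if "y \<in> deriv l ` {0<..}" for y
    using that loss_function_deriv_pos[OF l] by auto
  fix y :: real assume "y \<in> {0<..}"
  then have y: "0 < y" by simp
  have "\<forall>\<^sub>F x in at_right 0. deriv l x < y" using order_tendstoD(2)[OF lim y] .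
  then obtain b where b: "0 < b" "\<And>x. 0 < x \<Longrightarrow> x < b \<Longrightarrow> deriv l x < y"
    by (auto simp: eventually_at_right_field)
  have "\<forall>\<^sub>F x in at_top. y \<le> deriv l x" using top by (auto simp: filterlim_at_top)
  then obtain d where d: "\<And>x. d \<le> x \<Longrightarrow> y \<le> deriv l x" by (auto simp: eventually_at_top_linorder)
  have "\<exists>x\<ge>b/2. x \<le> max b d \<and> deriv l x = y"
  proof (rule IVT')
    show "deriv l (b/2) \<le> y" using b(2)[of "b/2"] b(1) by simp
    show "y \<le> deriv l (max b d)" by (rule d) simp
    show "b / 2 \<le> max b d" using b(1) by simp
    show "continuous_on {b/2..max b d} (deriv l)"
      using b(1) by (intro continuous_on_subset[OF loss_function_deriv_continuous[OF l]]) auto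
  qed
  then show "y \<in> deriv l ` {0<..}" using b(1) by force
qed

lemma inv_deriv_0 [simp]: "inv_deriv l 0 = 0"
  by (simp add: inv_deriv_def)

lemma inv_deriv_pos:
  assumes "loss_function l" "0 < y"
  shows "0 < inv_deriv l y" and "deriv l (inv_deriv l y) = y"
  using the_inv_into_into[of "deriv l" "{0<..}" y "{0<..}"] f_the_inv_into_f[of "deriv l" "{0<..}" y]
    loss_function_deriv_bij[OF assms(1)] assms(2)
  by (auto simp: inv_deriv_def bij_betw_def)

lemma inv_deriv_nonneg:
  assumes "loss_function l" "0 \<le> y"
  shows "0 \<le> inv_deriv l y"
  using inv_deriv_pos(1)[OF assms(1), of y] assms(2) by (cases "y = 0") auto

text \<open>The equivalences include y = 0, where I(0) = 0 and l' > 0. Continuity of I, its limit at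
  infinity and the endpoint case of the pointwise minimization all reduce to them.\<close>

lemma inv_deriv_le_iff:
  assumes l: "loss_function l" and "0 < x" "0 \<le> y"
  shows "inv_deriv l y \<le> x \<longleftrightarrow> y \<le> deriv l x" and "x \<le> inv_deriv l y \<longleftrightarrow> deriv l x \<le> y"
proof -
  have sm: "strict_mono_on {0<..} (deriv l)" using l by (auto simp: loss_function_def)
  have "(inv_deriv l y \<le> x \<longleftrightarrow> y \<le> deriv l x) \<and> (x \<le> inv_deriv l y \<longleftrightarrow> deriv l x \<le> y)"
  proof (cases "y = 0")
    case False
    then have "0 < inv_deriv l y" "deriv l (inv_deriv l y) = y"
      using inv_deriv_pos[OF l] assms by auto
    with strict_mono_on_leD[OF sm] show ?thesis
      using \<open>0 < x\<close> by (metis greaterThan_iff linorder_le_cases strict_mono_on_eqD[OF sm] order_antisym order_refl)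
  qed (use assms loss_function_deriv_pos[OF l \<open>0 < x\<close>] in auto)
  then show "inv_deriv l y \<le> x \<longleftrightarrow> y \<le> deriv l x" "x \<le> inv_deriv l y \<longleftrightarrow> deriv l x \<le> y" by auto
qed

text \<open>A point b strictly between a and I(y) separates y from l'(b), and the order equivalences
  turn a neighbourhood of y into a bound on I. The boundary point 0 is included because c = 0 is
  allowed in \<open>Psi1\<close>.\<close>

lemma inv_deriv_continuous:
  assumes l: "loss_function l"
  shows "continuous_on {0..} (inv_deriv l)"
  unfolding continuous_on_def
proof
  fix y :: real assume "y \<in> {0..}"
  then have y: "0 \<le> y" by simp
  show "(inv_deriv l \<longlongrightarrow> inv_deriv l y) (at y within {0..})"
  proof (rule order_tendstoI)
    fix a assume "a < inv_deriv l y"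
    show "\<forall>\<^sub>F z in at y within {0..}. a < inv_deriv l z"
    proof (cases "a < 0")
      case True
      then show ?thesis
        using inv_deriv_nonneg[OF l]
        by (intro eventually_at_filter[THEN iffD2] always_eventually) (auto intro: less_le_trans)
    next
      case False
      define b where "b = (a + inv_deriv l y) / 2"
      have b: "0 < b" "a < b" "b < inv_deriv l y"
        using False \<open>a < _\<close> by (auto simp: b_def)
      then have "deriv l b < y"
        using inv_deriv_le_iff(1)[OF l b(1) y] by linarith
      then have "\<forall>\<^sub>F z in nhds y. deriv l b < z" by (rule eventually_nhds_in_open[of "{deriv l b<..}", simplified])
      then show ?thesis unfolding eventually_at_filter
      proof eventually_elim
        case (elim z)
        then show ?case using inv_deriv_le_iff(2)[OF l b(1), of z] b by auto
      qed
    qed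
  next
    fix a assume a: "inv_deriv l y < a"
    define b where "b = (a + inv_deriv l y) / 2"
    have b: "0 < b" "b < a" "inv_deriv l y < b"
      using inv_deriv_nonneg[OF l y] a by (auto simp: b_def)
    then have "y < deriv l b"
      using inv_deriv_le_iff(2)[OF l b(1) y] by linarith
    then have "\<forall>\<^sub>F z in nhds y. z < deriv l b" by (rule eventually_nhds_in_open[of "{..<deriv l b}", simplified])
    then show "\<forall>\<^sub>F z in at y within {0..}. inv_deriv l z < a" unfolding eventually_at_filter
    proof eventually_elim
      case (elim z)
      then show ?case using inv_deriv_le_iff(1)[OF l b(1), of z] b by auto
    qed
  qed
qed

lemma inv_deriv_at_top:
  assumes l: "loss_function l"
  shows "filterlim (inv_deriv l) at_top at_top"
  unfolding filterlim_at_top_gt[of _ _ 0]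
proof safe
  fix Z :: real assume "0 < Z"
  show "\<forall>\<^sub>F y in at_top. Z \<le> inv_deriv l y"
    using eventually_ge_at_top[of "deriv l Z"]
  proof eventually_elim
    case (elim y)
    then show ?case
      using inv_deriv_le_iff(2)[OF l \<open>0 < Z\<close>, of y] loss_function_deriv_pos[OF l \<open>0 < Z\<close>] by auto
  qed
qed

lemma loss_function_strict_convex:
  assumes "loss_function l" "0 \<le> x" "0 \<le> y" "x \<noteq> y" "0 < u" "u < 1"
  shows "l ((1 - u) * x + u * y) < (1 - u) * l x + u * l y"
  using assms by (simp add: loss_function_def)

lemma loss_function_convex:
  assumes "loss_function l"
  shows "convex_on {0..} l"
proof (rule convex_onI)
  fix t x y :: real assume t: "0 < t" "t < 1" and xy: "x \<in> {0..}" "y \<in> {0..}"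
  show "l ((1 - t) *\<^sub>R x + t *\<^sub>R y) \<le> (1 - t) * l x + t * l y"
  proof (cases "x = y")
    case True then show ?thesis by (simp add: algebra_simps)
  next
    case False
    then show ?thesis
      using loss_function_strict_convex[OF assms, of x y t] t xy by simp
  qed
qed simp

lemma loss_function_above_tangent:
  assumes l: "loss_function l" and "0 < x" "0 \<le> y"
  shows "l x + deriv l x * (y - x) \<le> l y"
proof -
  have "(l has_field_derivative deriv l x) (at x within {0..})"
  proof (rule has_field_derivative_at_within)
    have "l differentiable (at x)" using l \<open>0 < x\<close> by (simp add: loss_function_def)
    then show "(l has_field_derivative deriv l x) (at x)"
      by (simp only: DERIV_deriv_iff_real_differentiable)
  qed
  from convex_on_imp_above_tangent[OF loss_function_convex[OF l] _ _ _ this, of y]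
  have "deriv l x * (y - x) \<le> l y - l x"
    using assms by simp
  then show ?thesis by simp
qed

lemma loss_function_pos:
  assumes l: "loss_function l" and "0 < x"
  shows "0 < l x"
proof -
  have "l ((1 - 1/2) * 0 + 1/2 * x) < (1 - 1/2) * l 0 + 1/2 * l x"
    using \<open>0 < x\<close> by (intro loss_function_strict_convex[OF l]) auto
  moreover have "0 \<le> l (x/2)" "l 0 = 0" using l \<open>0 < x\<close> by (auto simp: loss_function_def)
  ultimately show ?thesis by simp
qed

lemma loss_function_mono:
  assumes "loss_function l" "0 \<le> x" "x \<le> y"
  shows "l x \<le> l y"
  using mono_onD[of "{0..}" l x y] assms by (simp add: loss_function_def)

text \<open>Away from 0 this is differentiability. At 0 the values are squeezed between 0 and the
  chord \<open>x * l 1\<close>, by convexity and l(0) = 0.\<close>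

lemma loss_function_continuous:
  assumes l: "loss_function l"
  shows "continuous_on {0..} l"
proof -
  have "isCont l x" if "0 < x" for x
    using l that unfolding loss_function_def by (intro differentiable_imp_continuous_within) auto
  have "(l \<longlongrightarrow> 0) (at_right 0)"
  proof (rule real_tendsto_sandwich[OF _ _ tendsto_const])
    show "\<forall>\<^sub>F x in at_right 0. 0 \<le> l x"
      using eventually_at_right_less[of 0] by eventually_elim (use l in \<open>auto simp: loss_function_def\<close>)
    show "\<forall>\<^sub>F x in at_right 0. l x \<le> x * l 1"
      using eventually_at_right_less[of 0] eventually_at_right_real[of 0 1, simplified]
    proof eventually_elim
      case (elim x)
      have "l ((1 - x) * 0 + x * 1) < (1 - x) * l 0 + x * l 1"
        using elim by (intro loss_function_strict_convex[OF l]) auto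
      then show ?case using l by (simp add: loss_function_def)
    qed
    show "((\<lambda>x. x * l 1) \<longlongrightarrow> 0) (at_right 0)" by (auto intro!: tendsto_eq_intros)
  qed
  have "l 0 = 0" using l by (simp add: loss_function_def)
  show ?thesis
    unfolding continuous_on_eq_continuous_within
  proof
    fix x :: real assume "x \<in> {0..}"
    then consider "0 < x" | "x = 0" by force
    then show "continuous (at x within {0..}) l"
    proof cases
      case 1
      then show ?thesis
        using \<open>\<And>x. 0 < x \<Longrightarrow> isCont l x\<close> by (auto intro: continuous_at_imp_continuous_at_within)
    next
      case 2
      then show ?thesis
        using \<open>(l \<longlongrightarrow> 0) (at_right 0)\<close> \<open>l 0 = 0\<close> by (simp add: continuous_within at_within_Ici_at_right)
    qed
  qed
qed

text \<open>With \<open>z = c Z\<close> this is the pointwise form of the Neyman--Pearson argument.\<close>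

lemma inv_deriv_minimizes:
  assumes l: "loss_function l" and "0 < z" and r: "0 \<le> r" "r \<le> h"
  shows "l (min (inv_deriv l z) h) - z * min (inv_deriv l z) h \<le> l r - z * r"
proof (cases "h = 0")
  case False
  define m where "m = min (inv_deriv l z) h"
  have I: "0 < inv_deriv l z" "deriv l (inv_deriv l z) = z" using inv_deriv_pos[OF l \<open>0 < z\<close>] by auto
  have m: "0 < m" using I False r by (simp add: m_def)
  \<comment> \<open>First-order condition on [0, h]: either the minimizer is I(z), where l' = z, or
    it is the right endpoint h, where l' <= z and r - h <= 0.\<close>
  have "z * (r - m) \<le> deriv l m * (r - m)"
  proof (cases "inv_deriv l z \<le> h")
    case True then show ?thesis by (simp add: m_def I)
  next
    case False
    then have "m = h" by (simp add: m_def)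
    moreover from this have "deriv l m \<le> z" using inv_deriv_le_iff(2)[OF l m, of z] False \<open>0 < z\<close> by simp
    ultimately show ?thesis using r by (intro mult_right_mono_neg) auto
  qed
  with loss_function_above_tangent[OF l m r(1)] show ?thesis
    by (simp add: m_def[symmetric] algebra_simps)
next
  case True
  then have "r = 0" using r by simp
  then show ?thesis using True inv_deriv_pos(1)[OF l \<open>0 < z\<close>] by simp
qed

section \<open>Girsanov's theorem\<close>

text \<open>Wiener increments come with independence of \<sigma>-algebras. It is passed down to
  those generated by \<open>X\<close> and by \<open>g\<close> of \<open>Y\<close>, where the product
  formula for independent variables applies; values in \<open>ennreal\<close> avoid all
  integrability questions.\<close>

lemma (in prob_space) indep_set_nn_integral_mult:
  fixes X :: "'a \<Rightarrow> ennreal" and Y :: "'a \<Rightarrow> 'b"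
  assumes indep: "indep_set (sets F) (sets (vimage_algebra (space M) Y N))"
    and sub: "subalgebra M F" and X: "X \<in> borel_measurable F"
    and Y: "Y \<in> measurable M N" and g: "g \<in> borel_measurable N"
  shows "(\<integral>\<^sup>+\<omega>. X \<omega> * g (Y \<omega>) \<partial>M) = (\<integral>\<^sup>+\<omega>. X \<omega> \<partial>M) * (\<integral>\<^sup>+\<omega>. g (Y \<omega>) \<partial>M)"
proof -
  have spF: "space F = space M" using sub by (simp add: subalgebra_def)
  have gY: "(\<lambda>\<omega>. g (Y \<omega>)) \<in> borel_measurable M" using measurable_compose[OF Y g] .
  have gV: "(\<lambda>\<omega>. g (Y \<omega>)) \<in> borel_measurable (vimage_algebra (space M) Y N)"
    by (rule measurable_compose[OF measurable_vimage_algebra1 g]) (use Y in \<open>auto simp: measurable_space\<close>)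
  have "sigma_sets (space M) {X -` A \<inter> space M |A. A \<in> sets borel} \<subseteq> sets F"
    using measurable_sets[OF X] unfolding spF[symmetric] by (intro sets.sigma_sets_subset) auto
  moreover have "sigma_sets (space M) {(\<lambda>\<omega>. g (Y \<omega>)) -` A \<inter> space M |A. A \<in> sets borel}
      \<subseteq> sets (vimage_algebra (space M) Y N)"
    using sets.sigma_sets_subset[of "{(\<lambda>\<omega>. g (Y \<omega>)) -` A \<inter> space M |A. A \<in> sets borel}"
      "vimage_algebra (space M) Y N"] measurable_sets[OF gV] by auto
  ultimately have "indep_set (sigma_sets (space M) {X -` A \<inter> space M |A. A \<in> sets borel})
      (sigma_sets (space M) {(\<lambda>\<omega>. g (Y \<omega>)) -` A \<inter> space M |A. A \<in> sets borel})"
    using indep unfolding indep_sets2_eq by blast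
  then have "indep_var borel X borel (\<lambda>\<omega>. g (Y \<omega>))"
    unfolding indep_var_eq using measurable_from_subalg[OF sub X] gY by simp
  then have "indep_vars (\<lambda>_. borel) (case_bool X (\<lambda>\<omega>. g (Y \<omega>))) UNIV"
    unfolding indep_var_def by (rule indep_vars_cong[THEN iffD1, rotated 3]) (auto split: bool.split)
  from indep_vars_nn_integral[OF _ this] show ?thesis
    by (simp add: UNIV_bool mult.commute)
qed

text \<open>Completing the square: the factor \<open>exp x\<close> shifts the mean from 0 to
  \<sigma>^2 and leaves a constant.\<close>

lemma nn_integral_exp_normal:
  assumes "0 < \<sigma>"
  shows "(\<integral>\<^sup>+x. ennreal (normal_density 0 \<sigma> x) * ennreal (exp x) \<partial>lborel) = ennreal (exp (\<sigma>\<^sup>2 / 2))"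
proof -
  have "normal_density 0 \<sigma> x * exp x = exp (\<sigma>\<^sup>2 / 2) * normal_density (\<sigma>\<^sup>2) \<sigma> x" for x
  proof -
    have "- (x\<^sup>2 / (2 * \<sigma>\<^sup>2)) + x = \<sigma>\<^sup>2 / 2 + - ((x - \<sigma>\<^sup>2)\<^sup>2 / (2 * \<sigma>\<^sup>2))"
      using assms by (simp add: field_simps power2_eq_square)
    then have "exp (- (x\<^sup>2 / (2 * \<sigma>\<^sup>2))) * exp x = exp (\<sigma>\<^sup>2 / 2) * exp (- ((x - \<sigma>\<^sup>2)\<^sup>2 / (2 * \<sigma>\<^sup>2)))"
      by (simp only: exp_add[symmetric])
    then show ?thesis unfolding normal_density_def by simp
  qed
  then have "(\<integral>\<^sup>+x. ennreal (normal_density 0 \<sigma> x) * ennreal (exp x) \<partial>lborel)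
      = (\<integral>\<^sup>+x. ennreal (exp (\<sigma>\<^sup>2 / 2)) * ennreal (normal_density (\<sigma>\<^sup>2) \<sigma> x) \<partial>lborel)"
    by (simp add: ennreal_mult[symmetric])
  also have "\<dots> = ennreal (exp (\<sigma>\<^sup>2 / 2)) * ennreal (\<integral>x. normal_density (\<sigma>\<^sup>2) \<sigma> x \<partial>lborel)"
    using assms by (simp add: nn_integral_cmult nn_integral_eq_integral)
  finally show ?thesis using assms by simp
qed

section \<open>The market and its martingale measure\<close>

locale bs_market =
  fixes m :: "('w, 'n::finite) market"
  assumes bs: "black_scholes_market m"
begin

abbreviation P where "P \<equiv> prob m"
abbreviation F where "F \<equiv> filt m"
abbreviation T where "T \<equiv> horizon m"
abbreviation W where "W \<equiv> wiener m"
abbreviation Q where "Q \<equiv> corr m"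
abbreviation r where "r \<equiv> rate m"
abbreviation \<theta> where "\<theta> \<equiv> risk_premium m"
abbreviation N where "N \<equiv> mart_measure m"

definition q where "q = matrix_inv Q *v \<theta>"
text \<open>This drift absorbs the excess return: in each coordinate dS = S (r dt + \<sigma>
  dW').\<close>

definition W' where "W' t \<omega> = W t \<omega> + t *\<^sub>R \<theta>"

lemma horizon_pos: "0 < T" and corr: "correlation_matrix Q"
  and wiener: "correlated_wiener P F T Q W"
  using bs by (auto simp: black_scholes_market_def)

sublocale P: prob_space P
  using bs by (simp add: black_scholes_market_def filtered_prob_space_def)

lemma subalg: "t \<in> {0..T} \<Longrightarrow> subalgebra P (F t)"
  and subalg_mono: "0 \<le> s \<Longrightarrow> s \<le> t \<Longrightarrow> t \<le> T \<Longrightarrow> subalgebra (F t) (F s)"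
  using bs by (auto simp: black_scholes_market_def filtered_prob_space_def)

lemma space_filt: "t \<in> {0..T} \<Longrightarrow> space (F t) = space P"
  using subalg[of t] by (simp add: subalgebra_def)

lemma filt_measurable_mono:
  "f \<in> measurable (F s) M' \<Longrightarrow> 0 \<le> s \<Longrightarrow> s \<le> t \<Longrightarrow> t \<le> T \<Longrightarrow> f \<in> measurable (F t) M'"
  using measurable_from_subalg[OF subalg_mono] .

lemma filt_measurable_prob:
  "f \<in> measurable (F s) M' \<Longrightarrow> s \<in> {0..T} \<Longrightarrow> f \<in> measurable P M'"
  using measurable_from_subalg[OF subalg] .

lemma wiener_measurable_filt: "t \<in> {0..T} \<Longrightarrow> W t \<in> borel_measurable (F t)"
  using wiener by (simp add: correlated_wiener_def)

lemma wiener_measurable: "t \<in> {0..T} \<Longrightarrow> W t \<in> borel_measurable P"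
  using filt_measurable_prob[OF wiener_measurable_filt] by simp

lemma corr_q: "Q *v q = \<theta>"
  by (simp add: q_def matrix_vector_mul_assoc correlation_matrix_matrix_inv[OF corr])

lemma mart_density_eq: "mart_density m \<omega> = exp (- (q \<bullet> W T \<omega>)) * exp (- (q \<bullet> \<theta>) * T / 2)"
  by (simp add: mart_density_def norm_inv_sqrt_matrix[OF corr] q_def exp_add[symmetric])

lemma mart_density_pos: "0 < mart_density m \<omega>"
  by (simp add: mart_density_def)

lemma mart_density_measurable_filt: "mart_density m \<in> borel_measurable (F T)"
  unfolding mart_density_eq[abs_def] using wiener_measurable_filt[of T] horizon_pos by simp

lemma mart_density_measurable [measurable]: "mart_density m \<in> borel_measurable P"
  using filt_measurable_prob[OF mart_density_measurable_filt] horizon_pos by simp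

lemma nn_integral_exp_increment:
  assumes st: "0 \<le> s" "s \<le> t" "t \<le> T" and X: "X \<in> borel_measurable (F s)"
  shows "(\<integral>\<^sup>+\<omega>. X \<omega> * ennreal (exp (a \<bullet> (W t \<omega> - W s \<omega>))) \<partial>P) =
    (\<integral>\<^sup>+\<omega>. X \<omega> \<partial>P) * ennreal (exp ((t - s) * (a \<bullet> (Q *v a)) / 2))"
proof (cases "s = t \<or> a = 0")
  \<comment> \<open>Degenerate case: the projected increment vanishes and has no normal
    density.\<close>
  case True then show ?thesis by auto
next
  case False
  define \<sigma> where "\<sigma> = sqrt ((t - s) * (a \<bullet> (Q *v a)))"
  have "0 < a \<bullet> (Q *v a)" using corr False by (auto simp: correlation_matrix_def)
  then have \<sigma>: "0 < \<sigma>" "\<sigma>\<^sup>2 = (t - s) * (a \<bullet> (Q *v a))" using False st by (auto simp: \<sigma>_def)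
  have indep: "P.indep_set (sets (F s)) (sets (vimage_algebra (space P) (\<lambda>\<omega>. W t \<omega> - W s \<omega>) borel))"
    and dist: "distributed P lborel (\<lambda>\<omega>. a \<bullet> (W t \<omega> - W s \<omega>)) (\<lambda>x. ennreal (normal_density 0 \<sigma> x))"
    using wiener False st by (auto simp: correlated_wiener_def \<sigma>_def)
  have "(\<integral>\<^sup>+\<omega>. X \<omega> * ennreal (exp (a \<bullet> (W t \<omega> - W s \<omega>))) \<partial>P) =
    (\<integral>\<^sup>+\<omega>. X \<omega> \<partial>P) * (\<integral>\<^sup>+\<omega>. ennreal (exp (a \<bullet> (W t \<omega> - W s \<omega>))) \<partial>P)"
    using wiener_measurable st
    by (intro P.indep_set_nn_integral_mult[OF indep subalg X, where g = "\<lambda>x. ennreal (exp (a \<bullet> x))"]) auto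
  also have "(\<integral>\<^sup>+\<omega>. ennreal (exp (a \<bullet> (W t \<omega> - W s \<omega>))) \<partial>P) = ennreal (exp (\<sigma>\<^sup>2 / 2))"
    using distributed_nn_integral[OF dist, of "\<lambda>x. ennreal (exp x)"] nn_integral_exp_normal[OF \<sigma>(1)]
    by simp
  finally show ?thesis by (simp add: \<sigma>(2))
qed

text \<open>The martingale property of the density, integrated against an
  \<open>F t\<close>-measurable weight instead of stated as a conditional expectation.\<close>

lemma nn_integral_exp_wiener:
  assumes t: "t \<in> {0..T}" and X: "X \<in> borel_measurable (F t)"
  shows "(\<integral>\<^sup>+\<omega>. X \<omega> * ennreal (exp (- (q \<bullet> W T \<omega>))) \<partial>P) =
    (\<integral>\<^sup>+\<omega>. X \<omega> * ennreal (exp (- (q \<bullet> W t \<omega>))) \<partial>P) * ennreal (exp ((T - t) * (q \<bullet> \<theta>) / 2))"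
proof -
  have "(\<integral>\<^sup>+\<omega>. X \<omega> * ennreal (exp (- (q \<bullet> W T \<omega>))) \<partial>P) =
    (\<integral>\<^sup>+\<omega>. (X \<omega> * ennreal (exp (- (q \<bullet> W t \<omega>)))) * ennreal (exp ((- q) \<bullet> (W T \<omega> - W t \<omega>))) \<partial>P)"
    by (intro nn_integral_cong)
      (simp add: mult.assoc ennreal_mult[symmetric] exp_add[symmetric] inner_diff_right)
  also have "\<dots> = (\<integral>\<^sup>+\<omega>. X \<omega> * ennreal (exp (- (q \<bullet> W t \<omega>))) \<partial>P) *
      ennreal (exp ((T - t) * ((- q) \<bullet> (Q *v (- q))) / 2))"
    using t X wiener_measurable_filt[OF t] by (intro nn_integral_exp_increment) auto
  also have "(- q) \<bullet> (Q *v (- q)) = q \<bullet> \<theta>"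
    by (simp add: linear_neg[OF matrix_vector_mul_linear] corr_q)
  finally show ?thesis .
qed

lemma nn_integral_mart_measure:
  assumes "X \<in> borel_measurable P"
  shows "(\<integral>\<^sup>+\<omega>. X \<omega> \<partial>N) =
    (\<integral>\<^sup>+\<omega>. X \<omega> * ennreal (exp (- (q \<bullet> W T \<omega>))) \<partial>P) * ennreal (exp (- (q \<bullet> \<theta>) * T / 2))"
proof -
  have "(\<integral>\<^sup>+\<omega>. X \<omega> \<partial>N) = (\<integral>\<^sup>+\<omega>. ennreal (mart_density m \<omega>) * X \<omega> \<partial>P)"
    unfolding mart_measure_def using assms by (intro nn_integral_density) auto
  also have "\<dots> = (\<integral>\<^sup>+\<omega>. (X \<omega> * ennreal (exp (- (q \<bullet> W T \<omega>)))) * ennreal (exp (- (q \<bullet> \<theta>) * T / 2)) \<partial>P)"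
    by (intro nn_integral_cong) (simp add: mart_density_eq ennreal_mult mult_ac)
  finally show ?thesis
    using assms wiener_measurable[of T] horizon_pos by (simp add: nn_integral_multc)
qed

text \<open>Girsanov's theorem, in the form of the conditional Laplace transform of the increments of
  \<open>W' t = W t + t \<theta>\<close> under the martingale measure.\<close>

theorem girsanov:
  assumes st: "0 \<le> s" "s \<le> t" "t \<le> T" and X: "X \<in> borel_measurable (F s)"
  shows "(\<integral>\<^sup>+\<omega>. X \<omega> * ennreal (exp (b \<bullet> (W' t \<omega> - W' s \<omega>))) \<partial>N) =
    (\<integral>\<^sup>+\<omega>. X \<omega> \<partial>N) * ennreal (exp ((t - s) * (b \<bullet> (Q *v b)) / 2))"
proof -
  let ?E = "\<lambda>x::real. ennreal (exp x)"
  have EE: "?E x * ?E y = ?E (x + y)" for x y by (simp add: ennreal_mult[symmetric] exp_add)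
  have [measurable]: "W s \<in> borel_measurable (F s)" "W t \<in> borel_measurable (F t)"
    "W s \<in> borel_measurable (F t)" "X \<in> borel_measurable (F s)" "X \<in> borel_measurable (F t)"
    "X \<in> borel_measurable P" "W s \<in> borel_measurable P" "W t \<in> borel_measurable P"
    using wiener_measurable_filt st X filt_measurable_mono[OF X] filt_measurable_prob[OF X]
      filt_measurable_mono[OF wiener_measurable_filt, of s t] wiener_measurable by auto
  have N: "(\<integral>\<^sup>+\<omega>. X \<omega> \<partial>N) = (\<integral>\<^sup>+\<omega>. X \<omega> * ?E (- (q \<bullet> W s \<omega>)) \<partial>P) * ?E ((T - s) * (q \<bullet> \<theta>) / 2) * ?E (- (q \<bullet> \<theta>) * T / 2)"
    using st by (simp add: nn_integral_mart_measure nn_integral_exp_wiener[of s])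
  \<comment> \<open>Y is \<open>F t\<close>-measurable, so the terminal density can be replaced by
    its value at t. What is left is an exponential of the increment over [s, t], with exponent b -
    q, against an \<open>F s\<close>-measurable factor.\<close>
  define Y where "Y \<omega> = X \<omega> * ?E (b \<bullet> (W t \<omega> - W s \<omega>))" for \<omega>
  have [measurable]: "Y \<in> borel_measurable (F t)" "Y \<in> borel_measurable P" unfolding Y_def by measurable
  have "(\<integral>\<^sup>+\<omega>. Y \<omega> \<partial>N) = (\<integral>\<^sup>+\<omega>. Y \<omega> * ?E (- (q \<bullet> W t \<omega>)) \<partial>P) * ?E ((T - t) * (q \<bullet> \<theta>) / 2) * ?E (- (q \<bullet> \<theta>) * T / 2)"
    using st by (simp add: nn_integral_mart_measure nn_integral_exp_wiener[of t])
  also have "(\<integral>\<^sup>+\<omega>. Y \<omega> * ?E (- (q \<bullet> W t \<omega>)) \<partial>P) =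
      (\<integral>\<^sup>+\<omega>. (X \<omega> * ?E (- (q \<bullet> W s \<omega>))) * ?E ((b - q) \<bullet> (W t \<omega> - W s \<omega>)) \<partial>P)"
    by (intro nn_integral_cong) (simp add: Y_def mult.assoc EE algebra_simps)
  also have "\<dots> = (\<integral>\<^sup>+\<omega>. X \<omega> * ?E (- (q \<bullet> W s \<omega>)) \<partial>P) * ?E ((t - s) * ((b - q) \<bullet> (Q *v (b - q))) / 2)"
    using st by (intro nn_integral_exp_increment) auto
  \<comment> \<open>Since Q q = \<theta>, the mixed term is -2 (b, \<theta>); the drift of
    \<open>W'\<close> contributes exp ((t - s) (b, \<theta>)) and cancels it.\<close>
  also have "(b - q) \<bullet> (Q *v (b - q)) = b \<bullet> (Q *v b) - 2 * (b \<bullet> \<theta>) + q \<bullet> \<theta>"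
    using correlation_matrix_inner_sym[OF corr, of q b]
    by (simp add: matrix_vector_mult_diff_distrib corr_q inner_diff_left inner_diff_right inner_commute)
  finally have Y: "(\<integral>\<^sup>+\<omega>. Y \<omega> \<partial>N) = (\<integral>\<^sup>+\<omega>. X \<omega> * ?E (- (q \<bullet> W s \<omega>)) \<partial>P) *
      ?E ((t - s) * (b \<bullet> (Q *v b) - 2 * (b \<bullet> \<theta>) + q \<bullet> \<theta>) / 2 + (T - t) * (q \<bullet> \<theta>) / 2 + - (q \<bullet> \<theta>) * T / 2)"
    by (simp only: mult.assoc EE)
  have "(\<integral>\<^sup>+\<omega>. X \<omega> * ennreal (exp (b \<bullet> (W' t \<omega> - W' s \<omega>))) \<partial>N) =
      (\<integral>\<^sup>+\<omega>. Y \<omega> * ?E ((t - s) * (b \<bullet> \<theta>)) \<partial>N)"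
    by (intro nn_integral_cong)
      (simp add: Y_def W'_def mult.assoc EE inner_diff_right inner_add_right algebra_simps)
  also have "\<dots> = (\<integral>\<^sup>+\<omega>. Y \<omega> \<partial>N) * ?E ((t - s) * (b \<bullet> \<theta>))"
    by (rule nn_integral_multc) (simp add: mart_measure_def)
  also have "\<dots> = (\<integral>\<^sup>+\<omega>. X \<omega> \<partial>N) * ?E ((t - s) * (b \<bullet> (Q *v b)) / 2)"
    unfolding Y N mult.assoc EE
    by (simp add: algebra_simps add_divide_distrib diff_divide_distrib)
  finally show ?thesis .
qed

lemma prob_space_mart_measure: "prob_space N"
proof
  have "emeasure N (space N) = (\<integral>\<^sup>+\<omega>. 1 \<partial>N)" by simp
  also have "\<dots> = (\<integral>\<^sup>+\<omega>. ennreal (exp (- (q \<bullet> W 0 \<omega>))) \<partial>P) *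
      ennreal (exp (T * (q \<bullet> \<theta>) / 2)) * ennreal (exp (- (q \<bullet> \<theta>) * T / 2))"
    using nn_integral_mart_measure[of "\<lambda>_. 1"] nn_integral_exp_wiener[of 0 "\<lambda>_. 1"] horizon_pos by simp
  also have "(\<integral>\<^sup>+\<omega>. ennreal (exp (- (q \<bullet> W 0 \<omega>))) \<partial>P) = (\<integral>\<^sup>+\<omega>. 1 \<partial>P)"
    using wiener by (intro nn_integral_cong_AE) (auto simp: correlated_wiener_def elim: AE_mp)
  finally show "emeasure N (space N) = 1"
    by (simp add: P.emeasure_space_1 ennreal_mult[symmetric] exp_add[symmetric] mult.assoc)
qed

end

section \<open>Moments of the increments of the drifted process\<close>

lemma square_le_exp_plus_exp_minus:
  fixes x :: real
  shows "x\<^sup>2 \<le> 4 * (exp x + exp (- x) - 2)"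
proof -
  have aux: "\<bar>u\<bar> \<le> \<bar>exp u - exp (- u)\<bar>" for u :: real
  proof (cases "0 \<le> u")
    case True
    then have "1 + u \<le> exp u" "exp (- u) \<le> 1" by auto
    then show ?thesis using True by linarith
  next
    case False
    then have "1 - u \<le> exp (- u)" "exp u \<le> 1" using exp_ge_add_one_self[of "- u"] by auto
    then show ?thesis using False by linarith
  qed
  \<comment> \<open>At u = x / 2 the square of exp u - exp (- u) is exactly exp x + exp (- x) - 2.
    The resulting factor 4 is not sharp; any constant would do.\<close>
  have "(x / 2)\<^sup>2 \<le> (exp (x / 2) - exp (- (x / 2)))\<^sup>2"
    using aux[of "x/2"] by (simp only: abs_le_square_iff)
  also have "\<dots> = exp x + exp (- x) - 2"
    by (simp add: power2_diff mult_exp_exp power2_eq_square[of "exp _"])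
  finally show ?thesis by (simp add: power_divide)
qed

lemma borel_measurable_vec_component [measurable (raw)]:
  fixes f :: "'a \<Rightarrow> real^'n"
  assumes "f \<in> borel_measurable M"
  shows "(\<lambda>x. f x $ i) \<in> borel_measurable M"
  using assms by (rule measurable_compose) (intro borel_measurable_continuous_onI continuous_intros)

context bs_market begin

sublocale N: prob_space N by (rule prob_space_mart_measure)

lemma sets_mart_measure [measurable_cong, simp]: "sets N = sets P"
  by (simp add: mart_measure_def)

lemma space_mart_measure [simp]: "space N = space P"
  by (simp add: mart_measure_def)

lemma W'_measurable_filt: "0 \<le> s \<Longrightarrow> s \<le> t \<Longrightarrow> t \<le> T \<Longrightarrow> W' s \<in> borel_measurable (F t)"
  using filt_measurable_mono[OF wiener_measurable_filt, of s t] unfolding W'_def by simp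

lemma W'_measurable: "t \<in> {0..T} \<Longrightarrow> W' t \<in> borel_measurable P"
  using wiener_measurable unfolding W'_def by simp

lemma corr_axis: "axis i 1 \<bullet> (Q *v axis i 1) = 1"
  using corr by (simp add: correlation_matrix_def inner_axis' matrix_vector_mult_basis column_def)

lemma girsanov_exp:
  assumes st: "0 \<le> s" "s \<le> t" "t \<le> T" and X: "X \<in> borel_measurable (F s)"
    and int: "integrable N X" and nonneg: "\<And>\<omega>. 0 \<le> X \<omega>"
  shows "integrable N (\<lambda>\<omega>. X \<omega> * exp (c * (W' t \<omega> $ i - W' s \<omega> $ i)))"
    and "(LINT \<omega>|N. X \<omega> * exp (c * (W' t \<omega> $ i - W' s \<omega> $ i))) =
      (LINT \<omega>|N. X \<omega>) * exp ((t - s) * c\<^sup>2 / 2)"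
proof -
  have [measurable]: "X \<in> borel_measurable P" "W' t \<in> borel_measurable P" "W' s \<in> borel_measurable P"
    using filt_measurable_prob[OF X] W'_measurable st by auto
  have "(\<integral>\<^sup>+\<omega>. ennreal (X \<omega> * exp (c * (W' t \<omega> $ i - W' s \<omega> $ i))) \<partial>N) =
      (\<integral>\<^sup>+\<omega>. ennreal (X \<omega>) * ennreal (exp ((c *\<^sub>R axis i 1) \<bullet> (W' t \<omega> - W' s \<omega>))) \<partial>N)"
    by (intro nn_integral_cong) (simp add: ennreal_mult nonneg inner_axis')
  also have "\<dots> = (\<integral>\<^sup>+\<omega>. ennreal (X \<omega>) \<partial>N) *
      ennreal (exp ((t - s) * ((c *\<^sub>R axis i 1) \<bullet> (Q *v (c *\<^sub>R axis i 1))) / 2))"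
    using st X by (intro girsanov) auto
  also have "(c *\<^sub>R axis i 1) \<bullet> (Q *v (c *\<^sub>R axis i 1)) = c\<^sup>2"
    by (simp add: matrix_vector_mult_scaleR corr_axis power2_eq_square)
  also have "(\<integral>\<^sup>+\<omega>. ennreal (X \<omega>) \<partial>N) = ennreal (LINT \<omega>|N. X \<omega>)"
    using int nonneg by (intro nn_integral_eq_integral) auto
  finally have "(\<integral>\<^sup>+\<omega>. ennreal (X \<omega> * exp (c * (W' t \<omega> $ i - W' s \<omega> $ i))) \<partial>N) =
      ennreal ((LINT \<omega>|N. X \<omega>) * exp ((t - s) * c\<^sup>2 / 2))"
    by (simp add: ennreal_mult nonneg integral_nonneg)
  then have "has_bochner_integral N (\<lambda>\<omega>. X \<omega> * exp (c * (W' t \<omega> $ i - W' s \<omega> $ i)))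
      ((LINT \<omega>|N. X \<omega>) * exp ((t - s) * c\<^sup>2 / 2))"
    by (intro has_bochner_integral_nn_integral) (auto simp: nonneg integral_nonneg)
  then show "integrable N (\<lambda>\<omega>. X \<omega> * exp (c * (W' t \<omega> $ i - W' s \<omega> $ i)))"
    "(LINT \<omega>|N. X \<omega> * exp (c * (W' t \<omega> $ i - W' s \<omega> $ i))) =
      (LINT \<omega>|N. X \<omega>) * exp ((t - s) * c\<^sup>2 / 2)"
    by (auto simp: has_bochner_integral_iff)
qed

text \<open>The weight X makes the statements conditional on \<open>F s\<close>. Both moments are
  read off from the exponential ones: the square is dominated by the exponentials for c = 1 and c =
  -1, and the mean is a derivative at c = 0.\<close>

lemma increment_moments_nonneg:
  fixes i :: 'n
  assumes st: "0 \<le> s" "s \<le> t" "t \<le> T" and X: "X \<in> borel_measurable (F s)"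
    and int: "integrable N X" and nonneg: "\<And>\<omega>. 0 \<le> X \<omega>"
  defines "D \<equiv> \<lambda>\<omega>. W' t \<omega> $ i - W' s \<omega> $ i"
  shows "integrable N (\<lambda>\<omega>. X \<omega> * D \<omega>)" and "(LINT \<omega>|N. X \<omega> * D \<omega>) = 0"
    and "integrable N (\<lambda>\<omega>. X \<omega> * (D \<omega>)\<^sup>2)"
    and "(LINT \<omega>|N. X \<omega> * (D \<omega>)\<^sup>2) \<le> 4 * exp (T / 2) * (t - s) * (LINT \<omega>|N. X \<omega>)"
proof -
  have [measurable]: "X \<in> borel_measurable P" "W' t \<in> borel_measurable P" "W' s \<in> borel_measurable P"
    using filt_measurable_prob[OF X] W'_measurable st by auto
  have [measurable]: "D \<in> borel_measurable P" unfolding D_def by measurable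
  define K where "K = (LINT \<omega>|N. X \<omega>)"
  have K: "0 \<le> K" unfolding K_def using nonneg by (simp add: integral_nonneg)
  have ex: "integrable N (\<lambda>\<omega>. X \<omega> * exp (c * D \<omega>))"
    "(LINT \<omega>|N. X \<omega> * exp (c * D \<omega>)) = K * exp ((t - s) * c\<^sup>2 / 2)" for c
    using girsanov_exp[OF st X int nonneg] by (auto simp: D_def K_def)
  have sq: "X \<omega> * (D \<omega>)\<^sup>2 \<le> 4 * (X \<omega> * exp (1 * D \<omega>) + X \<omega> * exp (- 1 * D \<omega>) - 2 * X \<omega>)" for \<omega>
    using mult_left_mono[OF square_le_exp_plus_exp_minus[of "D \<omega>"] nonneg[of \<omega>]] by (simp add: algebra_simps)
  have int4: "integrable N (\<lambda>\<omega>. 4 * (X \<omega> * exp (1 * D \<omega>) + X \<omega> * exp (- 1 * D \<omega>) - 2 * X \<omega>))"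
    using ex(1)[of 1] ex(1)[of "-1"] int by auto
  show int_sq: "integrable N (\<lambda>\<omega>. X \<omega> * (D \<omega>)\<^sup>2)"
    by (rule Bochner_Integration.integrable_bound[OF int4])
      (use sq nonneg in \<open>auto intro!: AE_I2 order_trans[OF _ abs_ge_self]\<close>)
  have "(LINT \<omega>|N. X \<omega> * (D \<omega>)\<^sup>2) \<le>
      (LINT \<omega>|N. 4 * (X \<omega> * exp (1 * D \<omega>) + X \<omega> * exp (- 1 * D \<omega>) - 2 * X \<omega>))"
    by (intro integral_mono int_sq int4 sq)
  also have "\<dots> = 8 * K * (exp ((t - s) / 2) - 1)"
    using ex[of 1] ex[of "-1"] int by (simp add: K_def[symmetric]) (simp add: algebra_simps)
  also have "\<dots> \<le> 8 * K * ((t - s) / 2 * exp (T / 2))"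
  proof -
    \<comment> \<open>With u = (t - s) / 2, this yields exp u - 1 <= u exp u. The bound becomes
      linear in t - s, so that summing over a grid produces an energy.\<close>
    have "1 - (t - s) / 2 \<le> exp (- ((t - s) / 2))" using exp_ge_add_one_self[of "- ((t - s) / 2)"] by simp
    then have "exp ((t - s) / 2) * (1 - (t - s) / 2) \<le> exp ((t - s) / 2) * exp (- ((t - s) / 2))"
      by (intro mult_left_mono) auto
    then have "exp ((t - s) / 2) - 1 \<le> (t - s) / 2 * exp ((t - s) / 2)"
      by (simp add: exp_minus field_simps)
    also have "\<dots> \<le> (t - s) / 2 * exp (T / 2)" using st by (intro mult_left_mono) auto
    finally show ?thesis using K by (intro mult_left_mono) auto
  qed
  finally show "(LINT \<omega>|N. X \<omega> * (D \<omega>)\<^sup>2) \<le> 4 * exp (T / 2) * (t - s) * (LINT \<omega>|N. X \<omega>)"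
    by (simp add: K_def algebra_simps)
  have int_D: "integrable N (\<lambda>\<omega>. X \<omega> * D \<omega>)"
  proof (rule Bochner_Integration.integrable_bound)
    show "integrable N (\<lambda>\<omega>. X \<omega> + X \<omega> * (D \<omega>)\<^sup>2)" using int int_sq by simp
    have "\<bar>x\<bar> \<le> 1 + x\<^sup>2" for x :: real
      using sum_squares_bound[of 1 "\<bar>x\<bar>"] by (simp add: power2_eq_square)
    then have "X \<omega> * \<bar>D \<omega>\<bar> \<le> X \<omega> * (1 + (D \<omega>)\<^sup>2)" for \<omega>
      using nonneg by (intro mult_left_mono) auto
    then show "AE \<omega> in N. norm (X \<omega> * D \<omega>) \<le> norm (X \<omega> + X \<omega> * (D \<omega>)\<^sup>2)"
      using nonneg by (intro AE_I2) (simp add: abs_mult algebra_simps)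
  qed measurable
  then show "integrable N (\<lambda>\<omega>. X \<omega> * D \<omega>)" .
  define a where "a = (LINT \<omega>|N. X \<omega> * D \<omega>)"
  \<comment> \<open>\<open>exp y \<ge> 1 + y\<close> gives \<open>h \<ge> 0 = h 0\<close>, so that \<open>h\<close> has derivative \<open>0\<close> at \<open>0\<close>.\<close>
  define h where "h c = K * exp ((t - s) * c\<^sup>2 / 2) - K - c * a" for c
  have h: "0 \<le> h c" for c
  proof -
    have "(LINT \<omega>|N. X \<omega> + c * (X \<omega> * D \<omega>)) \<le> (LINT \<omega>|N. X \<omega> * exp (c * D \<omega>))"
    proof (intro integral_mono ex)
      show "integrable N (\<lambda>\<omega>. X \<omega> + c * (X \<omega> * D \<omega>))" using int int_D by simp
      show "X \<omega> + c * (X \<omega> * D \<omega>) \<le> X \<omega> * exp (c * D \<omega>)" for \<omega>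
        using mult_left_mono[OF exp_ge_add_one_self[of "c * D \<omega>"] nonneg[of \<omega>]]
        by (simp add: algebra_simps)
    qed
    then show ?thesis using int int_D ex(2)[of c] by (simp add: h_def K_def a_def)
  qed
  have "(h has_real_derivative - a) (at 0)"
    unfolding h_def by (auto intro!: derivative_eq_intros)
  then have "- a = 0"
    by (rule DERIV_local_min[where d = 1]) (use h in \<open>auto simp: h_def\<close>)
  then show "(LINT \<omega>|N. X \<omega> * D \<omega>) = 0" by (simp add: a_def)
qed

lemma increment_mean_zero:
  assumes st: "0 \<le> s" "s \<le> t" "t \<le> T" and X: "X \<in> borel_measurable (F s)"
    and int: "integrable N X"
  shows "integrable N (\<lambda>\<omega>. X \<omega> * (W' t \<omega> $ i - W' s \<omega> $ i))"
    and "(LINT \<omega>|N. X \<omega> * (W' t \<omega> $ i - W' s \<omega> $ i)) = 0"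
proof -
  let ?D = "\<lambda>\<omega>. W' t \<omega> $ i - W' s \<omega> $ i"
  have p: "(\<lambda>\<omega>. max 0 (X \<omega>)) \<in> borel_measurable (F s)" "integrable N (\<lambda>\<omega>. max 0 (X \<omega>))"
    and n: "(\<lambda>\<omega>. max 0 (- X \<omega>)) \<in> borel_measurable (F s)" "integrable N (\<lambda>\<omega>. max 0 (- X \<omega>))"
    using X int by auto
  note P = increment_moments_nonneg(1,2)[OF st p] and N = increment_moments_nonneg(1,2)[OF st n]
  have eq: "X \<omega> * ?D \<omega> = max 0 (X \<omega>) * ?D \<omega> - max 0 (- X \<omega>) * ?D \<omega>" for \<omega>
    by (simp add: max_def)
  show "integrable N (\<lambda>\<omega>. X \<omega> * ?D \<omega>)" "(LINT \<omega>|N. X \<omega> * ?D \<omega>) = 0"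
    unfolding eq using P[of i] N[of i] by auto
qed

end

section \<open>Discrete martingale transforms\<close>

lemma sum_square_le_card_mult_sum_square:
  fixes f :: "'i \<Rightarrow> real"
  shows "(\<Sum>i\<in>I. f i)\<^sup>2 \<le> card I * (\<Sum>i\<in>I. (f i)\<^sup>2)"
  using Cauchy_Schwarz_ineq_sum[of "\<lambda>_. 1" f I] by simp

context bs_market begin

text \<open>Takes the place of the constant 1 in the Ito isometry: 4 exp (T / 2) comes from
  one-dimensional increments, the number of coordinates from Cauchy-Schwarz, since coordinates may
  be correlated.\<close>

definition moment_bound :: real where "moment_bound = 4 * exp (T / 2) * CARD('n)"

lemma moment_bound_nonneg: "0 \<le> moment_bound" by (simp add: moment_bound_def)

text \<open>Contributions of different grid intervals are orthogonal, so second moments add up over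
  j. Measurability of the partial sum at its last grid time is part of the induction, because the
  partial sum is a weight in the cross term; boundedness of \<open>h\<close> serves integrability
  only.\<close>

lemma martingale_transform:
  fixes g :: "nat \<Rightarrow> real" and h :: "nat \<Rightarrow> 'n \<Rightarrow> 'w \<Rightarrow> real"
  assumes "\<And>j. j \<le> n \<Longrightarrow> 0 \<le> g j \<and> g j \<le> T" and "\<And>j. j < n \<Longrightarrow> g j \<le> g (Suc j)"
    and "\<And>j i. j < n \<Longrightarrow> h j i \<in> borel_measurable (F (g j))"
    and "\<And>j i \<omega>. j < n \<Longrightarrow> \<omega> \<in> space P \<Longrightarrow> \<bar>h j i \<omega>\<bar> \<le> B"
  defines "M \<equiv> \<lambda>n \<omega>. \<Sum>j<n. \<Sum>i\<in>UNIV. h j i \<omega> * (W' (g (Suc j)) \<omega> $ i - W' (g j) \<omega> $ i)"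
  shows "M n \<in> borel_measurable (F (g n))" and "integrable N (M n)" and "(LINT \<omega>|N. M n \<omega>) = 0"
    and "integrable N (\<lambda>\<omega>. (M n \<omega>)\<^sup>2)"
    and "(LINT \<omega>|N. (M n \<omega>)\<^sup>2) \<le>
      moment_bound * (LINT \<omega>|N. (\<Sum>j<n. (g (Suc j) - g j) * (\<Sum>i\<in>UNIV. (h j i \<omega>)\<^sup>2)))"
proof -
  have "M n \<in> borel_measurable (F (g n)) \<and> integrable N (M n) \<and> (LINT \<omega>|N. M n \<omega>) = 0 \<and>
    integrable N (\<lambda>\<omega>. (M n \<omega>)\<^sup>2) \<and> (LINT \<omega>|N. (M n \<omega>)\<^sup>2) \<le>
      moment_bound * (LINT \<omega>|N. (\<Sum>j<n. (g (Suc j) - g j) * (\<Sum>i\<in>UNIV. (h j i \<omega>)\<^sup>2)))"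
    using assms(1-4)
  proof (induction n)
    case 0
    then show ?case by (simp add: M_def)
  next
    case (Suc n)
    define D where "D i \<omega> = W' (g (Suc n)) \<omega> $ i - W' (g n) \<omega> $ i" for i \<omega>
    define d where "d \<omega> = (\<Sum>i\<in>UNIV. h n i \<omega> * D i \<omega>)" for \<omega>
    have M_Suc: "M (Suc n) \<omega> = M n \<omega> + d \<omega>" for \<omega> by (simp add: M_def d_def D_def)
    have IH: "M n \<in> borel_measurable (F (g n))" "integrable N (M n)" "(LINT \<omega>|N. M n \<omega>) = 0"
      "integrable N (\<lambda>\<omega>. (M n \<omega>)\<^sup>2)" "(LINT \<omega>|N. (M n \<omega>)\<^sup>2) \<le>
        moment_bound * (LINT \<omega>|N. (\<Sum>j<n. (g (Suc j) - g j) * (\<Sum>i\<in>UNIV. (h j i \<omega>)\<^sup>2)))"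
      using Suc.IH Suc.prems by auto
    have st: "0 \<le> g n" "g n \<le> g (Suc n)" "g (Suc n) \<le> T"
      using Suc.prems(1)[of n] Suc.prems(1)[of "Suc n"] Suc.prems(2)[of n] by auto
    have hF: "h j i \<in> borel_measurable (F (g j))" if "j \<le> n" for j i using Suc.prems(3) that by simp
    have hP [measurable]: "h j i \<in> borel_measurable P" if "j \<le> n" for j i
      using filt_measurable_prob[OF hF[OF that]] Suc.prems(1)[of j] that by simp
    have MP [measurable]: "M n \<in> borel_measurable P"
      using filt_measurable_prob[OF IH(1)] st by simp
    have "W' (g (Suc n)) \<in> borel_measurable P" "W' (g n) \<in> borel_measurable P"
      using W'_measurable st by auto
    then have DP [measurable]: "D i \<in> borel_measurable P" for i
      unfolding D_def[abs_def] by measurable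
    have hB: "\<bar>h j i \<omega>\<bar> \<le> B" if "j \<le> n" "\<omega> \<in> space P" for j i \<omega> using Suc.prems(4) that by simp
    have h_int: "integrable N (h j i)" if "j \<le> n" for j i
      by (rule N.integrable_const_bound[where B = B]) (use hB hP that in \<open>auto intro!: AE_I2\<close>)
    have "(h j i \<omega>)\<^sup>2 \<le> B\<^sup>2" if "j \<le> n" "\<omega> \<in> space P" for j i \<omega>
      using hB[OF that] by (metis abs_ge_zero power2_abs power_mono)
    then have h2_int: "integrable N (\<lambda>\<omega>. (h j i \<omega>)\<^sup>2)" if "j \<le> n" for j i
      by (intro N.integrable_const_bound[where B = "B\<^sup>2"]) (use hP that in \<open>auto intro!: AE_I2\<close>)
    have Mh_int: "integrable N (\<lambda>\<omega>. M n \<omega> * h n i \<omega>)" for i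
    proof (rule Bochner_Integration.integrable_bound[OF integrable_mult_right[OF IH(2), of "B"]])
      show "AE \<omega> in N. norm (M n \<omega> * h n i \<omega>) \<le> norm (B * M n \<omega>)"
      proof (intro AE_I2)
        fix \<omega> assume "\<omega> \<in> space N"
        then have "\<bar>h n i \<omega>\<bar> \<le> \<bar>B\<bar>" using hB[of n \<omega> i] by simp
        then show "norm (M n \<omega> * h n i \<omega>) \<le> norm (B * M n \<omega>)"
          by (simp add: abs_mult mult.commute[of "\<bar>B\<bar>"] mult_left_mono)
      qed
    qed measurable
    have d: "integrable N (\<lambda>\<omega>. h n i \<omega> * D i \<omega>)" "(LINT \<omega>|N. h n i \<omega> * D i \<omega>) = 0" for i
      using increment_mean_zero[OF st hF[of n i] h_int[of n i], of i] by (auto simp: D_def)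
    \<comment> \<open>Orthogonality: the increment after \<open>g n\<close> has mean zero against a
      weight that is known at time \<open>g n\<close>.\<close>
    have Md: "integrable N (\<lambda>\<omega>. M n \<omega> * h n i \<omega> * D i \<omega>)" "(LINT \<omega>|N. M n \<omega> * h n i \<omega> * D i \<omega>) = 0" for i
      using increment_mean_zero[OF st _ Mh_int[of i], of i] IH(1) hF[of n i] by (auto simp: D_def)
    have d2: "integrable N (\<lambda>\<omega>. (h n i \<omega>)\<^sup>2 * (D i \<omega>)\<^sup>2)" "(LINT \<omega>|N. (h n i \<omega>)\<^sup>2 * (D i \<omega>)\<^sup>2) \<le>
        4 * exp (T / 2) * (g (Suc n) - g n) * (LINT \<omega>|N. (h n i \<omega>)\<^sup>2)" for i
      using increment_moments_nonneg(3,4)[OF st _ h2_int[of n i], of i] hF[of n i] by (auto simp: D_def)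
    have d_sq: "(d \<omega>)\<^sup>2 \<le> CARD('n) * (\<Sum>i\<in>UNIV. (h n i \<omega>)\<^sup>2 * (D i \<omega>)\<^sup>2)" for \<omega>
      using sum_square_le_card_mult_sum_square[of "\<lambda>i. h n i \<omega> * D i \<omega>" UNIV]
      by (simp add: d_def power_mult_distrib)
    have d_meas [measurable]: "d \<in> borel_measurable P" unfolding d_def[abs_def] by measurable
    have bound_int: "integrable N (\<lambda>\<omega>. CARD('n) * (\<Sum>i\<in>UNIV. (h n i \<omega>)\<^sup>2 * (D i \<omega>)\<^sup>2))"
      using d2 by simp
    have d_sq_int: "integrable N (\<lambda>\<omega>. (d \<omega>)\<^sup>2)"
      by (rule Bochner_Integration.integrable_bound[OF bound_int])
        (use d_sq in \<open>auto intro!: AE_I2 order_trans[OF _ abs_ge_self]\<close>)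
    have d_sq_le: "(LINT \<omega>|N. (d \<omega>)\<^sup>2) \<le>
        moment_bound * ((g (Suc n) - g n) * (\<Sum>i\<in>UNIV. LINT \<omega>|N. (h n i \<omega>)\<^sup>2))"
    proof -
      have "(LINT \<omega>|N. (d \<omega>)\<^sup>2) \<le> (LINT \<omega>|N. CARD('n) * (\<Sum>i\<in>UNIV. (h n i \<omega>)\<^sup>2 * (D i \<omega>)\<^sup>2))"
        by (intro integral_mono d_sq_int bound_int d_sq)
      also have "\<dots> = CARD('n) * (\<Sum>i\<in>UNIV. LINT \<omega>|N. (h n i \<omega>)\<^sup>2 * (D i \<omega>)\<^sup>2)"
        using d2 by simp
      also have "\<dots> \<le> CARD('n) * (\<Sum>i\<in>UNIV. 4 * exp (T / 2) * (g (Suc n) - g n) * (LINT \<omega>|N. (h n i \<omega>)\<^sup>2))"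
        by (intro mult_left_mono sum_mono d2) auto
      finally show ?thesis
        by (simp add: sum_distrib_left[symmetric] moment_bound_def mult_ac)
    qed
    have Md_eq: "M n \<omega> * d \<omega> = (\<Sum>i\<in>UNIV. M n \<omega> * h n i \<omega> * D i \<omega>)" for \<omega>
      by (simp add: d_def sum_distrib_left mult.assoc)
    have M_sq: "(M (Suc n) \<omega>)\<^sup>2 = (M n \<omega>)\<^sup>2 + 2 * (M n \<omega> * d \<omega>) + (d \<omega>)\<^sup>2" for \<omega>
      by (simp add: M_Suc power2_sum algebra_simps)
    have Md_int: "integrable N (\<lambda>\<omega>. M n \<omega> * d \<omega>)" "(LINT \<omega>|N. M n \<omega> * d \<omega>) = 0"
      unfolding Md_eq using Md by auto
    have d_int: "integrable N d" "(LINT \<omega>|N. d \<omega>) = 0"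
      unfolding d_def[abs_def] using d by auto
    have "M (Suc n) \<in> borel_measurable (F (g (Suc n)))"
    proof -
      have [measurable]: "W' (g (Suc n)) \<in> borel_measurable (F (g (Suc n)))" "W' (g n) \<in> borel_measurable (F (g (Suc n)))"
        "M n \<in> borel_measurable (F (g (Suc n)))" "\<And>i. h n i \<in> borel_measurable (F (g (Suc n)))"
        using W'_measurable_filt[of "g n" "g (Suc n)"] W'_measurable_filt[of "g (Suc n)" "g (Suc n)"] st
          filt_measurable_mono[OF IH(1) st] filt_measurable_mono[OF hF st] by auto
      show ?thesis unfolding M_Suc[abs_def] d_def D_def by measurable
    qed
    moreover have "integrable N (M (Suc n))" "(LINT \<omega>|N. M (Suc n) \<omega>) = 0"
      unfolding M_Suc[abs_def] using IH d_int by auto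
    moreover have "integrable N (\<lambda>\<omega>. (M (Suc n) \<omega>)\<^sup>2)"
      unfolding M_sq using IH(4) Md_int(1) d_sq_int by simp
    moreover have "(LINT \<omega>|N. (M (Suc n) \<omega>)\<^sup>2) \<le>
      moment_bound * (LINT \<omega>|N. (\<Sum>j<Suc n. (g (Suc j) - g j) * (\<Sum>i\<in>UNIV. (h j i \<omega>)\<^sup>2)))"
    proof -
      have "(LINT \<omega>|N. (M (Suc n) \<omega>)\<^sup>2) = (LINT \<omega>|N. (M n \<omega>)\<^sup>2) + (LINT \<omega>|N. (d \<omega>)\<^sup>2)"
        unfolding M_sq using IH(4) Md_int d_sq_int by simp
      also have "\<dots> \<le> moment_bound * (LINT \<omega>|N. (\<Sum>j<n. (g (Suc j) - g j) * (\<Sum>i\<in>UNIV. (h j i \<omega>)\<^sup>2))) +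
         moment_bound * ((g (Suc n) - g n) * (\<Sum>i\<in>UNIV. LINT \<omega>|N. (h n i \<omega>)\<^sup>2))"
        by (intro add_mono IH d_sq_le)
      also have "\<dots> = moment_bound * (LINT \<omega>|N. (\<Sum>j<Suc n. (g (Suc j) - g j) * (\<Sum>i\<in>UNIV. (h j i \<omega>)\<^sup>2)))"
      proof -
        have "(LINT \<omega>|N. (\<Sum>j<k. (g (Suc j) - g j) * (\<Sum>i\<in>UNIV. (h j i \<omega>)\<^sup>2))) =
            (\<Sum>j<k. (g (Suc j) - g j) * (\<Sum>i\<in>UNIV. LINT \<omega>|N. (h j i \<omega>)\<^sup>2))" if "k \<le> Suc n" for k
          using h2_int that by (subst Bochner_Integration.integral_sum) auto
        from this[of n] this[of "Suc n"] show ?thesis by (simp add: distrib_left)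
      qed
      finally show ?thesis .
    qed
    ultimately show ?case by blast
  qed
  then show "M n \<in> borel_measurable (F (g n))" "integrable N (M n)" "(LINT \<omega>|N. M n \<omega>) = 0"
    "integrable N (\<lambda>\<omega>. (M n \<omega>)\<^sup>2)" "(LINT \<omega>|N. (M n \<omega>)\<^sup>2) \<le>
      moment_bound * (LINT \<omega>|N. (\<Sum>j<n. (g (Suc j) - g j) * (\<Sum>i\<in>UNIV. (h j i \<omega>)\<^sup>2)))"
    by auto
qed

end

section \<open>Simple processes on grids\<close>

lemma simple_value_Nil [simp]: "simple_value [] u \<omega> = 0"
  and simple_value_Cons [simp]: "simple_value ((s, t, \<xi>) # hs) u \<omega> =
    \<xi> \<omega> * indicator {s<..t} u + simple_value hs u \<omega>"
  by (simp_all add: simple_value_def)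

lemma simple_integral_Nil [simp]: "simple_integral V [] u \<omega> = 0"
  and simple_integral_Cons [simp]: "simple_integral V ((s, t, \<xi>) # hs) u \<omega> =
    \<xi> \<omega> * (V (min t u) \<omega> - V (min s u) \<omega>) + simple_integral V hs u \<omega>"
  by (simp_all add: simple_integral_def)

lemma simple_process_Nil [simp]: "simple_process F T []"
  and simple_process_Cons [simp]: "simple_process F T ((s, t, \<xi>) # hs) \<longleftrightarrow>
    0 \<le> s \<and> s \<le> t \<and> t \<le> T \<and> \<xi> \<in> borel_measurable (F s) \<and> bounded (\<xi> ` space (F s)) \<and>
    simple_process F T hs"
  by (simp_all add: simple_process_def)

lemma simple_integral_add:
  "simple_integral (\<lambda>t \<omega>. V t \<omega> + c * U t \<omega>) hs u \<omega> =
    simple_integral V hs u \<omega> + c * simple_integral U hs u \<omega>"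
proof (induction hs)
  case (Cons h hs)
  then show ?case by (cases h) (simp add: algebra_simps)
qed simp

lemma simple_value_0: "simple_process F T hs \<Longrightarrow> simple_value hs 0 \<omega> = 0"
proof (induction hs)
  case (Cons h hs)
  then show ?case by (cases h) (auto simp: indicator_def)
qed simp

lemma simple_integral_0: "simple_process F T hs \<Longrightarrow> simple_integral V hs 0 \<omega> = 0"
proof (induction hs)
  case (Cons h hs)
  then show ?case by (cases h) (auto simp: min_absorb2)
qed simp

lemma simple_value_bounded:
  assumes "simple_process F T hs" "\<And>t. t \<in> {0..T} \<Longrightarrow> space (F t) = S"
  shows "\<exists>B. \<forall>u. \<forall>\<omega>\<in>S. \<bar>simple_value hs u \<omega>\<bar> \<le> B"
  using assms(1)
proof (induction hs)
  case Nil
  then show ?case by (auto intro!: exI[of _ 0])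
next
  case (Cons h hs)
  obtain s t \<xi> where h: "h = (s, t, \<xi>)" by (cases h)
  obtain B where B: "\<And>u \<omega>. \<omega> \<in> S \<Longrightarrow> \<bar>simple_value hs u \<omega>\<bar> \<le> B" using Cons h by auto
  have "bounded (\<xi> ` S)" using Cons.prems assms(2)[of s] h by auto
  then obtain C where C: "\<And>\<omega>. \<omega> \<in> S \<Longrightarrow> \<bar>\<xi> \<omega>\<bar> \<le> C" by (auto simp: bounded_real)
  have "\<bar>simple_value (h # hs) u \<omega>\<bar> \<le> C + B" if "\<omega> \<in> S" for u \<omega>
  proof -
    have "\<bar>\<xi> \<omega> * indicator {s<..t} u\<bar> \<le> C" using C[OF that] by (auto simp: indicator_def)
    then show ?thesis using B[OF that, of u] by (simp add: h)
  qed
  then show ?case by blast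
qed

lemma simple_value_path_measurable [measurable]: "(\<lambda>u. simple_value hs u \<omega>) \<in> borel_measurable borel"
proof (induction hs)
  case (Cons h hs)
  then show ?case by (cases h) simp
qed simp

lemma simple_value_path_bounded: "\<exists>B. \<forall>u. \<bar>simple_value hs u \<omega>\<bar> \<le> B"
proof (induction hs)
  case (Cons h hs)
  obtain s t \<xi> where h: "h = (s, t, \<xi>)" by (cases h)
  obtain B where B: "\<And>u. \<bar>simple_value hs u \<omega>\<bar> \<le> B" using Cons by auto
  have "\<bar>simple_value (h # hs) u \<omega>\<bar> \<le> \<bar>\<xi> \<omega>\<bar> + B" for u
  proof -
    have "\<bar>\<xi> \<omega> * indicator {s<..t} u\<bar> \<le> \<bar>\<xi> \<omega>\<bar>" by (auto simp: indicator_def)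
    then show ?thesis using B[of u] by (simp add: h)
  qed
  then show ?case by blast
qed (auto intro!: exI[of _ 0])

lemma set_integrable_bounded_Icc:
  fixes f :: "real \<Rightarrow> real"
  assumes "f \<in> borel_measurable borel" "\<And>u. \<bar>f u\<bar> \<le> B"
  shows "set_integrable lborel {a..b} f"
  unfolding set_integrable_def
proof (rule integrableI_bounded_set_indicator[where B = B])
  show "emeasure lborel {a..b} < \<infinity>" by (cases "a \<le> b") auto
qed (use assms in auto)

text \<open>Time is treated as one more integrator, so that the drift part of \<open>W'\<close> is
  again a simple integral.\<close>

lemma simple_integral_time:
  assumes "simple_process F T hs" "0 \<le> u"
  shows "(LINT s:{0..u}|lborel. simple_value hs s \<omega>) = simple_integral (\<lambda>t \<omega>. t) hs u \<omega>"
  using assms(1)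
proof (induction hs)
  case Nil
  then show ?case by (simp add: set_lebesgue_integral_def)
next
  case (Cons h hs)
  obtain s t \<xi> where h: "h = (s, t, \<xi>)" by (cases h)
  have st: "0 \<le> s" "s \<le> t" using Cons.prems h by auto
  obtain B where "\<And>u. \<bar>simple_value hs u \<omega>\<bar> \<le> B" using simple_value_path_bounded[of hs \<omega>] by blast
  then have int: "set_integrable lborel {0..u} (\<lambda>s. simple_value hs s \<omega>)"
    by (intro set_integrable_bounded_Icc) auto
  have "(LINT v:{0..u}|lborel. simple_value (h # hs) v \<omega>) =
      (LINT v:{0..u}|lborel. \<xi> \<omega> * indicator {s<..t} v) + (LINT v:{0..u}|lborel. simple_value hs v \<omega>)"
    unfolding h simple_value_Cons
    by (intro set_integral_add int set_integrable_bounded_Icc[of _ "\<bar>\<xi> \<omega>\<bar>"]) (auto simp: indicator_def)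
  also have "(LINT v:{0..u}|lborel. \<xi> \<omega> * indicator {s<..t} v) =
      (LINT v|lborel. \<xi> \<omega> * indicator {min s u<..min t u} v)"
    unfolding set_lebesgue_integral_def
    by (intro Bochner_Integration.integral_cong refl) (use st assms(2) in \<open>auto simp: indicator_def\<close>)
  also have "\<dots> = \<xi> \<omega> * (min t u - min s u)" using st by (simp add: min_def)
  finally show ?case using Cons h by simp
qed

text \<open>No interval endpoint lies strictly between v and u, hence the simple process is constant
  on (v, u].\<close>

definition no_jump :: "'w simple \<Rightarrow> real \<Rightarrow> real \<Rightarrow> bool" where
  "no_jump hs v u \<longleftrightarrow> (\<forall>(s, t, \<xi>)\<in>set hs. (s \<le> v \<or> u \<le> s) \<and> (t \<le> v \<or> u \<le> t))"

lemma no_jump_Nil [simp]: "no_jump [] v u"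
  and no_jump_Cons [simp]: "no_jump ((s, t, \<xi>) # hs) v u \<longleftrightarrow>
    (s \<le> v \<or> u \<le> s) \<and> (t \<le> v \<or> u \<le> t) \<and> no_jump hs v u"
  by (auto simp: no_jump_def)

lemma simple_value_no_jump:
  assumes "no_jump hs v u" "v < w" "w \<le> u"
  shows "simple_value hs w \<omega> = simple_value hs u \<omega>"
  using assms(1)
proof (induction hs)
  case (Cons h hs)
  then show ?case using assms(2,3) by (cases h) (auto simp: indicator_def)
qed simp

lemma simple_integral_no_jump:
  assumes "no_jump hs v u" "v < u" "simple_process F T hs"
  shows "simple_integral V hs u \<omega> - simple_integral V hs v \<omega> =
    simple_value hs u \<omega> * (V u \<omega> - V v \<omega>)"
  using assms(1,3)
proof (induction hs)
  case (Cons h hs)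
  obtain s t \<xi> where h: "h = (s, t, \<xi>)" by (cases h)
  have "\<xi> \<omega> * (V (min t u) \<omega> - V (min s u) \<omega>) - \<xi> \<omega> * (V (min t v) \<omega> - V (min s v) \<omega>) =
      \<xi> \<omega> * indicator {s<..t} u * (V u \<omega> - V v \<omega>)"
    using Cons.prems \<open>v < u\<close> unfolding h by (auto simp: min_def indicator_def algebra_simps)
  then show ?case using Cons unfolding h by (auto simp: algebra_simps)
qed simp

text \<open>Predictability: the intervals are open on the left, so under \<open>no_jump\<close> an
  interval that contains u has started by time v, and its coefficient is known then.\<close>

lemma simple_value_measurable:
  assumes "simple_process F T hs" "no_jump hs v u" "v < u" "v \<le> T"
    and "\<And>s. 0 \<le> s \<Longrightarrow> s \<le> v \<Longrightarrow> subalgebra (F v) (F s)"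
  shows "simple_value hs u \<in> borel_measurable (F v)"
  using assms(1,2)
proof (induction hs)
  case Nil
  then show ?case by (simp add: simple_value_def[abs_def])
next
  case (Cons h hs)
  obtain s t \<xi> where h: "h = (s, t, \<xi>)" by (cases h)
  have "(\<lambda>\<omega>. \<xi> \<omega> * indicator {s<..t} u) \<in> borel_measurable (F v)"
  proof (cases "s \<le> v")
    case True
    then have "\<xi> \<in> borel_measurable (F v)"
      using Cons.prems h by (intro measurable_from_subalg[OF assms(5)[of s]]) auto
    then show ?thesis by simp
  next
    case False
    then have "u \<notin> {s<..t}" using Cons.prems h by auto
    then show ?thesis by simp
  qed
  moreover have "simple_value hs u \<in> borel_measurable (F v)" using Cons h by simp
  ultimately show ?case unfolding h simple_value_Cons[abs_def] by (rule borel_measurable_add)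
qed

text \<open>The grid is the sorted union of A with an equidistant grid of mesh below
  \<delta>.\<close>

lemma finite_refining_grid:
  fixes A :: "real set"
  assumes "finite A" "A \<subseteq> {0..T}" "0 < T" "0 < \<delta>"
  obtains g :: "nat \<Rightarrow> real" and n where "g 0 = 0" "g n = T" "\<And>j. j < n \<Longrightarrow> g j < g (Suc j)"
    "\<And>j. j \<le> n \<Longrightarrow> g j \<in> {0..T}" "\<And>j. j < n \<Longrightarrow> g (Suc j) - g j \<le> \<delta>"
    "\<And>j a. j < n \<Longrightarrow> a \<in> A \<Longrightarrow> a \<le> g j \<or> g (Suc j) \<le> a"
proof -
  obtain k :: nat where k: "T / \<delta> < k" using reals_Archimedean2 by blast
  have "0 < T / \<delta>" using assms by simp
  with k have k0: "0 < real k" by linarith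
  have step: "T / k < \<delta>" using k k0 assms by (simp add: field_simps)
  define C where "C = insert 0 (insert T (A \<union> (\<lambda>i. i * T / k) ` {..k}))"
  have C: "finite C" "C \<subseteq> {0..T}" "0 \<in> C" "T \<in> C"
    using assms k0 by (auto simp: C_def field_simps)
  define xs where "xs = sorted_list_of_set C"
  have xs: "set xs = C" "sorted xs" "distinct xs" using C by (auto simp: xs_def)
  have str: "sorted_wrt (<) xs" using xs by (simp add: strict_sorted_iff)
  then have lt: "xs ! i < xs ! j" if "i < j" "j < length xs" for i j
    using that by (simp add: sorted_wrt_iff_nth_less)
  have len: "0 < length xs" using xs C by auto
  have gap: "c \<le> xs ! j \<or> xs ! Suc j \<le> c" if "c \<in> C" "Suc j < length xs" for c j
  proof -
    obtain i where i: "i < length xs" "c = xs ! i" using \<open>c \<in> C\<close> xs by (metis in_set_conv_nth)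
    show ?thesis
      using i that lt[of i j] lt[of "Suc j" i] by (cases "i < j"; cases "Suc j < i") (auto simp: not_less dest: le_antisym le_SucE)
  qed
  have nth: "xs ! j \<in> C" if "j < length xs" for j using that xs by (metis nth_mem)
  show thesis
  proof (rule that[of "\<lambda>j. xs ! j" "length xs - 1"])
    obtain i where i: "i < length xs" "xs ! i = 0" using C(3) xs by (metis in_set_conv_nth)
    then have "\<not> 0 < i" using lt[of 0 i] nth[OF len] C(2) by force
    then show "xs ! 0 = 0" using i by simp
    obtain i where i: "i < length xs" "xs ! i = T" using C(4) xs by (metis in_set_conv_nth)
    then have "\<not> i < length xs - 1" using lt[of i "length xs - 1"] nth[of "length xs - 1"] C(2) by force
    then have "i = length xs - 1" using i(1) by linarith
    then show "xs ! (length xs - 1) = T" using i by simp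
    show "xs ! j < xs ! Suc j" if "j < length xs - 1" for j using that lt by simp
    show "xs ! j \<in> {0..T}" if "j \<le> length xs - 1" for j
    proof -
      have "j < length xs" using that len by linarith
      then show ?thesis using nth C(2) by blast
    qed
    show "a \<le> xs ! j \<or> xs ! Suc j \<le> a" if "j < length xs - 1" "a \<in> A" for j a
      using gap[of a j] that by (auto simp: C_def)
    show "xs ! Suc j - xs ! j \<le> \<delta>" if j: "j < length xs - 1" for j
    proof -
      \<comment> \<open>The first equidistant point beyond \<open>xs ! j\<close> lies within
        distance T / k and belongs to the grid, so the successor of \<open>xs ! j\<close> cannot be
        further away.\<close>
      define i where "i = nat \<lfloor>xs ! j * k / T\<rfloor>"
      have j01: "0 \<le> xs ! j" "xs ! j \<le> T" "xs ! j < xs ! Suc j" "xs ! Suc j \<le> T"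
        using nth[of j] nth[of "Suc j"] j C(2) lt[of j "Suc j"] by (auto simp: subset_eq)
      have i: "real i \<le> xs ! j * k / T" "xs ! j * k / T < real i + 1"
        unfolding i_def using j01 k0 assms by (auto simp: of_nat_nat)
      then have i': "xs ! j < real (Suc i) * T / k" "real i * T / k \<le> xs ! j"
        using k0 assms by (auto simp: field_simps)
      have "xs ! j * k / T < k" using j01 k0 assms by (simp add: field_simps)
      then have "real i < k" using i by linarith
      then have "real (Suc i) * T / k \<in> C" unfolding C_def by (intro insertI2 UnI2 imageI) simp
      then have "xs ! Suc j \<le> real (Suc i) * T / k" using gap[of "real (Suc i) * T / k" j] j i' by simp
      also have "\<dots> = real i * T / k + T / k" by (simp add: add_divide_distrib algebra_simps)
      finally show ?thesis using i' step by linarith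
    qed
  qed
qed

section \<open>Discounting along a path\<close>

lemma abel_summation:
  fixes D y :: "nat \<Rightarrow> real"
  shows "(\<Sum>j<k. D j * (y (Suc j) - y j)) = D k * y k - D 0 * y 0 - (\<Sum>j<k. y (Suc j) * (D (Suc j) - D j))"
  by (induction k) (auto simp: algebra_simps)

lemma exp_discount_bounds:
  fixes \<rho> T :: real
  assumes "s \<in> {0..T}" "t \<in> {0..T}"
  shows "exp (- \<rho> * t) \<le> exp (\<bar>\<rho>\<bar> * T)"
    and "\<bar>exp (- \<rho> * t) - exp (- \<rho> * s)\<bar> \<le> \<bar>\<rho>\<bar> * exp (\<bar>\<rho>\<bar> * T) * \<bar>t - s\<bar>"
proof -
  have le: "exp (- \<rho> * u) \<le> exp (\<bar>\<rho>\<bar> * T)" if "u \<in> {0..T}" for u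
  proof -
    have "- \<rho> * u \<le> \<bar>\<rho>\<bar> * T" using that by (intro mult_mono) auto
    then show ?thesis by simp
  qed
  show "exp (- \<rho> * t) \<le> exp (\<bar>\<rho>\<bar> * T)" by (rule le) fact
  have "norm (exp (- \<rho> * t) - exp (- \<rho> * s)) \<le> (\<bar>\<rho>\<bar> * exp (\<bar>\<rho>\<bar> * T)) * norm (t - s)"
  proof (rule field_differentiable_bound[of "{0..T}" "\<lambda>u. exp (- \<rho> * u)" "\<lambda>u. - \<rho> * exp (- \<rho> * u)"])
    show "((\<lambda>u. exp (- \<rho> * u)) has_field_derivative - \<rho> * exp (- \<rho> * u)) (at u within {0..T})" for u
      by (auto intro!: derivative_eq_intros)
    show "norm (- \<rho> * exp (- \<rho> * u)) \<le> \<bar>\<rho>\<bar> * exp (\<bar>\<rho>\<bar> * T)" if "u \<in> {0..T}" for u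
      using le[OF that] by (auto simp: abs_mult intro!: mult_left_mono)
  qed (use assms in auto)
  then show "\<bar>exp (- \<rho> * t) - exp (- \<rho> * s)\<bar> \<le> \<bar>\<rho>\<bar> * exp (\<bar>\<rho>\<bar> * T) * \<bar>t - s\<bar>" by simp
qed

text \<open>If \<open>X = x + \<integral> \<rho> X dt + Y\<close>, then \<open>exp (- \<rho> t) X\<close> is \<open>x + \<integral> exp (- \<rho> s) dY\<close>; summation
  by parts controls the Riemann sums of that integral although \<open>Y\<close> need not have bounded variation.\<close>

lemma discounted_step:
  fixes X Y :: "real \<Rightarrow> real"
  assumes ab: "a \<in> {0..T}" "b \<in> {0..T}" "a \<le> b"
    and X: "continuous_on {0..T} X"
    and eq: "X b - X a = \<rho> * integral {a..b} X + (Y b - Y a)"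
    and osc: "\<And>s. s \<in> {a..b} \<Longrightarrow> \<bar>X s - X b\<bar> \<le> \<eta>" "\<And>s. s \<in> {a..b} \<Longrightarrow> \<bar>exp (- \<rho> * a) - exp (- \<rho> * s)\<bar> \<le> \<eta>"
    and B: "\<bar>X b\<bar> \<le> B"
  shows "\<bar>exp (- \<rho> * b) * X b - exp (- \<rho> * a) * X a - exp (- \<rho> * a) * (Y b - Y a)\<bar> \<le>
    \<bar>\<rho>\<bar> * (exp (\<bar>\<rho>\<bar> * T) + B) * \<eta> * (b - a)"
proof -
  let ?D = "\<lambda>t. exp (- \<rho> * t)"
  have Xab: "continuous_on {a..b} X" using ab by (intro continuous_on_subset[OF X]) auto
  have "((\<lambda>s. - \<rho> * ?D s) has_integral ?D b - ?D a) {a..b}"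
    using ab by (intro fundamental_theorem_of_calculus)
      (auto intro!: derivative_eq_intros simp: has_real_derivative_iff_has_vector_derivative[symmetric])
  then have iD: "((\<lambda>s. X b * (- \<rho> * ?D s)) has_integral X b * (?D b - ?D a)) {a..b}"
    by (rule has_integral_mult_right)
  have iX: "((\<lambda>s. \<rho> * ?D a * X s) has_integral \<rho> * ?D a * integral {a..b} X) {a..b}"
    using integrable_continuous_interval[OF Xab] by (intro has_integral_mult_right integrable_integral)
  have err: "?D b * X b - ?D a * X a - ?D a * (Y b - Y a) =
      X b * (?D b - ?D a) + \<rho> * ?D a * integral {a..b} X"
  proof -
    have "Y b - Y a = X b - X a - \<rho> * integral {a..b} X" using eq by simp
    show ?thesis unfolding \<open>Y b - Y a = _\<close> by (simp add: algebra_simps)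
  qed
  have "norm (X b * (?D b - ?D a) + \<rho> * ?D a * integral {a..b} X) \<le>
      (\<bar>\<rho>\<bar> * (exp (\<bar>\<rho>\<bar> * T) + B) * \<eta>) * measure lborel (cbox a b)"
  proof (rule has_integral_bound)
    show "((\<lambda>s. X b * (- \<rho> * ?D s) + \<rho> * ?D a * X s) has_integral
        X b * (?D b - ?D a) + \<rho> * ?D a * integral {a..b} X) (cbox a b)"
      using has_integral_add[OF iD iX] by simp
    have \<eta>: "0 \<le> \<eta>" using osc(1)[of b] ab by simp
    show "0 \<le> \<bar>\<rho>\<bar> * (exp (\<bar>\<rho>\<bar> * T) + B) * \<eta>" using \<eta> B by (auto intro!: mult_nonneg_nonneg add_nonneg_nonneg)
    fix s assume "s \<in> cbox a b"
    then have s: "s \<in> {a..b}" by simp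
    \<comment> \<open>The discount factor is compared with its value at a and the path with its
      value at b; the integrand then splits into two oscillations, each at most \<eta> up to a
      factor.\<close>
    have "X b * (- \<rho> * ?D s) + \<rho> * ?D a * X s = \<rho> * (?D a * (X s - X b) + X b * (?D a - ?D s))"
      by (simp add: algebra_simps)
    also have "\<bar>\<dots>\<bar> \<le> \<bar>\<rho>\<bar> * (\<bar>?D a * (X s - X b)\<bar> + \<bar>X b * (?D a - ?D s)\<bar>)"
      unfolding abs_mult[of \<rho>] by (intro mult_left_mono abs_triangle_ineq) simp
    also have "\<dots> \<le> \<bar>\<rho>\<bar> * (exp (\<bar>\<rho>\<bar> * T) * \<eta> + B * \<eta>)"
      unfolding abs_mult using osc[OF s] B exp_discount_bounds(1)[OF ab(1,1)]
      by (intro mult_left_mono add_mono mult_mono) auto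
    finally show "norm (X b * (- \<rho> * ?D s) + \<rho> * ?D a * X s) \<le> \<bar>\<rho>\<bar> * (exp (\<bar>\<rho>\<bar> * T) + B) * \<eta>"
      by (simp add: algebra_simps)
  qed
  then show ?thesis using ab unfolding err by simp
qed

text \<open>The first summand of the constant collects the errors of \<open>discounted_step\<close>,
  added over the grid. The other two come from replacing Y by Yn: summation by parts trades
  increments of Yn - Y for increments of the discount factor. Every prefix k is covered because the
  truncation may stop anywhere.\<close>

lemma discounted_riemann_sum:
  fixes X Y Yn :: "real \<Rightarrow> real" and g :: "nat \<Rightarrow> real"
  assumes g: "g 0 = 0" "\<And>j. j \<le> n \<Longrightarrow> g j \<in> {0..T}" "\<And>j. j < n \<Longrightarrow> g j < g (Suc j)"
    and X: "continuous_on {0..T} X" and X0: "X 0 = x"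
    and eq: "\<And>s t. 0 \<le> s \<Longrightarrow> s \<le> t \<Longrightarrow> t \<le> T \<Longrightarrow> X t - X s = \<rho> * integral {s..t} X + (Y t - Y s)"
    and osc: "\<And>j s. j < n \<Longrightarrow> s \<in> {g j..g (Suc j)} \<Longrightarrow> \<bar>X s - X (g (Suc j))\<bar> \<le> \<eta>"
      "\<And>j s. j < n \<Longrightarrow> s \<in> {g j..g (Suc j)} \<Longrightarrow> \<bar>exp (- \<rho> * g j) - exp (- \<rho> * s)\<bar> \<le> \<eta>"
    and B: "\<And>t. t \<in> {0..T} \<Longrightarrow> \<bar>X t\<bar> \<le> B"
    and Yn: "\<And>t. t \<in> {0..T} \<Longrightarrow> \<bar>Yn t - Y t\<bar> \<le> \<eta>" and \<eta>: "0 \<le> \<eta>" and T: "0 \<le> T" and k: "k \<le> n"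
  shows "\<bar>x + (\<Sum>j<k. exp (- \<rho> * g j) * (Yn (g (Suc j)) - Yn (g j))) - exp (- \<rho> * g k) * X (g k)\<bar> \<le>
    (\<bar>\<rho>\<bar> * (exp (\<bar>\<rho>\<bar> * T) + B) * T + 2 * exp (\<bar>\<rho>\<bar> * T) + \<bar>\<rho>\<bar> * exp (\<bar>\<rho>\<bar> * T) * T) * \<eta>"
proof -
  define D where "D j = exp (- \<rho> * g j)" for j
  define E where "E = exp (\<bar>\<rho>\<bar> * T)"
  have E: "0 \<le> E" by (simp add: E_def)
  define \<delta> where "\<delta> j = Yn (g j) - Y (g j)" for j
  have gk: "g k \<le> T" using g(2)[OF k] by simp
  have tel: "(\<Sum>j<k. g (Suc j) - g j) = g k" using sum_lessThan_telescope[of g k] g(1) by simp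
  have D: "\<bar>D j\<bar> \<le> E" "\<bar>D (Suc j) - D j\<bar> \<le> \<bar>\<rho>\<bar> * E * (g (Suc j) - g j)" if "j < k" for j
    using exp_discount_bounds[of "g j" T "g j" \<rho>] exp_discount_bounds(2)[of "g j" T "g (Suc j)" \<rho>] that k
      g(2)[of j] g(2)[of "Suc j"] g(3)[of j] by (auto simp: D_def E_def)
  have Dk: "\<bar>D j\<bar> \<le> E" if "j \<le> k" for j
    using exp_discount_bounds(1)[OF g(2) g(2), of j j \<rho>] that k by (auto simp: D_def E_def)
  have \<delta>: "\<bar>\<delta> j\<bar> \<le> \<eta>" if "j \<le> k" for j using Yn[OF g(2)[of j]] that k by (simp add: \<delta>_def)
  have "\<bar>\<Sum>j<k. D j * (\<delta> (Suc j) - \<delta> j)\<bar> \<le> \<bar>D k * \<delta> k\<bar> + \<bar>D 0 * \<delta> 0\<bar> + \<bar>\<Sum>j<k. \<delta> (Suc j) * (D (Suc j) - D j)\<bar>"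
    unfolding abel_summation by linarith
  also have "\<dots> \<le> E * \<eta> + E * \<eta> + (\<Sum>j<k. \<eta> * (\<bar>\<rho>\<bar> * E * (g (Suc j) - g j)))"
  proof (intro add_mono)
    show "\<bar>D k * \<delta> k\<bar> \<le> E * \<eta>" "\<bar>D 0 * \<delta> 0\<bar> \<le> E * \<eta>"
      unfolding abs_mult using Dk[of k] Dk[of 0] \<delta>[of k] \<delta>[of 0] E by (auto intro!: mult_mono)
    show "\<bar>\<Sum>j<k. \<delta> (Suc j) * (D (Suc j) - D j)\<bar> \<le> (\<Sum>j<k. \<eta> * (\<bar>\<rho>\<bar> * E * (g (Suc j) - g j)))"
      using D(2) \<delta> \<eta> by (intro order_trans[OF sum_abs] sum_mono) (auto simp: abs_mult intro!: mult_mono)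
  qed
  also have "(\<Sum>j<k. \<eta> * (\<bar>\<rho>\<bar> * E * (g (Suc j) - g j))) = \<eta> * (\<bar>\<rho>\<bar> * E * g k)"
    by (simp only: sum_distrib_left[symmetric] tel)
  also have "\<dots> \<le> \<eta> * (\<bar>\<rho>\<bar> * E * T)" using gk \<eta> E by (intro mult_left_mono) auto
  finally have 1: "\<bar>\<Sum>j<k. D j * (\<delta> (Suc j) - \<delta> j)\<bar> \<le> 2 * E * \<eta> + \<eta> * (\<bar>\<rho>\<bar> * E * T)" by simp
  have step: "\<bar>D (Suc j) * X (g (Suc j)) - D j * X (g j) - D j * (Y (g (Suc j)) - Y (g j))\<bar> \<le>
      \<bar>\<rho>\<bar> * (E + B) * \<eta> * (g (Suc j) - g j)" if "j < k" for j
    unfolding D_def E_def using that k g(2)[of j] g(2)[of "Suc j"] g(3)[of j] osc[of j]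
    by (intro discounted_step X eq B) auto
  have B0: "0 \<le> B" using B[of 0] T by simp
  have "D k * X (g k) - x - (\<Sum>j<k. D j * (Y (g (Suc j)) - Y (g j))) =
      (\<Sum>j<k. D (Suc j) * X (g (Suc j)) - D j * X (g j) - D j * (Y (g (Suc j)) - Y (g j)))"
    using sum_lessThan_telescope[of "\<lambda>j. D j * X (g j)" k] X0 g(1)
    by (simp add: sum_subtractf D_def)
  also have "\<bar>\<dots>\<bar> \<le> (\<Sum>j<k. \<bar>\<rho>\<bar> * (E + B) * \<eta> * (g (Suc j) - g j))"
    using step by (intro order_trans[OF sum_abs] sum_mono) auto
  also have "\<dots> = \<bar>\<rho>\<bar> * (E + B) * \<eta> * g k"
    by (simp only: sum_distrib_left[symmetric] tel)
  also have "\<dots> \<le> \<bar>\<rho>\<bar> * (E + B) * \<eta> * T" using gk \<eta> E B0 by (intro mult_left_mono) auto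
  finally have 2: "\<bar>D k * X (g k) - x - (\<Sum>j<k. D j * (Y (g (Suc j)) - Y (g j)))\<bar> \<le> \<bar>\<rho>\<bar> * (E + B) * \<eta> * T" .
  have "(\<Sum>j<k. D j * (Yn (g (Suc j)) - Yn (g j))) =
      (\<Sum>j<k. D j * (\<delta> (Suc j) - \<delta> j)) + (\<Sum>j<k. D j * (Y (g (Suc j)) - Y (g j)))"
    by (simp add: sum.distrib[symmetric] \<delta>_def algebra_simps)
  then have "\<bar>x + (\<Sum>j<k. D j * (Yn (g (Suc j)) - Yn (g j))) - D k * X (g k)\<bar> \<le>
      \<bar>\<rho>\<bar> * (E + B) * \<eta> * T + (2 * E * \<eta> + \<eta> * (\<bar>\<rho>\<bar> * E * T))"
    using 1 2 by linarith
  then show ?thesis unfolding D_def E_def by (simp add: algebra_simps)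
qed

section \<open>Convergence of integrals and the wealth equation along a path\<close>

lemma nonneg_second_moment_bounded_tendsto_0:
  assumes "prob_space M" and [measurable]: "\<And>n::nat. f n \<in> borel_measurable M"
    and nonneg: "\<And>n \<omega>. 0 \<le> f n \<omega>" and int: "\<And>n. integrable M (f n)"
    and int2: "\<And>n. integrable M (\<lambda>\<omega>. (f n \<omega>)\<^sup>2)"
    and C: "\<And>n. (LINT \<omega>|M. (f n \<omega>)\<^sup>2) \<le> C"
    and lim: "AE \<omega> in M. (\<lambda>n. f n \<omega>) \<longlonglongrightarrow> 0"
  shows "(\<lambda>n. LINT \<omega>|M. f n \<omega>) \<longlonglongrightarrow> (0::real)"
proof -
  interpret prob_space M by fact
  have C0: "0 \<le> C" by (rule order_trans[OF _ C[of 0]]) simp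
  have "\<forall>\<^sub>F n in sequentially. (LINT \<omega>|M. f n \<omega>) < e" if "0 < e" for e :: real
  proof -
    \<comment> \<open>The part above c costs at most C / (4 c), which this choice keeps below e / 4;
      the added 1 keeps c positive when C = 0.\<close>
    define c where "c = (C + 1) / e"
    have c: "0 < c" using C0 that by (simp add: c_def)
    have "(\<lambda>n. LINT \<omega>|M. min c (f n \<omega>)) \<longlonglongrightarrow> (LINT \<omega>|M. 0)"
    proof (rule integral_dominated_convergence[where w = "\<lambda>_. c"])
      show "AE \<omega> in M. (\<lambda>n. min c (f n \<omega>)) \<longlonglongrightarrow> 0"
        using lim
      proof eventually_elim
        case (elim \<omega>)
        have "(\<lambda>n. min c (f n \<omega>)) \<longlonglongrightarrow> min c 0" by (intro tendsto_min tendsto_const elim)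
        then show ?case using c by simp
      qed
      show "AE \<omega> in M. norm (min c (f n \<omega>)) \<le> c" for n
        using c nonneg[of n] by (intro AE_I2) (auto simp: min_def)
    qed auto
    then have "\<forall>\<^sub>F n in sequentially. (LINT \<omega>|M. min c (f n \<omega>)) < e / 2"
      using order_tendstoD(2)[of _ 0 sequentially "e / 2"] that by simp
    then show ?thesis
    proof eventually_elim
      case (elim n)
      have min_int: "integrable M (\<lambda>\<omega>. min c (f n \<omega>))"
        using int c by (intro Bochner_Integration.integrable_min) auto
      have "f n \<omega> \<le> min c (f n \<omega>) + (f n \<omega>)\<^sup>2 / (4 * c)" for \<omega>
      proof (cases "f n \<omega> \<le> c")
        case False
        \<comment> \<open>Expanding the square gives f - c <= f^2 / (4 c), with equality at f = 2
          c.\<close>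
        have "0 \<le> (f n \<omega> - 2 * c)\<^sup>2" by simp
        then have "4 * c * (f n \<omega> - c) \<le> (f n \<omega>)\<^sup>2" by (simp add: power2_eq_square algebra_simps)
        then show ?thesis using False c by (simp add: field_simps)
      qed (use c in auto)
      then have "(LINT \<omega>|M. f n \<omega>) \<le> (LINT \<omega>|M. min c (f n \<omega>) + (f n \<omega>)\<^sup>2 / (4 * c))"
        using int int2 min_int by (intro integral_mono) auto
      also have "\<dots> = (LINT \<omega>|M. min c (f n \<omega>)) + (LINT \<omega>|M. (f n \<omega>)\<^sup>2) / (4 * c)"
        using int2 min_int by simp
      also have "\<dots> < e / 2 + e / 4"
      proof (intro add_less_le_mono elim)
        have "(LINT \<omega>|M. (f n \<omega>)\<^sup>2) / (4 * c) \<le> C / (4 * c)" using C c by (intro divide_right_mono) auto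
        also have "\<dots> \<le> e / 4" using C0 that by (simp add: c_def field_simps)
        finally show "(LINT \<omega>|M. (f n \<omega>)\<^sup>2) / (4 * c) \<le> e / 4" .
      qed
      finally show ?case using that by simp
    qed
  qed
  moreover have "\<forall>\<^sub>F n in sequentially. a < (LINT \<omega>|M. f n \<omega>)" if "a < 0" for a
    using that Bochner_Integration.integral_nonneg[of M "f _"] nonneg by (intro always_eventually allI) (metis less_le_trans)
  ultimately show ?thesis by (intro order_tendstoI)
qed

lemma set_integral_sum:
  fixes f :: "'i \<Rightarrow> 'a \<Rightarrow> real"
  assumes "\<And>i. i \<in> I \<Longrightarrow> set_integrable M A (f i)"
  shows "set_integrable M A (\<lambda>x. \<Sum>i\<in>I. f i x)"
    and "(LINT x:A|M. (\<Sum>i\<in>I. f i x)) = (\<Sum>i\<in>I. LINT x:A|M. f i x)"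
  using assms unfolding set_integrable_def set_lebesgue_integral_def
  by (auto simp: sum_distrib_left intro!: Bochner_Integration.integral_sum)

lemma set_integrable_of_square:
  fixes f :: "real \<Rightarrow> real"
  assumes meas: "f \<in> borel_measurable (restrict_space borel {0..T})"
    and sq: "set_integrable lborel {0..T} (\<lambda>s. (f s)\<^sup>2)"
  shows "set_integrable lborel {0..T} f"
  unfolding set_integrable_def
proof (rule Bochner_Integration.integrable_bound)
  have "set_integrable lborel {0..T} (\<lambda>_. 1 :: real)"
    by (intro set_integrable_bounded_Icc[of _ 1]) auto
  then show "integrable lborel (\<lambda>s. indicator {0..T} s *\<^sub>R (1 + (f s)\<^sup>2))"
    using set_integral_add(1)[OF _ sq, of "\<lambda>_. 1"] by (simp add: set_integrable_def)
  show "(\<lambda>s. indicator {0..T} s *\<^sub>R f s) \<in> borel_measurable lborel"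
    using meas by (subst (asm) borel_measurable_restrict_space_iff) auto
  have "\<bar>y\<bar> \<le> 1 + y\<^sup>2" for y :: real
    using sum_squares_bound[of 1 "\<bar>y\<bar>"] by (simp add: power2_eq_square)
  then show "AE s in lborel. norm (indicator {0..T} s *\<^sub>R f s) \<le> norm (indicator {0..T} s *\<^sub>R (1 + (f s)\<^sup>2))"
    by (intro AE_I2) (auto simp: indicator_def)
qed

lemma set_integrable_mult_continuous:
  fixes f B :: "real \<Rightarrow> real"
  assumes f: "set_integrable lborel {0..T} f" and B: "continuous_on {0..T} B"
  shows "set_integrable lborel {0..T} (\<lambda>s. f s * B s)"
proof -
  have "bounded (B ` {0..T})" using B by (intro compact_imp_bounded compact_continuous_image) auto
  then obtain C where C: "\<And>s. s \<in> {0..T} \<Longrightarrow> \<bar>B s\<bar> \<le> C" unfolding bounded_real by blast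
  show ?thesis
    unfolding set_integrable_def
  proof (rule Bochner_Integration.integrable_bound)
    show "integrable lborel (\<lambda>s. C * (indicator {0..T} s *\<^sub>R f s))"
      using f by (simp add: set_integrable_def)
    have "(\<lambda>s. (indicator {0..T} s *\<^sub>R f s) * (indicator {0..T} s *\<^sub>R B s)) \<in> borel_measurable lborel"
      using f borel_measurable_continuous_on_indicator[OF _ B]
      by (intro borel_measurable_times) (auto simp: set_integrable_def)
    also have "(\<lambda>s. (indicator {0..T} s *\<^sub>R f s) * (indicator {0..T} s *\<^sub>R B s)) = (\<lambda>s. indicator {0..T} s *\<^sub>R (f s * B s))"
      by (auto simp: indicator_def)
    finally show "(\<lambda>s. indicator {0..T} s *\<^sub>R (f s * B s)) \<in> borel_measurable lborel" .
    show "AE s in lborel. norm (indicator {0..T} s *\<^sub>R (f s * B s)) \<le> norm (C * (indicator {0..T} s *\<^sub>R f s))"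
    proof (intro AE_I2)
      fix s
      show "norm (indicator {0..T} s *\<^sub>R (f s * B s)) \<le> norm (C * (indicator {0..T} s *\<^sub>R f s))"
      proof (cases "s \<in> {0..T}")
        case True
        then have "\<bar>B s\<bar> \<le> \<bar>C\<bar>" using C[of s] by simp
        then show ?thesis using True by (simp add: abs_mult mult.commute[of _ "\<bar>f s\<bar>"] mult_left_mono)
      qed simp
    qed
  qed
qed

lemma uniform_limit_set_integral:
  fixes f :: "real \<Rightarrow> real" and h :: "nat \<Rightarrow> real \<Rightarrow> real"
  assumes T: "0 < T" and f: "set_integrable lborel {0..T} f"
    and h: "\<And>n. set_integrable lborel {0..T} (h n)"
    and sq: "\<And>n. set_integrable lborel {0..T} (\<lambda>s. (h n s - f s)\<^sup>2)"
    and lim: "(\<lambda>n. LINT s:{0..T}|lborel. (h n s - f s)\<^sup>2) \<longlonglongrightarrow> 0"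
  shows "uniform_limit {0..T} (\<lambda>n u. LINT s:{0..u}|lborel. h n s) (\<lambda>u. LINT s:{0..u}|lborel. f s) sequentially"
proof (rule uniform_limitI)
  fix e :: real assume "0 < e"
  \<comment> \<open>The bound |d| <= a + d^2 / a replaces Cauchy-Schwarz; once the integral of d^2
    is below a^2, it integrates to at most a T + a = e / 2.\<close>
  define a where "a = e / (2 * (T + 1))"
  have a: "0 < a" using T \<open>0 < e\<close> by (simp add: a_def)
  have "\<forall>\<^sub>F n in sequentially. (LINT s:{0..T}|lborel. (h n s - f s)\<^sup>2) < a\<^sup>2"
    using lim a by (intro order_tendstoD) auto
  then show "\<forall>\<^sub>F n in sequentially. \<forall>u\<in>{0..T}.
      dist (LINT s:{0..u}|lborel. h n s) (LINT s:{0..u}|lborel. f s) < e"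
  proof eventually_elim
    case (elim n)
    have d: "set_integrable lborel {0..T} (\<lambda>s. h n s - f s)" using f h by auto
    have "(LINT s:{0..T}|lborel. \<bar>h n s - f s\<bar>) \<le> (LINT s:{0..T}|lborel. a + (h n s - f s)\<^sup>2 / a)"
    proof (rule set_integral_mono)
      show "set_integrable lborel {0..T} (\<lambda>s. \<bar>h n s - f s\<bar>)" using d by (rule set_integrable_abs)
      show "set_integrable lborel {0..T} (\<lambda>s. a + (h n s - f s)\<^sup>2 / a)"
        using sq[of n] by (intro set_integral_add(1) set_integrable_divide
            set_integrable_bounded_Icc[of "\<lambda>_. a" "\<bar>a\<bar>"]) auto
      show "\<bar>h n s - f s\<bar> \<le> a + (h n s - f s)\<^sup>2 / a" for s
      proof (cases "\<bar>h n s - f s\<bar> \<le> a")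
        case True
        moreover have "0 \<le> (h n s - f s)\<^sup>2 / a" using a by simp
        ultimately show ?thesis by linarith
      next
        case False
        then have "\<bar>h n s - f s\<bar> * a \<le> \<bar>h n s - f s\<bar> * \<bar>h n s - f s\<bar>" by (intro mult_left_mono) auto
        then have "\<bar>h n s - f s\<bar> \<le> (h n s - f s)\<^sup>2 / a"
          using a by (simp add: pos_le_divide_eq power2_eq_square)
        then show ?thesis using a by linarith
      qed
    qed
    also have "\<dots> = a * T + (LINT s:{0..T}|lborel. (h n s - f s)\<^sup>2) / a"
      using T a sq[of n] set_integrable_bounded_Icc[of "\<lambda>_. a" "\<bar>a\<bar>" 0 T]
      by (subst set_integral_add) (auto simp: set_lebesgue_integral_def)
    also have "\<dots> \<le> a * T + a\<^sup>2 / a" using elim a by (intro add_left_mono divide_right_mono) auto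
    also have "\<dots> = a * (T + 1)" using a by (simp add: power2_eq_square algebra_simps)
    also have "\<dots> = e / 2" using T by (simp add: a_def field_simps)
    finally have le: "(LINT s:{0..T}|lborel. \<bar>h n s - f s\<bar>) \<le> e / 2" .
    show ?case
    proof
      fix u assume u: "u \<in> {0..T}"
      have sub: "set_integrable lborel {0..u} k" if "set_integrable lborel {0..T} k" for k :: "real \<Rightarrow> real"
        using u by (intro set_integrable_subset[OF that]) auto
      have "\<bar>(LINT s:{0..u}|lborel. h n s) - (LINT s:{0..u}|lborel. f s)\<bar> = \<bar>LINT s:{0..u}|lborel. h n s - f s\<bar>"
        using sub[OF f] sub[OF h[of n]] by (simp add: set_integral_diff)
      also have "\<dots> \<le> (LINT s:{0..u}|lborel. \<bar>h n s - f s\<bar>)"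
        using set_integral_norm_bound[OF sub[OF d]] by simp
      also have "\<dots> \<le> (LINT s:{0..T}|lborel. \<bar>h n s - f s\<bar>)"
        unfolding set_lebesgue_integral_def
        using set_integrable_abs[OF d] set_integrable_abs[OF sub[OF d]] u
        by (intro integral_mono) (auto simp: set_integrable_def indicator_def)
      finally show "dist (LINT s:{0..u}|lborel. h n s) (LINT s:{0..u}|lborel. f s) < e"
        using le \<open>0 < e\<close> by (simp add: dist_real_def)
    qed
  qed
qed

text \<open>\<open>K i\<close> stands for the amount held in stock i times its volatility. With the
  stock drift written as K i (\<rho> / \<sigma> i + \<theta> i), the \<rho>-parts of bond and stocks
  recombine to \<rho> X and the \<theta>-parts are absorbed into Y. Continuity of X is not assumed
  but read off from the resulting equation.\<close>

lemma wealth_path: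
  fixes X p B :: "real \<Rightarrow> real" and K J :: "'n::finite \<Rightarrow> real \<Rightarrow> real"
  assumes T: "0 < T" and p: "set_integrable lborel {0..T} p" and B: "continuous_on {0..T} B"
    and K: "\<And>i. set_integrable lborel {0..T} (K i)"
    and X: "\<And>t. X t = p t * B t + (\<Sum>i\<in>UNIV. K i t / \<sigma> i)"
    and eq: "\<And>t. t \<in> {0..T} \<Longrightarrow> X t = x + (LINT s:{0..t}|lborel. p s * (\<rho> * B s)) +
      (\<Sum>i\<in>UNIV. (LINT s:{0..t}|lborel. K i s * (\<rho> / \<sigma> i + \<theta> i)) + J i t)"
    and J: "\<And>i. continuous_on {0..T} (J i)" "\<And>i. J i 0 = 0"
  defines "Y \<equiv> \<lambda>t. \<Sum>i\<in>UNIV. J i t + \<theta> i * (LINT s:{0..t}|lborel. K i s)"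
  shows "continuous_on {0..T} X" and "X 0 = x"
    and "\<And>s t. 0 \<le> s \<Longrightarrow> s \<le> t \<Longrightarrow> t \<le> T \<Longrightarrow> X t - X s = \<rho> * integral {s..t} X + (Y t - Y s)"
proof -
  have sub: "set_integrable lborel {0..t} k" if "set_integrable lborel {0..T} k" "t \<in> {0..T}" for k :: "real \<Rightarrow> real" and t
    using that by (intro set_integrable_subset[OF that(1)]) auto
  have pB: "set_integrable lborel {0..T} (\<lambda>s. p s * B s)"
    using p B by (rule set_integrable_mult_continuous)
  have Ksum: "set_integrable lborel {0..T} (\<lambda>s. \<Sum>i\<in>UNIV. K i s / \<sigma> i)"
    using K by (intro set_integral_sum) auto
  have XI: "set_integrable lborel {0..T} X"
    unfolding X[abs_def] using pB Ksum by (rule set_integral_add)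
  have X_eq: "X t = x + \<rho> * integral {0..t} X + Y t" if t: "t \<in> {0..T}" for t
  proof -
    have "(LINT s:{0..t}|lborel. X s) = (LINT s:{0..t}|lborel. p s * B s) + (\<Sum>i\<in>UNIV. (LINT s:{0..t}|lborel. K i s) / \<sigma> i)"
      unfolding X[abs_def] using sub[OF pB t] sub[OF Ksum t] sub[OF K t]
      by (simp add: set_integral_add set_integral_sum)
    moreover have "(LINT s:{0..t}|lborel. p s * (\<rho> * B s)) = \<rho> * (LINT s:{0..t}|lborel. p s * B s)"
      by (simp add: mult.left_commute[of _ \<rho>])
    moreover have "(LINT s:{0..t}|lborel. K i s * (\<rho> / \<sigma> i + \<theta> i)) =
        \<rho> * ((LINT s:{0..t}|lborel. K i s) / \<sigma> i) + \<theta> i * (LINT s:{0..t}|lborel. K i s)" for i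
      by (subst set_integral_mult_left) (simp add: algebra_simps)
    ultimately have "X t = x + \<rho> * (LINT s:{0..t}|lborel. X s) + Y t"
      using eq[OF t] by (simp add: Y_def sum.distrib sum_distrib_left distrib_left)
    also have "(LINT s:{0..t}|lborel. X s) = integral {0..t} X"
      using sub[OF XI t] by (rule set_borel_integral_eq_integral)
    finally show ?thesis .
  qed
  have Xint: "X integrable_on {0..T}" using XI by (rule set_borel_integral_eq_integral)
  have Kint: "K i integrable_on {0..T}" for i using K by (rule set_borel_integral_eq_integral)
  have "continuous_on {0..T} (\<lambda>t. LINT s:{0..t}|lborel. K i s)" for i
    using indefinite_integral_continuous_1[OF Kint[of i]]
    by (rule continuous_on_eq) (use sub[OF K[of i]] in \<open>auto simp: set_borel_integral_eq_integral(2)\<close>)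
  then have "continuous_on {0..T} Y" unfolding Y_def using J by (intro continuous_intros) auto
  then have "continuous_on {0..T} (\<lambda>t. x + \<rho> * integral {0..t} X + Y t)"
    using indefinite_integral_continuous_1[OF Xint] by (intro continuous_intros) auto
  then show "continuous_on {0..T} X"
    by (rule continuous_on_eq) (use X_eq in auto)
  have "Y 0 = 0"
    using sub[OF K, of 0] T by (simp add: Y_def J set_borel_integral_eq_integral(2))
  then show "X 0 = x" using X_eq[of 0] T by simp
  show "X t - X s = \<rho> * integral {s..t} X + (Y t - Y s)" if "0 \<le> s" "s \<le> t" "t \<le> T" for s t
  proof -
    have "integral {0..t} X = integral {0..s} X + integral {s..t} X"
      using that by (intro Henstock_Kurzweil_Integration.integral_combine[symmetric] integrable_on_subinterval[OF Xint]) auto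
    then show ?thesis using X_eq[of s] X_eq[of t] that by (simp add: algebra_simps)
  qed
qed

section \<open>Truncation at an energy level\<close>

lemma truncation_prefix:
  fixes c :: "nat \<Rightarrow> real"
  assumes c: "\<And>j. 0 \<le> c j" and k: "0 \<le> k"
  obtains \<kappa> where "\<kappa> \<le> n" "\<And>j. j < n \<Longrightarrow> (\<Sum>l\<le>j. c l) \<le> k \<longleftrightarrow> j < \<kappa>" "(\<Sum>l<\<kappa>. c l) \<le> k"
    "(\<Sum>l<n. c l) \<le> k \<Longrightarrow> \<kappa> = n"
proof -
  have mono: "(\<Sum>l<i. c l) \<le> (\<Sum>l<j. c l)" if "i \<le> j" for i j
    using that c by (intro sum_mono2) auto
  \<comment> \<open>The longest prefix within the budget; the empty one qualifies because k is
    nonnegative. Nonnegative summands make the test at j equivalent to j < \<kappa>.\<close>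
  define \<kappa> where "\<kappa> = (GREATEST i. i \<le> n \<and> (\<Sum>l<i. c l) \<le> k)"
  have \<kappa>: "\<kappa> \<le> n \<and> (\<Sum>l<\<kappa>. c l) \<le> k"
    unfolding \<kappa>_def by (rule GreatestI_nat[of _ 0 n]) (use k in auto)
  have le: "i \<le> \<kappa>" if "i \<le> n" "(\<Sum>l<i. c l) \<le> k" for i
    unfolding \<kappa>_def using that by (intro Greatest_le_nat[of _ _ n]) auto
  show thesis
  proof (rule that[of \<kappa>])
    show "(\<Sum>l\<le>j. c l) \<le> k \<longleftrightarrow> j < \<kappa>" if "j < n" for j
      using le[of "Suc j"] mono[of "Suc j" \<kappa>] \<kappa> that
      by (auto simp: lessThan_Suc_atMost Suc_le_eq intro: order_trans)
    show "(\<Sum>l<n. c l) \<le> k \<Longrightarrow> \<kappa> = n" using le[of n] \<kappa> by simp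
  qed (use \<kappa> in auto)
qed

lemma sum_lessThan_prefix:
  fixes f :: "nat \<Rightarrow> 'a::comm_monoid_add"
  assumes "k \<le> n"
  shows "(\<Sum>j<n. if j < k then f j else 0) = (\<Sum>j<k. f j)"
  using assms by (intro sum.mono_neutral_cong_right) auto

lemma simple_value_square_integral:
  fixes g :: "nat \<Rightarrow> real"
  assumes hs: "simple_process F T hs" and g: "g 0 = 0" "\<And>j. j < n \<Longrightarrow> g j < g (Suc j)"
    and nj: "\<And>j. j < n \<Longrightarrow> no_jump hs (g j) (g (Suc j))"
  shows "(LINT s:{0..g n}|lborel. (simple_value hs s \<omega>)\<^sup>2) =
    (\<Sum>j<n. (g (Suc j) - g j) * (simple_value hs (g (Suc j)) \<omega>)\<^sup>2)"
proof -
  have "indicator {0..g n} s * (simple_value hs s \<omega>)\<^sup>2 =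
      (\<Sum>j<n. (simple_value hs (g (Suc j)) \<omega>)\<^sup>2 * indicator {g j<..g (Suc j)} s)" for s
    using g(2) nj
  proof (induction n)
    case 0
    then show ?case using simple_value_0[OF hs] g(1) by (simp add: indicator_def)
  next
    case (Suc n)
    have "0 \<le> g k" if "k \<le> n" for k
      using that Suc.prems(1)[of "k - 1"]
    proof (induction k)
      case (Suc k)
      then show ?case using Suc.IH Suc.prems \<open>\<And>j. j < Suc n \<Longrightarrow> g j < g (Suc j)\<close>[of k]
          \<open>\<And>j. j < Suc n \<Longrightarrow> g j < g (Suc j)\<close>[of "k - 1"] by simp
    qed (simp add: g(1))
    then have gn: "0 \<le> g n" by simp
    have "indicator {0..g (Suc n)} s * (simple_value hs s \<omega>)\<^sup>2 =
        indicator {0..g n} s * (simple_value hs s \<omega>)\<^sup>2 + (simple_value hs (g (Suc n)) \<omega>)\<^sup>2 * indicator {g n<..g (Suc n)} s"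
      using Suc.prems(1)[of n] gn simple_value_no_jump[OF Suc.prems(2)[of n], of s \<omega>]
      by (auto simp: indicator_def)
    then show ?case using Suc by simp
  qed
  then have "(LINT s:{0..g n}|lborel. (simple_value hs s \<omega>)\<^sup>2) =
      (LINT s|lborel. (\<Sum>j<n. (simple_value hs (g (Suc j)) \<omega>)\<^sup>2 * indicator {g j<..g (Suc j)} s))"
    by (simp add: set_lebesgue_integral_def)
  also have "\<dots> = (\<Sum>j<n. (simple_value hs (g (Suc j)) \<omega>)\<^sup>2 * (g (Suc j) - g j))"
    using g(2) by (subst Bochner_Integration.integral_sum) (auto intro!: sum.cong simp: less_imp_le)
  finally show ?thesis by (simp add: mult.commute)
qed

section \<open>Discounted wealth is a supermartingale\<close>

context bs_market begin

lemma AE_mart_measure: "AE \<omega> in P. R \<omega> \<Longrightarrow> AE \<omega> in N. R \<omega>"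
  unfolding mart_measure_def by (subst AE_density) (auto elim: AE_mp)

context
  fixes hs :: "'n \<Rightarrow> 'w simple" and g :: "nat \<Rightarrow> real" and n :: nat and k :: real
  assumes hs: "\<And>i. simple_process F T (hs i)"
    and g0: "g 0 = 0" and gn: "g n = T" and g_less: "\<And>j. j < n \<Longrightarrow> g j < g (Suc j)"
    and g_in: "\<And>j. j \<le> n \<Longrightarrow> g j \<in> {0..T}"
    and nj: "\<And>j i. j < n \<Longrightarrow> no_jump (hs i) (g j) (g (Suc j))" and k: "0 \<le> k"
begin

text \<open>The squared L^2 norm in time of the undiscounted integrand over one grid interval,
  summed over the coordinates.\<close>

definition energy where
  "energy j \<omega> = (g (Suc j) - g j) * (\<Sum>i\<in>UNIV. (simple_value (hs i) (g (Suc j)) \<omega>)\<^sup>2)"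

text \<open>The integrand is switched off before its energy exceeds \<open>k\<close>. Whether this happens on
  \<open>(g j, g (j + 1)]\<close> is known at time \<open>g j\<close>, so there is no overshoot.\<close>

definition truncated_integrand where
  "truncated_integrand j i \<omega> = (if (\<Sum>l\<le>j. if l < n then energy l \<omega> else 0) \<le> k
     then exp (- r * g j) * simple_value (hs i) (g (Suc j)) \<omega> else 0)"

definition truncated_integral where
  "truncated_integral \<omega> = (\<Sum>j<n. \<Sum>i\<in>UNIV. truncated_integrand j i \<omega> * (W' (g (Suc j)) \<omega> $ i - W' (g j) \<omega> $ i))"

text \<open>Along a fixed path the adapted test becomes a cutoff index. The truncated integral is
  then a plain partial sum, to which the estimates for prefixes apply.\<close>

lemma truncated_integral_prefix:
  obtains \<kappa> where "\<kappa> \<le> n"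
    "\<And>j i. j < n \<Longrightarrow> truncated_integrand j i \<omega> =
       (if j < \<kappa> then exp (- r * g j) * simple_value (hs i) (g (Suc j)) \<omega> else 0)"
    "(\<Sum>l<\<kappa>. energy l \<omega>) \<le> k"
    "(\<Sum>l<n. energy l \<omega>) \<le> k \<Longrightarrow> \<kappa> = n"
proof -
  \<comment> \<open>The guard \<open>l < n\<close> is what makes every summand nonnegative: beyond
    the grid \<open>g\<close> is arbitrary, and an energy could be negative.\<close>
  have "0 \<le> (if l < n then energy l \<omega> else 0)" for l
    using g_less[of l] by (auto simp: energy_def intro!: mult_nonneg_nonneg sum_nonneg)
  then obtain \<kappa> where \<kappa>: "\<kappa> \<le> n"
    "\<And>j. j < n \<Longrightarrow> (\<Sum>l\<le>j. if l < n then energy l \<omega> else 0) \<le> k \<longleftrightarrow> j < \<kappa>"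
    "(\<Sum>l<\<kappa>. if l < n then energy l \<omega> else 0) \<le> k"
    "(\<Sum>l<n. if l < n then energy l \<omega> else 0) \<le> k \<Longrightarrow> \<kappa> = n"
    using truncation_prefix[of "\<lambda>l. if l < n then energy l \<omega> else 0" k n] k by blast
  show thesis
  proof (rule that[OF \<kappa>(1)])
    have "(\<Sum>l<\<kappa>. if l < n then energy l \<omega> else 0) = (\<Sum>l<\<kappa>. energy l \<omega>)"
      using \<kappa>(1) by (intro sum.cong) auto
    then show "(\<Sum>l<\<kappa>. energy l \<omega>) \<le> k" using \<kappa>(3) by simp
    show "(\<Sum>l<n. energy l \<omega>) \<le> k \<Longrightarrow> \<kappa> = n" using \<kappa>(4) by simp
  qed (use \<kappa>(2) in \<open>auto simp: truncated_integrand_def\<close>)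
qed

lemma energy_sum: "(\<Sum>l<n. energy l \<omega>) = (\<Sum>i\<in>UNIV. LINT s:{0..T}|lborel. (simple_value (hs i) s \<omega>)\<^sup>2)"
proof -
  have "(\<Sum>i\<in>UNIV. LINT s:{0..T}|lborel. (simple_value (hs i) s \<omega>)\<^sup>2) =
      (\<Sum>i\<in>UNIV. \<Sum>j<n. (g (Suc j) - g j) * (simple_value (hs i) (g (Suc j)) \<omega>)\<^sup>2)"
    by (simp only: simple_value_square_integral[where n = n and g = g, OF hs g0 g_less nj, unfolded gn])
  also have "\<dots> = (\<Sum>j<n. \<Sum>i\<in>UNIV. (g (Suc j) - g j) * (simple_value (hs i) (g (Suc j)) \<omega>)\<^sup>2)"
    by (rule sum.swap)
  finally show ?thesis by (simp add: energy_def sum_distrib_left)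
qed

text \<open>The integrand on the interval after \<open>g l\<close> is known at \<open>g l\<close>
  already, hence the energy up to and including interval j is known at \<open>g j\<close>.\<close>

lemma simple_value_grid_measurable:
  assumes "l \<le> j" "j < n"
  shows "simple_value (hs i) (g (Suc l)) \<in> borel_measurable (F (g j))"
proof -
  have gl: "g l \<in> {0..T}" "g j \<in> {0..T}" "l < n" using g_in assms by auto
  have "g l \<le> g j"
    using assms
  proof (induction j rule: dec_induct)
    case (step j)
    then show ?case using g_less[of j] by simp
  qed simp
  moreover have "simple_value (hs i) (g (Suc l)) \<in> borel_measurable (F (g l))"
    using gl subalg_mono by (intro simple_value_measurable[OF hs nj g_less]) auto
  ultimately show ?thesis using filt_measurable_mono[of _ "g l" _ "g j"] gl by auto
qed

lemma truncated_integrand_measurable: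
  assumes j: "j < n"
  shows "truncated_integrand j i \<in> borel_measurable (F (g j))"
proof -
  note [measurable] = simple_value_grid_measurable[OF _ j]
  have "(\<lambda>\<omega>. if l < n then energy l \<omega> else 0) \<in> borel_measurable (F (g j))" if "l \<in> {..j}" for l
    using that unfolding energy_def by simp
  then have [measurable]: "(\<lambda>\<omega>. \<Sum>l\<le>j. if l < n then energy l \<omega> else 0) \<in> borel_measurable (F (g j))"
    by (rule borel_measurable_sum)
  have [measurable]: "simple_value (hs i) (g (Suc j)) \<in> borel_measurable (F (g j))"
    using simple_value_grid_measurable[of j j] j by simp
  show ?thesis unfolding truncated_integrand_def[abs_def] by measurable
qed

text \<open>The bound depends on \<open>hs\<close> and may grow along the approximation; it secures
  integrability and does not enter the second-moment estimate.\<close>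

lemma truncated_integrand_bounded:
  obtains B where "\<And>j i \<omega>. j < n \<Longrightarrow> \<omega> \<in> space P \<Longrightarrow> \<bar>truncated_integrand j i \<omega>\<bar> \<le> B"
proof -
  have "\<exists>b. \<forall>u. \<forall>\<omega>\<in>space P. \<bar>simple_value (hs i) u \<omega>\<bar> \<le> b" for i
    using simple_value_bounded[OF hs space_filt] .
  then obtain b where b: "\<And>i u \<omega>. \<omega> \<in> space P \<Longrightarrow> \<bar>simple_value (hs i) u \<omega>\<bar> \<le> b i" by metis
  show thesis
  proof (rule that[of "exp (\<bar>r\<bar> * T) * (\<Sum>i\<in>UNIV. \<bar>b i\<bar>)"])
    fix j i \<omega> assume j: "j < n" and \<omega>: "\<omega> \<in> space P"
    have "\<bar>simple_value (hs i) (g (Suc j)) \<omega>\<bar> \<le> (\<Sum>i\<in>UNIV. \<bar>b i\<bar>)"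
      using b[OF \<omega>, of i "g (Suc j)"] member_le_sum[of i UNIV "\<lambda>i. \<bar>b i\<bar>"] by simp
    moreover have "exp (- r * g j) \<le> exp (\<bar>r\<bar> * T)"
      using j by (intro exp_discount_bounds(1)[of 0] g_in) (use horizon_pos in auto)
    ultimately show "\<bar>truncated_integrand j i \<omega>\<bar> \<le> exp (\<bar>r\<bar> * T) * (\<Sum>i\<in>UNIV. \<bar>b i\<bar>)"
      unfolding truncated_integrand_def by (auto simp: abs_mult intro!: mult_mono mult_nonneg_nonneg sum_nonneg)
  qed
qed

lemma truncated_integral:
  shows "truncated_integral \<in> borel_measurable P" and "integrable N truncated_integral"
    and "(LINT \<omega>|N. truncated_integral \<omega>) = 0" and "integrable N (\<lambda>\<omega>. (truncated_integral \<omega>)\<^sup>2)"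
    and "(LINT \<omega>|N. (truncated_integral \<omega>)\<^sup>2) \<le> moment_bound * ((exp (\<bar>r\<bar> * T))\<^sup>2 * k)"
proof -
  obtain B where B: "\<And>j i \<omega>. j < n \<Longrightarrow> \<omega> \<in> space P \<Longrightarrow> \<bar>truncated_integrand j i \<omega>\<bar> \<le> B"
    using truncated_integrand_bounded by blast
  note mt = martingale_transform[of n g truncated_integrand B, folded truncated_integral_def,
      OF _ _ truncated_integrand_measurable B]
  have "truncated_integral \<in> borel_measurable (F T)"
    using mt(1) g_in g_less by (auto simp: gn less_imp_le)
  then show "truncated_integral \<in> borel_measurable P"
    by (rule filt_measurable_prob) (use horizon_pos in simp)
  show "integrable N truncated_integral" "(LINT \<omega>|N. truncated_integral \<omega>) = 0"
    "integrable N (\<lambda>\<omega>. (truncated_integral \<omega>)\<^sup>2)"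
    using mt(2-4) g_in g_less by (auto simp: less_imp_le)
  define e where "e \<omega> = (\<Sum>j<n. (g (Suc j) - g j) * (\<Sum>i\<in>UNIV. (truncated_integrand j i \<omega>)\<^sup>2))" for \<omega>
  have e_le: "e \<omega> \<le> (exp (\<bar>r\<bar> * T))\<^sup>2 * k" for \<omega>
  proof -
    obtain \<kappa> where \<kappa>: "\<kappa> \<le> n" "\<And>j i. j < n \<Longrightarrow> truncated_integrand j i \<omega> =
       (if j < \<kappa> then exp (- r * g j) * simple_value (hs i) (g (Suc j)) \<omega> else 0)"
      "(\<Sum>l<\<kappa>. energy l \<omega>) \<le> k" "(\<Sum>l<n. energy l \<omega>) \<le> k \<Longrightarrow> \<kappa> = n"
      by (rule truncated_integral_prefix[of \<omega>]) (rule that)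
    have "e \<omega> = (\<Sum>j<n. if j < \<kappa> then (exp (- r * g j))\<^sup>2 * energy j \<omega> else 0)"
      unfolding e_def
    proof (intro sum.cong refl)
      fix j assume "j \<in> {..<n}"
      then have "j < n" by simp
      then show "(g (Suc j) - g j) * (\<Sum>i\<in>UNIV. (truncated_integrand j i \<omega>)\<^sup>2) =
          (if j < \<kappa> then (exp (- r * g j))\<^sup>2 * energy j \<omega> else 0)"
        by (simp add: \<kappa>(2) energy_def power_mult_distrib sum_distrib_left[symmetric] mult.left_commute)
    qed
    also have "\<dots> = (\<Sum>j<\<kappa>. (exp (- r * g j))\<^sup>2 * energy j \<omega>)"
      using \<kappa>(1) by (rule sum_lessThan_prefix)
    also have "\<dots> \<le> (\<Sum>j<\<kappa>. (exp (\<bar>r\<bar> * T))\<^sup>2 * energy j \<omega>)"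
    proof (intro sum_mono mult_right_mono power_mono)
      fix j assume "j \<in> {..<\<kappa>}"
      then have j: "j < n" using \<kappa>(1) by simp
      then show "exp (- r * g j) \<le> exp (\<bar>r\<bar> * T)"
        by (intro exp_discount_bounds(1)[of 0] g_in) (use horizon_pos in auto)
      show "0 \<le> energy j \<omega>" using g_less[OF j] by (auto simp: energy_def intro!: mult_nonneg_nonneg sum_nonneg)
    qed simp
    also have "\<dots> \<le> (exp (\<bar>r\<bar> * T))\<^sup>2 * k" using \<kappa>(3) by (simp add: sum_distrib_left[symmetric])
    finally show ?thesis .
  qed
  have "(LINT \<omega>|N. e \<omega>) \<le> (exp (\<bar>r\<bar> * T))\<^sup>2 * k"
  \<comment> \<open>A non-integrable e has Bochner integral 0 by default, which is below the bound
    as well, so integrability need not be settled.\<close>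
  proof (cases "integrable N e")
    case True
    then show ?thesis using e_le by (intro N.integral_le_const) auto
  qed (use k in \<open>simp add: not_integrable_integral_eq\<close>)
  then have "moment_bound * (LINT \<omega>|N. e \<omega>) \<le> moment_bound * ((exp (\<bar>r\<bar> * T))\<^sup>2 * k)"
    by (intro mult_left_mono moment_bound_nonneg)
  moreover have "(LINT \<omega>|N. (truncated_integral \<omega>)\<^sup>2) \<le> moment_bound * (LINT \<omega>|N. e \<omega>)"
    unfolding e_def by (rule mt(5)) (use g_in g_less in \<open>auto intro: less_imp_le\<close>)
  ultimately show "(LINT \<omega>|N. (truncated_integral \<omega>)\<^sup>2) \<le> moment_bound * ((exp (\<bar>r\<bar> * T))\<^sup>2 * k)"
    by (rule order_trans[rotated])
qed

text \<open>Links the two sides of the argument: the same random variable is a martingale transform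
  for the moment bounds and a discounted Riemann sum of simple integrals for the comparison with the
  wealth.\<close>

lemma truncated_integral_path:
  obtains \<kappa> where "\<kappa> \<le> n" "truncated_integral \<omega> = (\<Sum>j<\<kappa>. exp (- r * g j) *
      ((\<Sum>i\<in>UNIV. simple_integral (\<lambda>t \<omega>. W' t \<omega> $ i) (hs i) (g (Suc j)) \<omega>) -
       (\<Sum>i\<in>UNIV. simple_integral (\<lambda>t \<omega>. W' t \<omega> $ i) (hs i) (g j) \<omega>)))"
    "(\<Sum>i\<in>UNIV. LINT s:{0..T}|lborel. (simple_value (hs i) s \<omega>)\<^sup>2) \<le> k \<Longrightarrow> \<kappa> = n"
proof -
  obtain \<kappa> where \<kappa>: "\<kappa> \<le> n" "\<And>j i. j < n \<Longrightarrow> truncated_integrand j i \<omega> =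
       (if j < \<kappa> then exp (- r * g j) * simple_value (hs i) (g (Suc j)) \<omega> else 0)"
    "(\<Sum>l<\<kappa>. energy l \<omega>) \<le> k" "(\<Sum>l<n. energy l \<omega>) \<le> k \<Longrightarrow> \<kappa> = n"
    by (rule truncated_integral_prefix[of \<omega>]) (rule that)
  have "truncated_integral \<omega> = (\<Sum>j<n. if j < \<kappa> then
      \<Sum>i\<in>UNIV. (exp (- r * g j) * simple_value (hs i) (g (Suc j)) \<omega>) * (W' (g (Suc j)) \<omega> $ i - W' (g j) \<omega> $ i)
      else 0)"
    unfolding truncated_integral_def by (intro sum.cong refl) (simp add: \<kappa>(2))
  also have "\<dots> = (\<Sum>j<\<kappa>. \<Sum>i\<in>UNIV. (exp (- r * g j) * simple_value (hs i) (g (Suc j)) \<omega>) *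
      (W' (g (Suc j)) \<omega> $ i - W' (g j) \<omega> $ i))"
    using \<kappa>(1) by (rule sum_lessThan_prefix)
  also have "\<dots> = (\<Sum>j<\<kappa>. exp (- r * g j) * (\<Sum>i\<in>UNIV. simple_integral (\<lambda>t \<omega>. W' t \<omega> $ i) (hs i) (g (Suc j)) \<omega> -
      simple_integral (\<lambda>t \<omega>. W' t \<omega> $ i) (hs i) (g j) \<omega>))"
    using \<kappa>(1) by (intro sum.cong refl)
      (simp add: simple_integral_no_jump[OF nj g_less hs] sum_distrib_left mult.assoc)
  finally have "truncated_integral \<omega> = (\<Sum>j<\<kappa>. exp (- r * g j) *
      ((\<Sum>i\<in>UNIV. simple_integral (\<lambda>t \<omega>. W' t \<omega> $ i) (hs i) (g (Suc j)) \<omega>) -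
       (\<Sum>i\<in>UNIV. simple_integral (\<lambda>t \<omega>. W' t \<omega> $ i) (hs i) (g j) \<omega>)))"
    by (simp add: sum_subtractf)
  then show thesis using \<kappa> energy_sum[of \<omega>] by (intro that[of \<kappa>]) auto
qed

end

end

section \<open>Approximating the wealth path by simple integrals\<close>

lemma simple_integral_continuous:
  assumes "continuous_on {0..T} (\<lambda>t. V t \<omega>)" "simple_process F T hs"
  shows "continuous_on {0..T} (\<lambda>u. simple_integral V hs u \<omega>)"
  using assms(2)
proof (induction hs)
  case (Cons h hs)
  obtain s t \<xi> where h: "h = (s, t, \<xi>)" by (cases h)
  have "continuous_on {0..T} (\<lambda>u. V (min c u) \<omega>)" if "0 \<le> c" for c
    using that by (intro continuous_on_compose2[OF assms(1)] continuous_intros) auto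
  then have "continuous_on {0..T} (\<lambda>u. V (min t u) \<omega>)" "continuous_on {0..T} (\<lambda>u. V (min s u) \<omega>)"
    using Cons.prems h by auto
  then show ?case using Cons h by (auto intro!: continuous_intros)
qed simp

lemma uniform_limit_sum:
  fixes f :: "'i \<Rightarrow> 'a \<Rightarrow> 'b \<Rightarrow> 'c::real_normed_vector"
  assumes "\<And>i. i \<in> I \<Longrightarrow> uniform_limit X (f i) (l i) net"
  shows "uniform_limit X (\<lambda>n x. \<Sum>i\<in>I. f i n x) (\<lambda>x. \<Sum>i\<in>I. l i x) net"
  using assms
  by (induction I rule: infinite_finite_induct) (auto intro: uniform_limit_add uniform_limit_const)

lemma progressive_path_measurable:
  assumes "progressive F T K" "0 \<le> T" "\<omega> \<in> space (F T)"
  shows "(\<lambda>s. K s \<omega>) \<in> borel_measurable (restrict_space borel {0..T})"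
proof -
  have "(\<lambda>(s, \<omega>). K s \<omega>) \<in> borel_measurable (restrict_space borel {0..T} \<Otimes>\<^sub>M F T)"
    using assms by (auto simp: progressive_def)
  from measurable_compose[OF measurable_Pair2'[OF assms(3)] this] show ?thesis by simp
qed

lemma progressive_terminal_measurable:
  assumes "progressive F T K" "0 \<le> T"
  shows "K T \<in> borel_measurable (F T)"
proof -
  have "(\<lambda>(s, \<omega>). K s \<omega>) \<in> borel_measurable (restrict_space borel {0..T} \<Otimes>\<^sub>M F T)"
    using assms by (auto simp: progressive_def)
  from measurable_compose[OF measurable_Pair1'[of T] this] show ?thesis
    using assms(2) by (simp add: space_restrict_space)
qed

context bs_market begin

lemma bond_continuous: "continuous_on {0..T} (bond m)"
proof -
  have "(bond m has_real_derivative r * bond m t) (at t within {0..T})" if "t \<in> {0..T}" for t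
    using bs that by (auto simp: black_scholes_market_def)
  then show ?thesis by (intro DERIV_continuous_on)
qed

lemma vol_pos: "0 < vol m $ i"
  using bs by (auto simp: black_scholes_market_def)

lemma drift_div_vol: "drift m $ i / vol m $ i = r / vol m $ i + \<theta> $ i"
  by (simp add: risk_premium_def diff_divide_distrib)

text \<open>The simple integrands \<open>hs\<close> are integrated with respect to the drifted process \<open>W'\<close>, which is
  a martingale under the martingale measure. Their limit \<open>Y\<close> satisfies \<open>dX = r X dt + dY\<close> for the
  wealth \<open>X\<close>.\<close>

definition path_approximation where
  "path_approximation x \<pi> hs \<omega> \<longleftrightarrow> (\<exists>Y C. continuous_on {0..T} (\<lambda>t. wealth m \<pi> t \<omega>) \<and> wealth m \<pi> 0 \<omega> = x \<and>
      (\<forall>s t. 0 \<le> s \<longrightarrow> s \<le> t \<longrightarrow> t \<le> T \<longrightarrow> wealth m \<pi> t \<omega> - wealth m \<pi> s \<omega> =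
         r * integral {s..t} (\<lambda>t. wealth m \<pi> t \<omega>) + (Y t - Y s)) \<and>
      uniform_limit {0..T} (\<lambda>n u. \<Sum>i\<in>UNIV. simple_integral (\<lambda>t \<omega>. W' t \<omega> $ i) (hs i n) u \<omega>) Y sequentially \<and>
      (\<forall>\<^sub>F n in sequentially. (\<Sum>i\<in>UNIV. LINT s:{0..T}|lborel. (simple_value (hs i n) s \<omega>)\<^sup>2) \<le> C))"

lemma self_financing_approximation:
  assumes sf: "self_financing m x \<pi>"
  obtains hs :: "'n \<Rightarrow> nat \<Rightarrow> 'w simple" where
    "\<And>i n. simple_process F T (hs i n)"
    "AE \<omega> in P. path_approximation x \<pi> hs \<omega>"
proof -
  obtain G where G: "\<And>i. stock_integral m i (\<lambda>t \<omega>. snd \<pi> t \<omega> $ i) (G i)"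
    and eq: "AE \<omega> in P. \<forall>t\<in>{0..T}. wealth m \<pi> t \<omega> = x +
      (LINT s:{0..t}|lborel. fst \<pi> s \<omega> * (r * bond m s)) + (\<Sum>i\<in>UNIV. G i t \<omega>)"
    and p: "AE \<omega> in P. set_integrable lborel {0..T} (\<lambda>s. fst \<pi> s \<omega>)"
    using sf unfolding self_financing_def by blast
  define K where "K i t \<omega> = snd \<pi> t \<omega> $ i * (stock m t \<omega> $ i * vol m $ i)" for i t \<omega>
  have "\<exists>J. ito_integral P F T (\<lambda>t \<omega>. W t \<omega> $ i) (K i) J \<and> (AE \<omega> in P. \<forall>t\<in>{0..T}.
      G i t \<omega> = (LINT s:{0..t}|lborel. snd \<pi> s \<omega> $ i * (stock m s \<omega> $ i * drift m $ i)) + J t \<omega>)" for i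
    using G[of i] unfolding stock_integral_def K_def[abs_def] .
  from choice[OF allI[OF this]]
  obtain J where *: "\<forall>i. ito_integral P F T (\<lambda>t \<omega>. W t \<omega> $ i) (K i) (J i) \<and> (AE \<omega> in P. \<forall>t\<in>{0..T}.
      G i t \<omega> = (LINT s:{0..t}|lborel. snd \<pi> s \<omega> $ i * (stock m s \<omega> $ i * drift m $ i)) + J i t \<omega>)" ..
  have J: "ito_integral P F T (\<lambda>t \<omega>. W t \<omega> $ i) (K i) (J i)" for i
    using *[THEN spec, of i] by (rule conjunct1)
  have fin: "AE \<omega> in P. \<forall>i. R i \<omega>" if "\<And>i. AE \<omega> in P. R i \<omega>" for R :: "'n \<Rightarrow> 'w \<Rightarrow> bool"
    using that by (rule eventually_all_finite)
  have GJ: "AE \<omega> in P. \<forall>i. \<forall>t\<in>{0..T}.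
      G i t \<omega> = (LINT s:{0..t}|lborel. snd \<pi> s \<omega> $ i * (stock m s \<omega> $ i * drift m $ i)) + J i t \<omega>"
    using *[THEN spec] by (intro fin) (rule conjunct2)
  have Kprog: "progressive F T (K i)" for i using J[of i] by (simp add: ito_integral_def)
  have K2: "AE \<omega> in P. \<forall>i. set_integrable lborel {0..T} (\<lambda>s. (K i s \<omega>)\<^sup>2)"
    using J by (intro fin) (simp add: ito_integral_def)
  have "\<exists>hs. (\<forall>n. simple_process F T (hs n)) \<and> (AE \<omega> in P.
      (\<lambda>n. LINT s:{0..T}|lborel. (simple_value (hs n) s \<omega> - K i s \<omega>)\<^sup>2) \<longlonglongrightarrow> 0 \<and>
      uniform_limit {0..T} (\<lambda>n u. simple_integral (\<lambda>t \<omega>. W t \<omega> $ i) (hs n) u \<omega>) (\<lambda>u. J i u \<omega>) sequentially)" for i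
    using J[of i] by (simp add: ito_integral_def)
  from choice[OF allI[OF this]]
  obtain hs where **: "\<forall>i. (\<forall>n. simple_process F T (hs i n)) \<and> (AE \<omega> in P.
      (\<lambda>n. LINT s:{0..T}|lborel. (simple_value (hs i n) s \<omega> - K i s \<omega>)\<^sup>2) \<longlonglongrightarrow> 0 \<and>
      uniform_limit {0..T} (\<lambda>n u. simple_integral (\<lambda>t \<omega>. W t \<omega> $ i) (hs i n) u \<omega>) (\<lambda>u. J i u \<omega>) sequentially)" ..
  have hs: "simple_process F T (hs i n)" for i n
    using **[THEN spec, of i] by simp
  have lim: "AE \<omega> in P. \<forall>i.
      (\<lambda>n. LINT s:{0..T}|lborel. (simple_value (hs i n) s \<omega> - K i s \<omega>)\<^sup>2) \<longlonglongrightarrow> 0 \<and>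
      uniform_limit {0..T} (\<lambda>n u. simple_integral (\<lambda>t \<omega>. W t \<omega> $ i) (hs i n) u \<omega>) (\<lambda>u. J i u \<omega>) sequentially"
    using **[THEN spec] by (intro fin) (rule conjunct2)
  have Wc: "AE \<omega> in P. continuous_on {0..T} (\<lambda>t. W t \<omega>)"
    using wiener by (auto simp: correlated_wiener_def)
  have "AE \<omega> in P. path_approximation x \<pi> hs \<omega>"
    using GJ K2 lim eq p Wc AE_space
  proof eventually_elim
    case (elim \<omega>)
    then have GJ: "\<And>i t. t \<in> {0..T} \<Longrightarrow> G i t \<omega> =
        (LINT s:{0..t}|lborel. snd \<pi> s \<omega> $ i * (stock m s \<omega> $ i * drift m $ i)) + J i t \<omega>"
      and K2: "\<And>i. set_integrable lborel {0..T} (\<lambda>s. (K i s \<omega>)\<^sup>2)"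
      and lim: "\<And>i. (\<lambda>n. LINT s:{0..T}|lborel. (simple_value (hs i n) s \<omega> - K i s \<omega>)\<^sup>2) \<longlonglongrightarrow> 0"
      and ul: "\<And>i. uniform_limit {0..T} (\<lambda>n u. simple_integral (\<lambda>t \<omega>. W t \<omega> $ i) (hs i n) u \<omega>) (\<lambda>u. J i u \<omega>) sequentially"
      and eq: "\<And>t. t \<in> {0..T} \<Longrightarrow> wealth m \<pi> t \<omega> = x +
        (LINT s:{0..t}|lborel. fst \<pi> s \<omega> * (r * bond m s)) + (\<Sum>i\<in>UNIV. G i t \<omega>)"
      and p: "set_integrable lborel {0..T} (\<lambda>s. fst \<pi> s \<omega>)"
      and Wc: "continuous_on {0..T} (\<lambda>t. W t \<omega>)" and \<omega>: "\<omega> \<in> space P"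
      by auto
    have "\<omega> \<in> space (F T)" using \<omega> space_filt[of T] horizon_pos by simp
    then have Km: "(\<lambda>s. K i s \<omega>) \<in> borel_measurable (restrict_space borel {0..T})" for i
      using progressive_path_measurable[OF Kprog] horizon_pos by simp
    have KI: "set_integrable lborel {0..T} (\<lambda>s. K i s \<omega>)" for i
      using Km K2 by (rule set_integrable_of_square)
    have sv: "set_integrable lborel {0..T} (\<lambda>s. simple_value (hs i n) s \<omega>)"
      "set_integrable lborel {0..T} (\<lambda>s. (simple_value (hs i n) s \<omega>)\<^sup>2)" for i n
    proof -
      obtain B where B: "\<And>u. \<bar>simple_value (hs i n) u \<omega>\<bar> \<le> B"
        using simple_value_path_bounded[of "hs i n" \<omega>] by blast
      then show "set_integrable lborel {0..T} (\<lambda>s. simple_value (hs i n) s \<omega>)"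
        by (intro set_integrable_bounded_Icc) auto
      have "(simple_value (hs i n) u \<omega>)\<^sup>2 \<le> B\<^sup>2" for u
        using power_mono[OF B[of u] abs_ge_zero, of 2] by simp
      then show "set_integrable lborel {0..T} (\<lambda>s. (simple_value (hs i n) s \<omega>)\<^sup>2)"
        by (intro set_integrable_bounded_Icc[of _ "B\<^sup>2"]) auto
    qed
    have dm: "(\<lambda>s. indicator {0..T} s *\<^sub>R (simple_value (hs i n) s \<omega> - K i s \<omega>)\<^sup>2) \<in> borel_measurable lborel" for i n
    proof -
      have "(\<lambda>s. simple_value (hs i n) s \<omega> - K i s \<omega>) \<in> borel_measurable (restrict_space borel {0..T})"
        by (intro borel_measurable_diff Km measurable_restrict_space1 simple_value_path_measurable)
      then have "(\<lambda>s. (simple_value (hs i n) s \<omega> - K i s \<omega>)\<^sup>2) \<in> borel_measurable (restrict_space borel {0..T})"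
        by (rule borel_measurable_power)
      then show ?thesis by (subst (asm) borel_measurable_restrict_space_iff) auto
    qed
    \<comment> \<open>Bochner integrals of non-integrable functions are 0, so the convergence in
      \<open>lim\<close> carries information only once these squares are known to be
      integrable.\<close>
    have sq: "set_integrable lborel {0..T} (\<lambda>s. (simple_value (hs i n) s \<omega> - K i s \<omega>)\<^sup>2)" for i n
      unfolding set_integrable_def
    proof (rule Bochner_Integration.integrable_bound[OF _ dm])
      have "set_integrable lborel {0..T} (\<lambda>s. 2 * (simple_value (hs i n) s \<omega>)\<^sup>2 + 2 * (K i s \<omega>)\<^sup>2)"
        using sv(2)[of i n] K2[of i] by (intro set_integral_add(1)) auto
      then show "integrable lborel (\<lambda>s. indicator {0..T} s *\<^sub>R (2 * (simple_value (hs i n) s \<omega>)\<^sup>2 + 2 * (K i s \<omega>)\<^sup>2))"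
        by (simp add: set_integrable_def)
      have "(a - b)\<^sup>2 \<le> 2 * a\<^sup>2 + 2 * b\<^sup>2" for a b :: real
        using zero_le_power2[of "a + b"] by (simp add: power2_sum power2_diff)
      then show "AE s in lborel. norm (indicator {0..T} s *\<^sub>R (simple_value (hs i n) s \<omega> - K i s \<omega>)\<^sup>2) \<le>
          norm (indicator {0..T} s *\<^sub>R (2 * (simple_value (hs i n) s \<omega>)\<^sup>2 + 2 * (K i s \<omega>)\<^sup>2))"
        by (intro AE_I2) (auto simp: indicator_def)
    qed
    have Wci: "continuous_on {0..T} (\<lambda>t. W t \<omega> $ i)" for i using Wc by (intro continuous_intros)
    \<comment> \<open>\<open>ito_integral\<close> does not mention regularity of J in time;
      continuity and the value 0 at time 0 are inherited from the simple integrals through the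
      uniform limit.\<close>
    have Jc: "continuous_on {0..T} (\<lambda>t. J i t \<omega>)" for i
      using simple_integral_continuous[of T "\<lambda>t \<omega>. W t \<omega> $ i", OF Wci hs]
      by (intro uniform_limit_theorem[OF _ ul]) auto
    have J0: "J i 0 \<omega> = 0" for i
    proof -
      have "(\<lambda>n. simple_integral (\<lambda>t \<omega>. W t \<omega> $ i) (hs i n) 0 \<omega>) \<longlonglongrightarrow> J i 0 \<omega>"
        using tendsto_uniform_limitI[OF ul, of 0] horizon_pos by simp
      then show ?thesis by (simp add: simple_integral_0[OF hs] LIMSEQ_const_iff)
    qed
    define Y where "Y t = (\<Sum>i\<in>UNIV. J i t \<omega> + \<theta> $ i * (LINT s:{0..t}|lborel. K i s \<omega>))" for t
    have X: "wealth m \<pi> t \<omega> = fst \<pi> t \<omega> * bond m t + (\<Sum>i\<in>UNIV. K i t \<omega> / vol m $ i)" for t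
      using vol_pos by (simp add: wealth_def K_def less_imp_neq[symmetric])
    have "snd \<pi> s \<omega> $ i * (stock m s \<omega> $ i * drift m $ i) = K i s \<omega> * (r / vol m $ i + \<theta> $ i)" for s i
      using vol_pos[of i] by (simp add: K_def drift_div_vol[symmetric])
    then have eq': "wealth m \<pi> t \<omega> = x + (LINT s:{0..t}|lborel. fst \<pi> s \<omega> * (r * bond m s)) +
        (\<Sum>i\<in>UNIV. (LINT s:{0..t}|lborel. K i s \<omega> * (r / vol m $ i + \<theta> $ i)) + J i t \<omega>)"
      if "t \<in> {0..T}" for t
      using eq[OF that] GJ[OF that] by simp
    note path = wealth_path[where X = "\<lambda>t. wealth m \<pi> t \<omega>" and \<sigma> = "\<lambda>i. vol m $ i" and \<theta> = "\<lambda>i. \<theta> $ i"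
        and J = "\<lambda>i t. J i t \<omega>", OF horizon_pos p bond_continuous KI X eq' Jc J0, folded Y_def]
    \<comment> \<open>Passing from \<open>W\<close> to \<open>W'\<close> adds \<theta> times the
      time integral of the same simple process; its uniform convergence follows from L^2 convergence
      on the bounded interval.\<close>
    have W'_int: "simple_integral (\<lambda>t \<omega>. W' t \<omega> $ i) (hs i n) u \<omega> =
        simple_integral (\<lambda>t \<omega>. W t \<omega> $ i) (hs i n) u \<omega> + \<theta> $ i * (LINT s:{0..u}|lborel. simple_value (hs i n) s \<omega>)"
      if "u \<in> {0..T}" for i n u
      using that simple_integral_add[of "\<lambda>t \<omega>. W t \<omega> $ i" "\<theta> $ i" "\<lambda>t \<omega>. t" "hs i n" u \<omega>]
      by (simp add: W'_def simple_integral_time[OF hs] mult.commute)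
    have "uniform_limit {0..T} (\<lambda>n u. \<Sum>i\<in>UNIV. simple_integral (\<lambda>t \<omega>. W t \<omega> $ i) (hs i n) u \<omega> +
        \<theta> $ i * (LINT s:{0..u}|lborel. simple_value (hs i n) s \<omega>)) Y sequentially"
      unfolding Y_def
      by (intro uniform_limit_sum uniform_limit_add ul
          bounded_linear.uniform_limit[OF bounded_linear_mult_right] uniform_limit_set_integral[OF horizon_pos KI sv(1) sq lim])
    then have ulY: "uniform_limit {0..T} (\<lambda>n u. \<Sum>i\<in>UNIV. simple_integral (\<lambda>t \<omega>. W' t \<omega> $ i) (hs i n) u \<omega>) Y sequentially"
      by (rule uniform_limit_cong'[THEN iffD1, rotated 2]) (auto simp: W'_int)
    \<comment> \<open>From a^2 <= 2 (a - b)^2 + 2 b^2, where the squared L^2 distance is eventually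
      below 1.\<close>
    define C where "C = (\<Sum>i\<in>UNIV. 2 * 1 + 2 * (LINT s:{0..T}|lborel. (K i s \<omega>)\<^sup>2))"
    have "\<forall>\<^sub>F n in sequentially. \<forall>i. (LINT s:{0..T}|lborel. (simple_value (hs i n) s \<omega> - K i s \<omega>)\<^sup>2) < 1"
      by (intro eventually_all_finite order_tendstoD(2)[OF lim]) simp
    then have "\<forall>\<^sub>F n in sequentially. (\<Sum>i\<in>UNIV. LINT s:{0..T}|lborel. (simple_value (hs i n) s \<omega>)\<^sup>2) \<le> C"
    proof eventually_elim
      case (elim n)
      show ?case unfolding C_def
      proof (rule sum_mono)
        fix i
        have ab: "a\<^sup>2 \<le> 2 * (a - b)\<^sup>2 + 2 * b\<^sup>2" for a b :: real
          using zero_le_power2[of "a - 2 * b"] by (simp add: power2_diff power_mult_distrib)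
        have "(LINT s:{0..T}|lborel. (simple_value (hs i n) s \<omega>)\<^sup>2) \<le>
            (LINT s:{0..T}|lborel. 2 * (simple_value (hs i n) s \<omega> - K i s \<omega>)\<^sup>2 + 2 * (K i s \<omega>)\<^sup>2)"
          using sv(2) sq K2 by (intro set_integral_mono set_integral_add(1) ab) auto
        also have "\<dots> = 2 * (LINT s:{0..T}|lborel. (simple_value (hs i n) s \<omega> - K i s \<omega>)\<^sup>2) +
            2 * (LINT s:{0..T}|lborel. (K i s \<omega>)\<^sup>2)"
          using sq K2 by (subst set_integral_add(2)) auto
        also have "\<dots> \<le> 2 * 1 + 2 * (LINT s:{0..T}|lborel. (K i s \<omega>)\<^sup>2)"
          using elim by (intro add_right_mono mult_left_mono less_imp_le) auto
        finally show "(LINT s:{0..T}|lborel. (simple_value (hs i n) s \<omega>)\<^sup>2) \<le>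
            2 * 1 + 2 * (LINT s:{0..T}|lborel. (K i s \<omega>)\<^sup>2)" .
      qed
    qed
    with path ulY show ?case unfolding path_approximation_def by blast
  qed
  with hs show thesis by (rule that)
qed

end

text \<open>Uniformity in the prefix k is essential: the cutoff index varies with n and with the
  path, so convergence at a fixed index would not suffice. As the mesh tends to 0, uniform
  continuity of X and of the discount factor supplies the oscillation bounds.\<close>

lemma discounted_riemann_sums_converge:
  fixes X Y :: "real \<Rightarrow> real" and Yn :: "nat \<Rightarrow> real \<Rightarrow> real" and g :: "nat \<Rightarrow> nat \<Rightarrow> real"
  assumes g: "\<And>n. g n 0 = 0" "\<And>n j. j \<le> N n \<Longrightarrow> g n j \<in> {0..T}" "\<And>n j. j < N n \<Longrightarrow> g n j < g n (Suc j)"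
      "\<And>n j. j < N n \<Longrightarrow> g n (Suc j) - g n j \<le> inverse (real (Suc n))"
    and X: "continuous_on {0..T} X" and X0: "X 0 = x"
    and eq: "\<And>s t. 0 \<le> s \<Longrightarrow> s \<le> t \<Longrightarrow> t \<le> T \<Longrightarrow> X t - X s = \<rho> * integral {s..t} X + (Y t - Y s)"
    and Yn: "uniform_limit {0..T} Yn Y sequentially" and T: "0 < T" and e: "0 < e"
  shows "\<forall>\<^sub>F n in sequentially. \<forall>k\<le>N n. \<bar>x + (\<Sum>j<k. exp (- \<rho> * g n j) * (Yn n (g n (Suc j)) - Yn n (g n j))) -
    exp (- \<rho> * g n k) * X (g n k)\<bar> \<le> e"
proof -
  have "bounded (X ` {0..T})" using X by (intro compact_imp_bounded compact_continuous_image) auto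
  then obtain B where B: "\<And>t. t \<in> {0..T} \<Longrightarrow> \<bar>X t\<bar> \<le> B" unfolding bounded_real by blast
  have B0: "0 \<le> B" using B[of 0] T by simp
  define C where "C = \<bar>\<rho>\<bar> * (exp (\<bar>\<rho>\<bar> * T) + B) * T + 2 * exp (\<bar>\<rho>\<bar> * T) + \<bar>\<rho>\<bar> * exp (\<bar>\<rho>\<bar> * T) * T"
  have C: "0 \<le> C" unfolding C_def using T B0 by (intro add_nonneg_nonneg mult_nonneg_nonneg) auto
  \<comment> \<open>C is the constant of \<open>discounted_riemann_sum\<close>; C + 1 is positive
    without further argument.\<close>
  define \<eta> where "\<eta> = e / (C + 1)"
  have \<eta>: "0 < \<eta>" "C * \<eta> \<le> e"
  proof -
    show "0 < \<eta>" using e C by (simp add: \<eta>_def)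
    have "C * e \<le> (C + 1) * e" using e by (simp add: algebra_simps)
    then show "C * \<eta> \<le> e" using C by (simp add: \<eta>_def divide_le_eq mult.commute)
  qed
  have "uniformly_continuous_on {0..T} X" using X by (intro compact_uniformly_continuous) auto
  then obtain d1 where d1: "0 < d1" "\<And>s t. s \<in> {0..T} \<Longrightarrow> t \<in> {0..T} \<Longrightarrow> \<bar>s - t\<bar> < d1 \<Longrightarrow> \<bar>X s - X t\<bar> < \<eta>"
    using \<eta>(1) unfolding uniformly_continuous_on_def dist_real_def by metis
  have "uniformly_continuous_on {0..T} (\<lambda>t. exp (- \<rho> * t))"
    by (intro compact_uniformly_continuous continuous_intros) auto
  then obtain d2 where d2: "0 < d2" "\<And>s t. s \<in> {0..T} \<Longrightarrow> t \<in> {0..T} \<Longrightarrow> \<bar>s - t\<bar> < d2 \<Longrightarrow>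
      \<bar>exp (- \<rho> * s) - exp (- \<rho> * t)\<bar> < \<eta>"
    using \<eta>(1) unfolding uniformly_continuous_on_def dist_real_def by metis
  have "\<forall>\<^sub>F n in sequentially. inverse (real (Suc n)) < min d1 d2"
    using d1(1) d2(1) by (intro order_tendstoD(2)[OF LIMSEQ_inverse_real_of_nat]) auto
  moreover have "\<forall>\<^sub>F n in sequentially. \<forall>t\<in>{0..T}. dist (Yn n t) (Y t) < \<eta>"
    using uniform_limitD[OF Yn \<eta>(1)] .
  ultimately show ?thesis
  proof eventually_elim
    case (elim n)
    show ?case
    proof (intro allI impI)
      fix k assume k: "k \<le> N n"
      have near: "s \<in> {0..T} \<and> g n j \<in> {0..T} \<and> g n (Suc j) \<in> {0..T} \<and>
          \<bar>s - g n (Suc j)\<bar> < min d1 d2 \<and> \<bar>g n j - s\<bar> < min d1 d2"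
        if "j < N n" "s \<in> {g n j..g n (Suc j)}" for j s
      proof -
        have "g n j \<in> {0..T}" "g n (Suc j) \<in> {0..T}" using g(2)[of j n] g(2)[of "Suc j" n] that(1) by auto
        moreover have "g n (Suc j) - g n j < min d1 d2" using g(4)[OF that(1)] elim(1) by simp
        ultimately show ?thesis using that(2) by auto
      qed
      have "\<bar>x + (\<Sum>j<k. exp (- \<rho> * g n j) * (Yn n (g n (Suc j)) - Yn n (g n j))) -
          exp (- \<rho> * g n k) * X (g n k)\<bar> \<le> C * \<eta>"
        unfolding C_def
      proof (rule discounted_riemann_sum[where g = "g n" and n = "N n" and Y = Y])
        fix j s assume j: "j < N n" and s: "s \<in> {g n j..g n (Suc j)}"
        show "\<bar>X s - X (g n (Suc j))\<bar> \<le> \<eta>"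
          using d1(2)[of s "g n (Suc j)"] near[OF j s] by (auto intro: less_imp_le)
        show "\<bar>exp (- \<rho> * g n j) - exp (- \<rho> * s)\<bar> \<le> \<eta>"
          using d2(2)[of "g n j" s] near[OF j s] by (auto intro: less_imp_le)
      next
        show "\<bar>Yn n t - Y t\<bar> \<le> \<eta>" if "t \<in> {0..T}" for t
          using elim(2) that by (auto simp: dist_real_def intro: less_imp_le)
      qed (use g k X X0 eq B T \<eta>(1) in auto)
      then show "\<bar>x + (\<Sum>j<k. exp (- \<rho> * g n j) * (Yn n (g n (Suc j)) - Yn n (g n j))) -
          exp (- \<rho> * g n k) * X (g n k)\<bar> \<le> e" using \<eta>(2) by linarith
    qed
  qed
qed

section \<open>The supermartingale inequality\<close>

context bs_market begin

text \<open>Interval endpoints of simple processes are deterministic, so one grid per n serves all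
  coordinates and all paths.\<close>

lemma refining_grids:
  fixes hs :: "'n \<Rightarrow> nat \<Rightarrow> 'w simple"
  assumes hs: "\<And>i n. simple_process F T (hs i n)"
  obtains g len where "\<And>n. g n 0 = 0" "\<And>n. g n (len n) = T" "\<And>n j. j < len n \<Longrightarrow> g n j < g n (Suc j)"
    "\<And>n j. j \<le> len n \<Longrightarrow> g n j \<in> {0..T}" "\<And>n j. j < len n \<Longrightarrow> g n (Suc j) - g n j \<le> inverse (real (Suc n))"
    "\<And>n j i. j < len n \<Longrightarrow> no_jump (hs i n) (g n j) (g n (Suc j))"
proof -
  have "\<exists>gl. fst gl 0 = 0 \<and> fst gl (snd gl) = T \<and> (\<forall>j<snd gl. fst gl j < fst gl (Suc j)) \<and>
      (\<forall>j\<le>snd gl. fst gl j \<in> {0..T}) \<and> (\<forall>j<snd gl. fst gl (Suc j) - fst gl j \<le> inverse (real (Suc n))) \<and>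
      (\<forall>j<snd gl. \<forall>i. no_jump (hs i n) (fst gl j) (fst gl (Suc j)))" for n
  proof -
    define A where "A = (\<Union>i. (\<Union>(s, t, \<xi>)\<in>set (hs i n). {s, t}))"
    have A: "finite A" unfolding A_def by auto
    have "A \<subseteq> {0..T}"
    proof
      fix a assume "a \<in> A"
      then obtain i s t \<xi> where "(s, t, \<xi>) \<in> set (hs i n)" "a = s \<or> a = t" by (auto simp: A_def)
      moreover from this have "0 \<le> s \<and> s \<le> t \<and> t \<le> T" using hs[of i n] by (auto simp: simple_process_def)
      ultimately show "a \<in> {0..T}" by auto
    qed
    then obtain g len where gl: "g 0 = 0" "g len = T" "\<And>j. j < len \<Longrightarrow> g j < g (Suc j)"
      "\<And>j. j \<le> len \<Longrightarrow> g j \<in> {0..T}" "\<And>j. j < len \<Longrightarrow> g (Suc j) - g j \<le> inverse (real (Suc n))"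
      "\<And>j a. j < len \<Longrightarrow> a \<in> A \<Longrightarrow> a \<le> g j \<or> g (Suc j) \<le> a"
      using finite_refining_grid[OF A _ horizon_pos, of "inverse (real (Suc n))"] by (metis inverse_positive_iff_positive of_nat_0_less_iff zero_less_Suc)
    have "no_jump (hs i n) (g j) (g (Suc j))" if "j < len" for i j
      unfolding no_jump_def
    proof (clarify)
      fix s t \<xi> assume "(s, t, \<xi>) \<in> set (hs i n)"
      then have "s \<in> A" "t \<in> A" unfolding A_def by force+
      then show "(s \<le> g j \<or> g (Suc j) \<le> s) \<and> (t \<le> g j \<or> g (Suc j) \<le> t)"
        using gl(6)[OF that] by blast
    qed
    then show ?thesis using gl by (intro exI[of _ "(g, len)"]) auto
  qed
  from choice[OF allI[OF this]] obtain gl where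
    gl: "\<forall>n. fst (gl n) 0 = 0 \<and> fst (gl n) (snd (gl n)) = T \<and> (\<forall>j<snd (gl n). fst (gl n) j < fst (gl n) (Suc j)) \<and>
      (\<forall>j\<le>snd (gl n). fst (gl n) j \<in> {0..T}) \<and>
      (\<forall>j<snd (gl n). fst (gl n) (Suc j) - fst (gl n) j \<le> inverse (real (Suc n))) \<and>
      (\<forall>j<snd (gl n). \<forall>i. no_jump (hs i n) (fst (gl n) j) (fst (gl n) (Suc j)))" ..
  show thesis
    by (rule that[of "\<lambda>n. fst (gl n)" "\<lambda>n. snd (gl n)"]) (use gl in blast)+
qed

lemma admissible_initial_nonneg:
  assumes "admissible m x \<pi>"
  shows "0 \<le> x"
proof -
  have "AE \<omega> in P. wealth m \<pi> 0 \<omega> = x" "AE \<omega> in P. \<forall>t\<in>{0..T}. 0 \<le> wealth m \<pi> t \<omega>"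
    using assms by (auto simp: admissible_def self_financing_def)
  then have "AE \<omega> in P. 0 \<le> x"
    by eventually_elim (use horizon_pos in auto)
  then show ?thesis by (simp add: P.AE_const)
qed

theorem discounted_wealth_supermartingale:
  assumes adm: "admissible m x \<pi>"
  shows "(\<integral>\<^sup>+\<omega>. ennreal (exp (- r * T) * wealth m \<pi> T \<omega>) \<partial>N) \<le> ennreal x"
proof -
  have sf: "self_financing m x \<pi>" using adm by (simp add: admissible_def)
  have x0: "0 \<le> x" using adm by (rule admissible_initial_nonneg)
  obtain hs where hs: "\<And>i n. simple_process F T (hs i n)"
    and path: "AE \<omega> in P. path_approximation x \<pi> hs \<omega>"
    using self_financing_approximation[OF sf] by blast
  obtain g len where g: "\<And>n. g n 0 = 0" "\<And>n. g n (len n) = T" "\<And>n j. j < len n \<Longrightarrow> g n j < g n (Suc j)"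
    "\<And>n j. j \<le> len n \<Longrightarrow> g n j \<in> {0..T}" "\<And>n j. j < len n \<Longrightarrow> g n (Suc j) - g n j \<le> inverse (real (Suc n))"
    "\<And>n j i. j < len n \<Longrightarrow> no_jump (hs i n) (g n j) (g n (Suc j))"
    by (rule refining_grids[of hs]) (rule hs, rule that)
  define S where "S k n = truncated_integral (\<lambda>i. hs i n) (g n) (len n) (real k)" for k n :: nat
  define Yn where "Yn n \<omega> u = (\<Sum>i\<in>UNIV. simple_integral (\<lambda>t \<omega>. W' t \<omega> $ i) (hs i n) u \<omega>)" for n \<omega> u
  have S: "S k n \<in> borel_measurable P" "integrable N (S k n)" "(LINT \<omega>|N. S k n \<omega>) = 0"
    "integrable N (\<lambda>\<omega>. (S k n \<omega>)\<^sup>2)"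
    "(LINT \<omega>|N. (S k n \<omega>)\<^sup>2) \<le> moment_bound * ((exp (\<bar>r\<bar> * T))\<^sup>2 * real k)" for k n
    unfolding S_def by (rule truncated_integral; (fact hs g | simp))+
  have S_path: "\<exists>\<kappa>\<le>len n. S k n \<omega> = (\<Sum>j<\<kappa>. exp (- r * g n j) * (Yn n \<omega> (g n (Suc j)) - Yn n \<omega> (g n j))) \<and>
      ((\<Sum>i\<in>UNIV. LINT s:{0..T}|lborel. (simple_value (hs i n) s \<omega>)\<^sup>2) \<le> real k \<longrightarrow> \<kappa> = len n)" for n k \<omega>
  proof (rule truncated_integral_path[where hs = "\<lambda>i. hs i n" and g = "g n" and n = "len n" and k = "real k" and \<omega> = \<omega>])
    fix \<kappa> assume "\<kappa> \<le> len n"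
      "truncated_integral (\<lambda>i. hs i n) (g n) (len n) (real k) \<omega> = (\<Sum>j<\<kappa>. exp (- r * g n j) *
         ((\<Sum>i\<in>UNIV. simple_integral (\<lambda>t \<omega>. W' t \<omega> $ i) (hs i n) (g n (Suc j)) \<omega>) -
          (\<Sum>i\<in>UNIV. simple_integral (\<lambda>t \<omega>. W' t \<omega> $ i) (hs i n) (g n j) \<omega>)))"
      "(\<Sum>i\<in>UNIV. LINT s:{0..T}|lborel. (simple_value (hs i n) s \<omega>)\<^sup>2) \<le> real k \<Longrightarrow> \<kappa> = len n"
    then show ?thesis unfolding S_def Yn_def by blast
  qed (fact hs g | simp)+
  have [measurable]: "S k n \<in> borel_measurable P" for k n by (rule S(1))
  \<comment> \<open>Cutting off at \<kappa> leaves a value close to the discounted wealth at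
    \<open>g n \<kappa>\<close>, which is nonnegative; this gives the lower bound for every k. Once
    k exceeds the energy bound of the path, eventually nothing is cut off and the limit is the
    discounted terminal wealth.\<close>
  have limits: "AE \<omega> in P. 0 \<le> wealth m \<pi> T \<omega> \<and> (\<forall>k. \<forall>e>0. \<forall>\<^sub>F n in sequentially. - e \<le> x + S k n \<omega>) \<and>
      (\<forall>\<^sub>F k in sequentially. (\<lambda>n. x + S k n \<omega>) \<longlonglongrightarrow> exp (- r * T) * wealth m \<pi> T \<omega>)"
  proof -
    have "AE \<omega> in P. \<forall>t\<in>{0..T}. 0 \<le> wealth m \<pi> t \<omega>" using adm by (simp add: admissible_def)
    with path show ?thesis
    proof eventually_elim
      case (elim \<omega>)
      then obtain Y C where X: "continuous_on {0..T} (\<lambda>t. wealth m \<pi> t \<omega>)" "wealth m \<pi> 0 \<omega> = x"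
        and eq: "\<And>s t. 0 \<le> s \<Longrightarrow> s \<le> t \<Longrightarrow> t \<le> T \<Longrightarrow> wealth m \<pi> t \<omega> - wealth m \<pi> s \<omega> =
          r * integral {s..t} (\<lambda>t. wealth m \<pi> t \<omega>) + (Y t - Y s)"
        and ul: "uniform_limit {0..T} (\<lambda>n u. Yn n \<omega> u) Y sequentially"
        and C: "\<forall>\<^sub>F n in sequentially. (\<Sum>i\<in>UNIV. LINT s:{0..T}|lborel. (simple_value (hs i n) s \<omega>)\<^sup>2) \<le> C"
        unfolding path_approximation_def Yn_def by blast
      have nonneg: "0 \<le> wealth m \<pi> t \<omega>" if "t \<in> {0..T}" for t using elim(2) that by blast
      have conv: "\<forall>\<^sub>F n in sequentially. \<forall>k\<le>len n. \<bar>x + (\<Sum>j<k. exp (- r * g n j) *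
            (Yn n \<omega> (g n (Suc j)) - Yn n \<omega> (g n j))) -
          exp (- r * g n k) * wealth m \<pi> (g n k) \<omega>\<bar> \<le> e" if "0 < e" for e
        by (rule discounted_riemann_sums_converge[where X = "\<lambda>t. wealth m \<pi> t \<omega>" and Y = Y and T = T and N = len])
          (fact g X eq ul horizon_pos that)+
      have "\<forall>\<^sub>F n in sequentially. - e \<le> x + S k n \<omega>" if "0 < e" for k e
        using conv[OF that]
      proof eventually_elim
        case (elim n)
        obtain \<kappa> where \<kappa>: "\<kappa> \<le> len n" "S k n \<omega> = (\<Sum>j<\<kappa>. exp (- r * g n j) *
            (Yn n \<omega> (g n (Suc j)) - Yn n \<omega> (g n j)))"
          using S_path[of n k \<omega>] by blast
        have "\<bar>x + S k n \<omega> - exp (- r * g n \<kappa>) * wealth m \<pi> (g n \<kappa>) \<omega>\<bar> \<le> e"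
          using elim[rule_format, OF \<kappa>(1)] unfolding \<kappa>(2) .
        moreover have "0 \<le> exp (- r * g n \<kappa>) * wealth m \<pi> (g n \<kappa>) \<omega>"
          using nonneg[OF g(4)[OF \<kappa>(1)]] by (intro mult_nonneg_nonneg) auto
        ultimately show ?case by linarith
      qed
      moreover have "\<forall>\<^sub>F k in sequentially. (\<lambda>n. x + S k n \<omega>) \<longlonglongrightarrow> exp (- r * T) * wealth m \<pi> T \<omega>"
      proof -
        obtain k0 :: nat where k0: "C \<le> k0" using real_arch_simple by blast
        show ?thesis
          using eventually_ge_at_top[of k0]
        proof eventually_elim
          case (elim k)
          have Ck: "C \<le> real k" using k0 elim by linarith
          show ?case
          proof (rule tendstoI)
            fix e :: real assume "0 < e"
            then have "0 < e / 2" by simp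
            from conv[OF this] C show "\<forall>\<^sub>F n in sequentially. dist (x + S k n \<omega>) (exp (- r * T) * wealth m \<pi> T \<omega>) < e"
            proof eventually_elim
              case (elim n)
              obtain \<kappa> where \<kappa>: "\<kappa> \<le> len n" "S k n \<omega> = (\<Sum>j<\<kappa>. exp (- r * g n j) *
                  (Yn n \<omega> (g n (Suc j)) - Yn n \<omega> (g n j)))"
                "(\<Sum>i\<in>UNIV. LINT s:{0..T}|lborel. (simple_value (hs i n) s \<omega>)\<^sup>2) \<le> real k \<longrightarrow> \<kappa> = len n"
                using S_path[of n k \<omega>] by blast
              have "\<kappa> = len n" using \<kappa>(3) elim(2) Ck by linarith
              have "\<bar>x + S k n \<omega> - exp (- r * g n \<kappa>) * wealth m \<pi> (g n \<kappa>) \<omega>\<bar> \<le> e / 2"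
                using elim(1)[rule_format, OF \<kappa>(1)] unfolding \<kappa>(2) .
              then have "\<bar>x + S k n \<omega> - exp (- r * T) * wealth m \<pi> T \<omega>\<bar> \<le> e / 2"
                by (simp only: \<open>\<kappa> = len n\<close> g(2))
              then show ?case using \<open>0 < e\<close> by (simp add: dist_real_def)
            qed
          qed
        qed
      qed
      ultimately show ?case using nonneg[of T] horizon_pos by auto
    qed
  qed
  \<comment> \<open>The truncated integrals have mean 0, so the mean of the positive part exceeds x
    by the mean of the negative part f. Now f tends to 0 almost surely and is bounded in L^2, since
    x >= 0 makes f at most the absolute value of \<open>S k n\<close>; hence its mean tends to
    0.\<close>
  have mean: "(\<lambda>n. \<integral>\<^sup>+\<omega>. ennreal (max 0 (x + S k n \<omega>)) \<partial>N) \<longlonglongrightarrow> ennreal x" for k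
  proof -
    define f where "f n \<omega> = max 0 (- (x + S k n \<omega>))" for n \<omega>
    have [measurable]: "f n \<in> borel_measurable P" for n unfolding f_def[abs_def] by measurable
    have f_int: "integrable N (f n)" for n
      unfolding f_def[abs_def] using S(2)[of k n] by (intro Bochner_Integration.integrable_max) auto
    have f_sq: "(f n \<omega>)\<^sup>2 \<le> (S k n \<omega>)\<^sup>2" for n \<omega>
    proof (cases "x + S k n \<omega> < 0")
      case True
      then have "f n \<omega> \<le> - S k n \<omega>" "0 \<le> f n \<omega>" using x0 by (auto simp: f_def)
      from power_mono[OF this, of 2] show ?thesis by simp
    next
      case False
      then have "f n \<omega> = 0" by (simp add: f_def)
      then show ?thesis by simp
    qed
    have f2_int: "integrable N (\<lambda>\<omega>. (f n \<omega>)\<^sup>2)" for n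
      by (rule Bochner_Integration.integrable_bound[OF S(4)[of k n]]) (use f_sq in auto)
    have "(\<lambda>n. LINT \<omega>|N. f n \<omega>) \<longlonglongrightarrow> 0"
    proof (rule nonneg_second_moment_bounded_tendsto_0[OF prob_space_mart_measure _ _ f_int f2_int])
      show "(LINT \<omega>|N. (f n \<omega>)\<^sup>2) \<le> moment_bound * ((exp (\<bar>r\<bar> * T))\<^sup>2 * k)" for n
        by (rule order_trans[OF integral_mono[OF f2_int S(4)[of k n] f_sq] S(5)])
      show "AE \<omega> in N. (\<lambda>n. f n \<omega>) \<longlonglongrightarrow> 0"
      proof (rule AE_mart_measure)
        show "AE \<omega> in P. (\<lambda>n. f n \<omega>) \<longlonglongrightarrow> 0"
          using limits
        proof eventually_elim
          case (elim \<omega>)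
          show ?case
          proof (rule tendstoI)
            fix e :: real assume "0 < e"
            then have "0 < e / 2" by simp
            with elim have "\<forall>\<^sub>F n in sequentially. - (e / 2) \<le> x + S k n \<omega>" by blast
            then show "\<forall>\<^sub>F n in sequentially. dist (f n \<omega>) 0 < e"
              by eventually_elim (use \<open>0 < e\<close> in \<open>auto simp: f_def\<close>)
          qed
        qed
      qed
    qed (auto simp: f_def)
    then have "(\<lambda>n. ennreal (x + (LINT \<omega>|N. f n \<omega>))) \<longlonglongrightarrow> ennreal (x + 0)"
      by (intro tendsto_ennrealI tendsto_intros)
    moreover have "(\<integral>\<^sup>+\<omega>. ennreal (max 0 (x + S k n \<omega>)) \<partial>N) = ennreal (x + (LINT \<omega>|N. f n \<omega>))" for n
    proof -
      have eq: "max 0 (x + S k n \<omega>) = x + S k n \<omega> + f n \<omega>" for \<omega> by (simp add: f_def)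
      have "(\<integral>\<^sup>+\<omega>. ennreal (max 0 (x + S k n \<omega>)) \<partial>N) = ennreal (LINT \<omega>|N. max 0 (x + S k n \<omega>))"
        unfolding eq using S(2)[of k n] f_int[of n]
        by (intro nn_integral_eq_integral) (auto simp: eq[symmetric])
      also have "(LINT \<omega>|N. max 0 (x + S k n \<omega>)) = x + (LINT \<omega>|N. f n \<omega>)"
        unfolding eq using S(2,3)[of k n] f_int[of n] N.prob_space by simp
      finally show ?thesis .
    qed
    ultimately show ?thesis by simp
  qed
  \<comment> \<open>A lower limit, because for small k the sequence need not converge: the cutoff
    may vary with n.\<close>
  define L where "L k \<omega> = liminf (\<lambda>n. ennreal (max 0 (x + S k n \<omega>)))" for k \<omega>
  have [measurable]: "L k \<in> borel_measurable P" for k unfolding L_def by measurable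
  have L_le: "(\<integral>\<^sup>+\<omega>. L k \<omega> \<partial>N) \<le> ennreal x" for k
  proof -
    have "(\<integral>\<^sup>+\<omega>. L k \<omega> \<partial>N) \<le> liminf (\<lambda>n. \<integral>\<^sup>+\<omega>. ennreal (max 0 (x + S k n \<omega>)) \<partial>N)"
      unfolding L_def by (rule nn_integral_liminf) measurable
    also have "\<dots> = ennreal x" by (rule lim_imp_Liminf[OF _ mean]) simp
    finally show ?thesis .
  qed
  have "AE \<omega> in P. ennreal (exp (- r * T) * wealth m \<pi> T \<omega>) = liminf (\<lambda>k. L k \<omega>)"
    using limits
  proof eventually_elim
    case (elim \<omega>)
    have "\<forall>\<^sub>F k in sequentially. L k \<omega> = ennreal (exp (- r * T) * wealth m \<pi> T \<omega>)"
      using elim[THEN conjunct2, THEN conjunct2]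
    proof eventually_elim
      case (elim k)
      have "(\<lambda>n. ennreal (max 0 (x + S k n \<omega>))) \<longlonglongrightarrow> ennreal (max 0 (exp (- r * T) * wealth m \<pi> T \<omega>))"
        by (intro tendsto_ennrealI tendsto_max tendsto_const elim)
      then show ?case
        unfolding L_def using \<open>0 \<le> wealth m \<pi> T \<omega> \<and> _\<close> by (subst lim_imp_Liminf) (auto simp: max_absorb2)
    qed
    then have "(\<lambda>k. L k \<omega>) \<longlonglongrightarrow> ennreal (exp (- r * T) * wealth m \<pi> T \<omega>)"
      by (rule tendsto_eventually)
    then show ?case by (simp add: lim_imp_Liminf)
  qed
  then have "(\<integral>\<^sup>+\<omega>. ennreal (exp (- r * T) * wealth m \<pi> T \<omega>) \<partial>N) = (\<integral>\<^sup>+\<omega>. liminf (\<lambda>k. L k \<omega>) \<partial>N)"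
    by (intro nn_integral_cong_AE AE_mart_measure)
  also have "\<dots> \<le> liminf (\<lambda>k. \<integral>\<^sup>+\<omega>. L k \<omega> \<partial>N)" by (rule nn_integral_liminf) measurable
  also have "\<dots> \<le> liminf (\<lambda>k. ennreal x)" using L_le by (intro Liminf_mono always_eventually allI)
  finally show ?thesis by (simp add: Liminf_const)
qed

end

text \<open>l and I are controlled on the half line only; composing with \<open>max 0\<close>
  extends them continuously without changing the values that occur.\<close>

lemma continuous_on_nonneg_borel_measurable:
  fixes h :: "real \<Rightarrow> real"
  assumes h: "continuous_on {0..} h" and f: "f \<in> borel_measurable M" and nonneg: "\<And>\<omega>. \<omega> \<in> space M \<Longrightarrow> 0 \<le> f \<omega>"
  shows "(\<lambda>\<omega>. h (f \<omega>)) \<in> borel_measurable M"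
proof -
  have "continuous_on UNIV (\<lambda>y. h (max 0 y))"
    by (intro continuous_on_compose2[OF h] continuous_intros) auto
  then have "(\<lambda>\<omega>. h (max 0 (f \<omega>))) \<in> borel_measurable M"
    by (intro measurable_compose[OF f] borel_measurable_continuous_onI)
  then show ?thesis
    by (rule measurable_cong[THEN iffD1, rotated]) (simp add: nonneg max_absorb2)
qed

section \<open>Optimal partial hedging\<close>

locale hedging = bs_market +
  fixes l :: "real \<Rightarrow> real" and H :: "'a \<Rightarrow> real"
  assumes complete: "complete_market m" and loss: "loss_function l" and claim: "contingent_claim m l H"
begin

abbreviation Z where "Z \<equiv> mart_density m"

text \<open>For c >= 0 this is the shortfall (1 - \<phi>_c) H, written without the quotient by
  H.\<close>

definition residual where "residual c \<omega> = min (inv_deriv l (c * Z \<omega>)) (H \<omega>)"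

lemma H_nonneg: "\<omega> \<in> space P \<Longrightarrow> 0 \<le> H \<omega>"
  and H_measurable_filt: "H \<in> borel_measurable (F T)"
  and integrable_l_H: "integrable P (\<lambda>\<omega>. l (H \<omega>))"
  using claim by (auto simp: contingent_claim_def)

lemma H_measurable [measurable]: "H \<in> borel_measurable P"
  by (rule filt_measurable_prob[OF H_measurable_filt]) (use horizon_pos in simp)

lemma integral_mart_measure:
  assumes "f \<in> borel_measurable P"
  shows "integrable N f \<longleftrightarrow> integrable P (\<lambda>\<omega>. Z \<omega> * f \<omega>)" and "(LINT \<omega>|N. f \<omega>) = (LINT \<omega>|P. Z \<omega> * f \<omega>)"
  unfolding mart_measure_def using assms mart_density_pos
  by (auto simp: integrable_density integral_density less_imp_le)

lemma integrable_H: "integrable N H"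
proof -
  have "integrable P (\<lambda>\<omega>. exp (r * T) * (exp (- r * T) * Z \<omega> * H \<omega>))"
    using claim unfolding contingent_claim_def by (intro integrable_mult_right) auto
  also have "(\<lambda>\<omega>. exp (r * T) * (exp (- r * T) * Z \<omega> * H \<omega>)) = (\<lambda>\<omega>. Z \<omega> * H \<omega>)"
    by (simp add: mult.assoc[symmetric] exp_add[symmetric])
  finally show ?thesis by (simp add: integral_mart_measure(1))
qed

lemma residual_measurable_filt:
  assumes "0 \<le> c"
  shows "residual c \<in> borel_measurable (F T)"
proof -
  have "(\<lambda>\<omega>. inv_deriv l (c * Z \<omega>)) \<in> borel_measurable (F T)"
    by (rule continuous_on_nonneg_borel_measurable[OF inv_deriv_continuous[OF loss]])
      (use mart_density_measurable_filt mart_density_pos assms in \<open>auto simp: less_imp_le\<close>)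
  then show ?thesis unfolding residual_def[abs_def] using H_measurable_filt by simp
qed

lemma residual_measurable: "0 \<le> c \<Longrightarrow> residual c \<in> borel_measurable P"
  by (rule filt_measurable_prob[OF residual_measurable_filt]) (use horizon_pos in auto)

lemma residual_bounds:
  assumes "0 \<le> c" "\<omega> \<in> space P"
  shows "0 \<le> residual c \<omega>" "residual c \<omega> \<le> H \<omega>"
proof -
  have "0 \<le> c * Z \<omega>" using assms mart_density_pos[of \<omega>] by simp
  then show "0 \<le> residual c \<omega>" "residual c \<omega> \<le> H \<omega>"
    using inv_deriv_nonneg[OF loss] H_nonneg[OF assms(2)] by (auto simp: residual_def)
qed

lemma residual_eq:
  assumes "0 \<le> c" "\<omega> \<in> space P"
  shows "(1 - test_fun m l H c \<omega>) * H \<omega> = residual c \<omega>"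
proof (cases "0 < H \<omega>")
  case True
  then show ?thesis by (auto simp: test_fun_def residual_def min_def field_simps)
next
  case False
  then have "H \<omega> = 0" using H_nonneg[OF assms(2)] by simp
  then show ?thesis using residual_bounds[OF assms] by simp
qed

lemma l_residual_measurable: "0 \<le> c \<Longrightarrow> (\<lambda>\<omega>. l (residual c \<omega>)) \<in> borel_measurable P"
  by (rule continuous_on_nonneg_borel_measurable[OF loss_function_continuous[OF loss] residual_measurable])
    (auto simp: residual_bounds)

lemma l_residual_bounds:
  assumes "0 \<le> c" "\<omega> \<in> space P"
  shows "0 \<le> l (residual c \<omega>)" "l (residual c \<omega>) \<le> l (H \<omega>)"
  using residual_bounds[OF assms] loss loss_function_mono[OF loss] by (auto simp: loss_function_def)

lemma integrable_l_residual: "0 \<le> c \<Longrightarrow> integrable P (\<lambda>\<omega>. l (residual c \<omega>))"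
  by (rule Bochner_Integration.integrable_bound[OF integrable_l_H l_residual_measurable])
    (auto intro!: AE_I2 order_trans[OF _ abs_ge_self] simp: l_residual_bounds)

lemma integrable_residual: "0 \<le> c \<Longrightarrow> integrable N (residual c)"
  by (rule Bochner_Integration.integrable_bound[OF integrable_H])
    (use residual_measurable residual_bounds in \<open>auto intro!: AE_I2 order_trans[OF _ abs_ge_self]\<close>)

lemma Psi1_eq: "0 \<le> c \<Longrightarrow> Psi1 m l H c = (LINT \<omega>|P. l (residual c \<omega>))"
  unfolding Psi1_def by (intro Bochner_Integration.integral_cong) (auto simp: residual_eq)

lemma Psi2_eq:
  assumes "0 \<le> c"
  shows "Psi2 m l H c = (LINT \<omega>|N. H \<omega> - residual c \<omega>)"
  unfolding Psi2_def
proof (intro Bochner_Integration.integral_cong refl)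
  fix \<omega> assume "\<omega> \<in> space N"
  then show "H \<omega> * test_fun m l H c \<omega> = H \<omega> - residual c \<omega>"
    using residual_eq[OF assms, of \<omega>] by (simp add: algebra_simps)
qed

lemma Psi1_0: "Psi1 m l H 0 = 0"
proof -
  have "Psi1 m l H 0 = (LINT \<omega>|P. 0)"
    unfolding Psi1_eq[OF order_refl]
    using H_nonneg loss by (intro Bochner_Integration.integral_cong) (auto simp: residual_def loss_function_def)
  then show ?thesis by simp
qed

lemma Psi1_continuous: "continuous_on {0..} (Psi1 m l H)"
  unfolding continuous_on_sequentially
proof (intro allI ballI impI, elim conjE)
  fix u and c :: real assume c: "c \<in> {0..}" and u: "\<forall>n. u n \<in> {0..}" "u \<longlonglongrightarrow> c"
  have "(\<lambda>n. LINT \<omega>|P. l (residual (u n) \<omega>)) \<longlonglongrightarrow> (LINT \<omega>|P. l (residual c \<omega>))"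
  proof (rule integral_dominated_convergence[where w = "\<lambda>\<omega>. l (H \<omega>)"])
    show "AE \<omega> in P. (\<lambda>n. l (residual (u n) \<omega>)) \<longlonglongrightarrow> l (residual c \<omega>)"
    proof (intro AE_I2)
      fix \<omega> assume \<omega>: "\<omega> \<in> space P"
      have Z0: "0 \<le> Z \<omega>" using mart_density_pos[of \<omega>] by simp
      have "(\<lambda>n. inv_deriv l (u n * Z \<omega>)) \<longlonglongrightarrow> inv_deriv l (c * Z \<omega>)"
        by (rule continuous_on_tendsto_compose[OF inv_deriv_continuous[OF loss]])
          (use u c Z0 in \<open>auto intro!: tendsto_intros\<close>)
      then have "(\<lambda>n. residual (u n) \<omega>) \<longlonglongrightarrow> residual c \<omega>"
        unfolding residual_def by (intro tendsto_min tendsto_const)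
      then show "(\<lambda>n. l (residual (u n) \<omega>)) \<longlonglongrightarrow> l (residual c \<omega>)"
        by (rule continuous_on_tendsto_compose[OF loss_function_continuous[OF loss]])
          (use u c \<omega> residual_bounds in auto)
    qed
    show "AE \<omega> in P. norm (l (residual (u n) \<omega>)) \<le> l (H \<omega>)" for n
      using u(1) l_residual_bounds[of "u n"] by (intro AE_I2) auto
  qed (use u(1) c l_residual_measurable integrable_l_H in auto)
  then show "(Psi1 m l H \<circ> u) \<longlonglongrightarrow> Psi1 m l H c"
    using u(1) c by (simp add: Psi1_eq comp_def)
qed

text \<open>Since Z > 0, I(n Z) tends to infinity at every sample point, so the residual eventually
  equals H; l(H) dominates.\<close>

lemma Psi1_at_top: "(\<lambda>n. Psi1 m l H (real n)) \<longlonglongrightarrow> (LINT \<omega>|P. l (H \<omega>))"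
proof -
  have "(\<lambda>n. LINT \<omega>|P. l (residual (real n) \<omega>)) \<longlonglongrightarrow> (LINT \<omega>|P. l (H \<omega>))"
  proof (rule integral_dominated_convergence[where w = "\<lambda>\<omega>. l (H \<omega>)"])
    show "AE \<omega> in P. (\<lambda>n. l (residual (real n) \<omega>)) \<longlonglongrightarrow> l (H \<omega>)"
    proof (intro AE_I2)
      fix \<omega>
      have "filterlim (\<lambda>n. real n * Z \<omega>) at_top sequentially"
        by (rule filterlim_at_top_mult_tendsto_pos[OF tendsto_const mart_density_pos filterlim_real_sequentially])
      from filterlim_compose[OF inv_deriv_at_top[OF loss] this]
      have "\<forall>\<^sub>F n in sequentially. H \<omega> \<le> inv_deriv l (real n * Z \<omega>)"
        by (simp add: filterlim_at_top)
      then have "\<forall>\<^sub>F n in sequentially. l (residual (real n) \<omega>) = l (H \<omega>)"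
        by eventually_elim (simp add: residual_def min_absorb2)
      then show "(\<lambda>n. l (residual (real n) \<omega>)) \<longlonglongrightarrow> l (H \<omega>)" by (rule tendsto_eventually)
    qed
    show "AE \<omega> in P. norm (l (residual (real n) \<omega>)) \<le> l (H \<omega>)" for n
      using l_residual_bounds[of "real n"] by (intro AE_I2) auto
  qed (use l_residual_measurable integrable_l_H in auto)
  then show ?thesis by (simp add: Psi1_eq)
qed

text \<open>Intermediate values between \<open>Psi1\<close> at 0, which is 0, and its limit E[l(H)].
  The limit itself need not be attained, hence the strict upper bound on v.\<close>

lemma Psi1_solvable:
  assumes v: "0 \<le> v" "v < (LINT \<omega>|P. l (H \<omega>))"
  shows "\<exists>c\<ge>0. Psi1 m l H c = v"
proof -
  obtain n where n: "v < Psi1 m l H (real n)"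
    using eventually_happens[OF order_tendstoD(1)[OF Psi1_at_top v(2)]] by auto
  have "\<exists>c\<ge>0. c \<le> real n \<and> Psi1 m l H c = v"
    using v(1) n Psi1_0 by (intro IVT' continuous_on_subset[OF Psi1_continuous]) auto
  then show ?thesis by blast
qed

section \<open>Feasible initial capital\<close>

lemma feasible_nonneg: "x \<in> feasible_costs m l H v \<Longrightarrow> 0 \<le> x"
  unfolding feasible_costs_def using admissible_initial_nonneg by blast

lemma feasible_cost_of_residual:
  assumes c: "0 \<le> c" and v: "Psi1 m l H c \<le> v"
  shows "exp (- r * T) * Psi2 m l H c \<in> feasible_costs m l H v"
proof -
  define G where "G \<omega> = H \<omega> - residual c \<omega>" for \<omega>
  have "G \<in> borel_measurable (F T)" unfolding G_def[abs_def]
    using residual_measurable_filt[OF c] H_measurable_filt by simp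
  moreover have "\<forall>\<omega>\<in>space P. 0 \<le> G \<omega>" using residual_bounds[OF c] by (auto simp: G_def)
  moreover have "integrable N (\<lambda>\<omega>. exp (- r * T) * G \<omega>)"
    unfolding G_def using integrable_H integrable_residual[OF c] by simp
  ultimately obtain \<pi> where \<pi>: "admissible m (LINT \<omega>|N. exp (- r * T) * G \<omega>) \<pi>"
    and X: "AE \<omega> in P. wealth m \<pi> T \<omega> = G \<omega>"
    using complete unfolding complete_market_def by blast
  have "(\<integral>\<^sup>+\<omega>. ennreal (l (max (H \<omega> - wealth m \<pi> T \<omega>) 0)) \<partial>P) = (\<integral>\<^sup>+\<omega>. ennreal (l (residual c \<omega>)) \<partial>P)"
  proof (rule nn_integral_cong_AE)
    show "AE \<omega> in P. ennreal (l (max (H \<omega> - wealth m \<pi> T \<omega>) 0)) = ennreal (l (residual c \<omega>))"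
      using X AE_space
    proof eventually_elim
      case (elim \<omega>)
      then show ?case using residual_bounds[OF c elim(2)] by (simp add: G_def max_absorb1)
    qed
  qed
  also have "\<dots> = ennreal (Psi1 m l H c)"
    unfolding Psi1_eq[OF c] using c l_residual_bounds
    by (intro nn_integral_eq_integral integrable_l_residual) auto
  also have "\<dots> \<le> ennreal v" using v by (rule ennreal_leI)
  finally have "(\<integral>\<^sup>+\<omega>. ennreal (l (max (H \<omega> - wealth m \<pi> T \<omega>) 0)) \<partial>P) \<le> ennreal v" .
  moreover have "(LINT \<omega>|N. exp (- r * T) * G \<omega>) = exp (- r * T) * Psi2 m l H c"
    by (simp add: G_def Psi2_eq[OF c])
  then have "admissible m (exp (- r * T) * Psi2 m l H c) \<pi>" using \<pi> by simp
  ultimately show ?thesis unfolding feasible_costs_def by blast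
qed

lemma wealth_terminal_measurable:
  assumes "self_financing m x \<pi>"
  shows "wealth m \<pi> T \<in> borel_measurable P"
proof -
  have T: "T \<in> {0..T}" using horizon_pos by simp
  have "fst \<pi> T \<in> borel_measurable (F T)" "(\<lambda>\<omega>. snd \<pi> T \<omega> $ i) \<in> borel_measurable (F T)" for i
    using assms progressive_terminal_measurable[of F T] horizon_pos unfolding self_financing_def by auto
  note this[THEN filt_measurable_prob, OF T, measurable]
  have "stock m T \<in> borel_measurable (F T)" using bs T by (auto simp: black_scholes_market_def)
  note this[THEN filt_measurable_prob, OF T, measurable]
  show ?thesis unfolding wealth_def[abs_def] by measurable
qed

lemma feasible_cost_ge:
  assumes c: "0 \<le> c" and x: "x \<in> feasible_costs m l H (Psi1 m l H c)"
  shows "exp (- r * T) * Psi2 m l H c \<le> x"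
proof -
  obtain \<pi> where adm: "admissible m x \<pi>"
    and risk: "(\<integral>\<^sup>+\<omega>. ennreal (l (max (H \<omega> - wealth m \<pi> T \<omega>) 0)) \<partial>P) \<le> ennreal (Psi1 m l H c)"
    using x by (auto simp: feasible_costs_def)
  define X where "X = wealth m \<pi> T"
  define R where "R \<omega> = max (H \<omega> - X \<omega>) 0" for \<omega>
  have [measurable]: "X \<in> borel_measurable P"
    unfolding X_def using adm by (intro wealth_terminal_measurable) (auto simp: admissible_def)
  have [measurable]: "R \<in> borel_measurable P" unfolding R_def[abs_def] by measurable
  have lR [measurable]: "(\<lambda>\<omega>. l (R \<omega>)) \<in> borel_measurable P"
    by (rule continuous_on_nonneg_borel_measurable[OF loss_function_continuous[OF loss]]) (auto simp: R_def)
  have l0: "0 \<le> l (R \<omega>)" for \<omega> using loss by (simp add: loss_function_def R_def)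
  have "AE \<omega> in P. \<forall>t\<in>{0..T}. 0 \<le> wealth m \<pi> t \<omega>" using adm by (simp add: admissible_def)
  then have X0: "AE \<omega> in P. 0 \<le> X \<omega>"
    by eventually_elim (use horizon_pos in \<open>simp add: X_def\<close>)
  \<comment> \<open>The upper bound uses X >= 0, that is, admissibility; it places R in the range
    [0, H] over which the residual is optimal.\<close>
  have R_le: "AE \<omega> in P. 0 \<le> R \<omega> \<and> R \<omega> \<le> H \<omega>"
    using X0 AE_space by eventually_elim (use H_nonneg in \<open>auto simp: R_def\<close>)
  have R_int: "integrable N R"
    by (rule Bochner_Integration.integrable_bound[OF integrable_H _ AE_mart_measure[OF AE_mp[OF R_le]]])
      (auto intro!: AE_I2 order_trans[OF _ abs_ge_self])
  have Psi1_nonneg: "0 \<le> Psi1 m l H c"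
    unfolding Psi1_eq[OF c] using l_residual_bounds[OF c] by (intro Bochner_Integration.integral_nonneg_AE AE_I2) auto
  have lR_int: "integrable P (\<lambda>\<omega>. l (R \<omega>))"
    using risk by (intro integrableI_nonneg lR) (auto simp: l0 X_def[symmetric] R_def[symmetric] intro: order.strict_trans1)
  have lR_le: "(LINT \<omega>|P. l (R \<omega>)) \<le> Psi1 m l H c"
    using risk Psi1_nonneg nn_integral_eq_integral[OF lR_int] l0 by (simp add: X_def[symmetric] R_def[symmetric])
  have key: "(LINT \<omega>|N. R \<omega>) \<le> (LINT \<omega>|N. residual c \<omega>)"
  proof (cases "c = 0")
    case True
    then have "(LINT \<omega>|P. l (R \<omega>)) = 0"
      using lR_le l0 Psi1_0 by (intro antisym) (auto intro: Bochner_Integration.integral_nonneg_AE)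
    then have "AE \<omega> in P. l (R \<omega>) = 0"
      using integral_nonneg_eq_0_iff_AE[OF lR_int] l0 by simp
    then have "AE \<omega> in P. R \<omega> = 0"
      using R_le by eventually_elim (metis loss_function_pos[OF loss] order_le_less less_irrefl)
    then have "(LINT \<omega>|N. R \<omega>) = (LINT \<omega>|N. 0)"
      by (intro integral_cong_AE AE_mart_measure) auto
    also have "\<dots> \<le> (LINT \<omega>|N. residual c \<omega>)"
      using residual_bounds[OF c] by (simp, intro Bochner_Integration.integral_nonneg_AE AE_I2) simp
    finally show ?thesis .
  next
    case False
    then have c0: "0 < c" using c by simp
    have ZR: "integrable P (\<lambda>\<omega>. Z \<omega> * R \<omega>)" "(LINT \<omega>|N. R \<omega>) = (LINT \<omega>|P. Z \<omega> * R \<omega>)"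
      using R_int by (simp_all add: integral_mart_measure)
    have Zres: "integrable P (\<lambda>\<omega>. Z \<omega> * residual c \<omega>)" "(LINT \<omega>|N. residual c \<omega>) = (LINT \<omega>|P. Z \<omega> * residual c \<omega>)"
      using integrable_residual[OF c] residual_measurable[OF c] by (simp_all add: integral_mart_measure)
    have "(LINT \<omega>|P. l (residual c \<omega>) - c * (Z \<omega> * residual c \<omega>)) \<le> (LINT \<omega>|P. l (R \<omega>) - c * (Z \<omega> * R \<omega>))"
    proof (rule integral_mono_AE)
      show "AE \<omega> in P. l (residual c \<omega>) - c * (Z \<omega> * residual c \<omega>) \<le> l (R \<omega>) - c * (Z \<omega> * R \<omega>)"
        using R_le
      proof eventually_elim
        case (elim \<omega>)
        have "0 < c * Z \<omega>" using c0 mart_density_pos[of \<omega>] by simp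
        from inv_deriv_minimizes[OF loss this, of "R \<omega>" "H \<omega>"] show ?case
          using elim by (simp add: residual_def mult.assoc)
      qed
    qed (use integrable_l_residual[OF c] lR_int ZR Zres in auto)
    then have "Psi1 m l H c - c * (LINT \<omega>|N. residual c \<omega>) \<le> (LINT \<omega>|P. l (R \<omega>)) - c * (LINT \<omega>|N. R \<omega>)"
      using integrable_l_residual[OF c] lR_int ZR Zres by (simp add: Psi1_eq[OF c])
    \<comment> \<open>The Lagrangian inequality turns the risk constraint into a price comparison; c
      > 0 permits the division that follows.\<close>
    then have "c * (LINT \<omega>|N. R \<omega>) \<le> c * (LINT \<omega>|N. residual c \<omega>)" using lR_le by linarith
    then show ?thesis using c0 by simp
  qed
  have fin: "(\<integral>\<^sup>+\<omega>. ennreal (exp (- r * T) * X \<omega>) \<partial>N) \<le> ennreal x"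
    unfolding X_def by (rule discounted_wealth_supermartingale[OF adm])
  have X0N: "AE \<omega> in N. 0 \<le> exp (- r * T) * X \<omega>"
    by (rule AE_mart_measure) (use X0 in \<open>eventually_elim, simp\<close>)
  have X_int: "integrable N (\<lambda>\<omega>. exp (- r * T) * X \<omega>)"
    by (rule integrableI_nonneg[OF _ X0N order.strict_trans1[OF fin]]) auto
  have "Psi2 m l H c = (LINT \<omega>|N. H \<omega>) - (LINT \<omega>|N. residual c \<omega>)"
    unfolding Psi2_eq[OF c] using integrable_H integrable_residual[OF c] by simp
  also have "\<dots> \<le> (LINT \<omega>|N. H \<omega>) - (LINT \<omega>|N. R \<omega>)" using key by simp
  also have "\<dots> = (LINT \<omega>|N. H \<omega> - R \<omega>)" using integrable_H R_int by simp
  finally have "exp (- r * T) * Psi2 m l H c \<le> exp (- r * T) * (LINT \<omega>|N. H \<omega> - R \<omega>)"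
    by (intro mult_left_mono) auto
  also have "\<dots> = (LINT \<omega>|N. exp (- r * T) * (H \<omega> - R \<omega>))" by simp
  \<comment> \<open>H - R is the minimum of H and X, hence at most X.\<close>
  also have "\<dots> \<le> (LINT \<omega>|N. exp (- r * T) * X \<omega>)"
    using integrable_H R_int X_int by (intro integral_mono) (auto simp: R_def)
  also have "\<dots> \<le> x"
    using fin unfolding nn_integral_eq_integral[OF X_int X0N]
    by (simp only: ennreal_le_iff[OF admissible_initial_nonneg[OF adm]])
  finally show ?thesis .
qed

lemma zero_feasible:
  assumes v: "(LINT \<omega>|P. l (H \<omega>)) \<le> v"
  shows "0 \<in> feasible_costs m l H v"
proof -
  \<comment> \<open>Replicating the payoff 0 costs 0 and leaves all of H as shortfall.\<close>
  obtain \<pi> where \<pi>: "admissible m 0 \<pi>" and X: "AE \<omega> in P. wealth m \<pi> T \<omega> = 0"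
    using complete[unfolded complete_market_def, THEN spec, of "\<lambda>_. 0"] by auto
  have "(\<integral>\<^sup>+\<omega>. ennreal (l (max (H \<omega> - wealth m \<pi> T \<omega>) 0)) \<partial>P) = (\<integral>\<^sup>+\<omega>. ennreal (l (H \<omega>)) \<partial>P)"
    by (rule nn_integral_cong_AE) (use X AE_space in eventually_elim, use H_nonneg in \<open>auto simp: max_absorb1\<close>)
  also have "\<dots> = ennreal (LINT \<omega>|P. l (H \<omega>))"
    using H_nonneg loss by (intro nn_integral_eq_integral integrable_l_H AE_I2) (auto simp: loss_function_def)
  also have "\<dots> \<le> ennreal v" using v by (rule ennreal_leI)
  finally show ?thesis using \<pi> unfolding feasible_costs_def by blast
qed

end

text \<open>A \<open>LEAST\<close> is meaningful only where a minimum exists, so attainment is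
  asserted explicitly. Solvability is asserted too: the formula is claimed for every selection c of
  solutions, and such a selection must exist for it to have content.\<close>

theorem theorem3p9:
  fixes m :: "('w, 'n::finite) market" and l :: "real \<Rightarrow> real" and H :: "'w \<Rightarrow> real"
  assumes "black_scholes_market m" and "complete_market m"
    and "loss_function l" and "contingent_claim m l H"
    and "mono_on {0<..} (deriv (deriv l))"
    and "integrable (prob m) (\<lambda>\<omega>. if H \<omega> = 0 then 0 else deriv l (H \<omega>) * H \<omega>)"
    and "integrable (prob m) (\<lambda>\<omega>. if H \<omega> = 0 then 0 else deriv (deriv l) (H \<omega>) * (H \<omega>)\<^sup>2)"
  defines "L \<equiv> LINT \<omega>|prob m. l (H \<omega>)"
  shows "(\<forall>v\<ge>0. cost_reduction m l H v \<in> feasible_costs m l H v \<and>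
            (\<forall>x\<in>feasible_costs m l H v. cost_reduction m l H v \<le> x)) \<and>
    (\<forall>v\<in>{0..<L}. \<exists>c\<ge>0. Psi1 m l H c = v) \<and>
    (\<forall>c. (\<forall>v\<in>{0..<L}. 0 \<le> c v \<and> Psi1 m l H (c v) = v) \<longrightarrow>
       (\<forall>v\<ge>0. cost_reduction m l H v =
          (if v < L then exp (- rate m * horizon m) * Psi2 m l H (c v) else 0)))"
proof -
  interpret hedging m l H
    using assms(1-4) by unfold_locales
  have least: "cost_reduction m l H v = x"
    if "x \<in> feasible_costs m l H v" "\<And>y. y \<in> feasible_costs m l H v \<Longrightarrow> x \<le> y" for v x
    unfolding cost_reduction_def using that by (rule Least_equality)
  have small: "exp (- r * T) * Psi2 m l H c \<in> feasible_costs m l H v"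
    "\<And>y. y \<in> feasible_costs m l H v \<Longrightarrow> exp (- r * T) * Psi2 m l H c \<le> y"
    if "0 \<le> c" "Psi1 m l H c = v" for c v
    using feasible_cost_of_residual[OF that(1)] feasible_cost_ge[OF that(1)] that(2) by auto
  have large: "0 \<in> feasible_costs m l H v" "\<And>y. y \<in> feasible_costs m l H v \<Longrightarrow> 0 \<le> y"
    if "L \<le> v" for v
    using zero_feasible feasible_nonneg that by (auto simp: L_def)
  have solvable: "\<exists>c\<ge>0. Psi1 m l H c = v" if "0 \<le> v" "v < L" for v
    using Psi1_solvable that by (simp add: L_def)
  have "cost_reduction m l H v \<in> feasible_costs m l H v \<and>
      (\<forall>x\<in>feasible_costs m l H v. cost_reduction m l H v \<le> x)" if "0 \<le> v" for v
  proof (cases "v < L")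
    case True
    from solvable[OF that this] obtain c where c: "0 \<le> c" "Psi1 m l H c = v" by blast
    show ?thesis using least[OF small[OF c]] small[OF c] by simp
  next
    case False
    then have v: "L \<le> v" by simp
    show ?thesis using least[OF large[OF v]] large[OF v] by simp
  qed
  moreover have "cost_reduction m l H v = (if v < L then exp (- r * T) * Psi2 m l H (c v) else 0)"
    if c: "\<forall>v\<in>{0..<L}. 0 \<le> c v \<and> Psi1 m l H (c v) = v" and v: "0 \<le> v" for c v
  proof (cases "v < L")
    case True
    then show ?thesis using least[OF small[of "c v" v]] c v by simp
  next
    case False
    then show ?thesis using least[OF large[of v]] by simp
  qed
  ultimately show ?thesis using solvable by auto
qed

end
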